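(* Let $Q(x,y,z)$ be an irreducible real quadratic form. Let $\mathcal S_Q^{\mathbb R}=\{Q=1\}\subset\mathbb R^3$ be the real quadratic surface, equipped with a measure $dm$ for which any polynomial in $x,y,z$ is an $L_2$-integrable function on the surface. Let $f$ be an $L_2$-integrable continuous real-valued function on $\mathcal S_Q^{\mathbb R}$. Then there exists a sequence of multipoles $\{w_k^f\in\overline{\mathcal M}^{\mathbb R}(k)\}_{0\le k<+\infty}$ such that: (1) the sequence gives rise, via the maps $\overline\Phi_Q^{\mathbb R}$, to real polynomials $P_d^f(x,y,z)=\sum_{k=0}^d\overline\Phi_Q^{\mathbb R}(w_k^f)$, where the mutually orthogonal polynomials $\overline\Phi_Q^{\mathbb R}(w_k^f)$ are uniquely determined by $f$; (2) as $d\to\infty$, the polynomials $P_d^f$ converge to $f$ in the space $L_2(\mathcal S_Q^{\mathbb R})$; (3) the multipoles satisfy $\sum_{k=0}^\infty\sin^2(\theta_k)\cdot\rho(w_k^f,\mathbf 0)^2<\infty$. When $Q$ is positive-definite, moreover: (4) the mutually orthogonal polynomials $\overline\Phi_Q^{\mathbb R}(w_k^f)$ belong to $Har_Q(k;\mathbb R)$; (5) each multipole $w_k^f$ is uniquely determined by $f$; (6) for any continuous deformation $\{f_t\in C(\mathcal S_Q^{\mathbb R})\}_{0\le t\le1}$ of the function $f=f_0$, there exists a unique continuous deformation $\{w_k^{f_t}\in\overline{\mathcal M}^{\mathbb R}(k)\}$ of the $f_t$-representing multipoles such that $w_k^{f_0}=w_k^f$.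
   Context: $V(k;\mathbb R)$ is the space of real homogeneous polynomials of degree $k$ in $x,y,z$ with inner product $\langle f,g\rangle=\int_{\mathcal S_Q^{\mathbb R}}fg\,dm$ and norm $\|\cdot\|$; $V_Q(k;\mathbb R)$ is the subspace of those divisible by $Q$ and $V_Q^\perp(k;\mathbb R)$ its orthogonal complement in $V(k;\mathbb R)$. With $Q(v)=vBv^T$, $\Delta_Q=\sum b^{ij}\partial_i\partial_j$, $(b^{ij})=B^{-1}$, and $Har_Q(k;\mathbb R)=Ker(\Delta_Q)\cap V(k;\mathbb R)$. $\mathcal M^{\mathbb R}(k)=[\mathbb R^3\setminus0]^k/\Sigma_k^{\mathbb R}$, where $\mathbb R^3$ is the space of real linear forms and $\Sigma_k^{\mathbb R}$ is generated by permutations of factors and by rescalings $(\lambda_\nu)\in(\mathbb R^\ast)^k$ with $\prod\lambda_\nu=1$; $\overline{\mathcal M}^{\mathbb R}(k)$ adds the zero multipole $\mathbf 0$ (for $k=0$, multipoles are just real constants). $\Theta$ sends the class of $(L_1,\dots,L_k)$ to $\prod L_\nu\in V(k;\mathbb R)$ and $\mathbf 0$ to $0$; $\mathcal{F}act(k;\mathbb R)$ denotes the set of products of $k$ non-zero real linear forms. $\overline\Phi_Q^{\mathbb R}:\overline{\mathcal M}^{\mathbb R}(k)\to V_Q^\perp(k;\mathbb R)$ is $\Theta$ followed by orthogonal projection. $\rho(w,\mathbf 0)=\|\Theta(w)\|$. $\theta_k\in(0,\pi/2]$ is the minimal angle between vectors of $\mathcal{F}act(k;\mathbb R)$ and non-zero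 vectors of $V_Q(k;\mathbb R)$ ($\theta_k=\pi/2$ if $V_Q(k;\mathbb R)=0$). The multipoles $w_k$ are $f$-representing if $\overline\Phi_Q^{\mathbb R}(w_k)=f_k$ for all $k$, where $f=\sum_kf_k$, $f_k\in V_Q^\perp(k;\mathbb R)$, is the orthogonal decomposition of $f$ in $L_2(\mathcal S_Q^{\mathbb R})$.
   Formalization: Added on dm, since the claim fails for arbitrary dm: odd-degree forms have integral zero; polynomials are dense in L_2 when the surface is non-compact; and, for (4) only, dm is invariant under the orthogonal group of Q. The inner product on each V(k;R) is taken as definite, as in the context. *)

theory Defs
  imports "HOL-Analysis.Analysis" "HOL-Combinatorics.Permutations"
begin

section \<open>Quadratic forms, quadratic surfaces and polynomials\<close>

text \<open>
  Real polynomials in three variables are identified with polynomial functions on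
  \<open>real^3\<close>, which is harmless because the field of coefficients is infinite.
\<close>

definition qform :: "real^3^3 \<Rightarrow> real^3 \<Rightarrow> real" where
  "qform B v = v \<bullet> (B *v v)"

definition qsurface :: "real^3^3 \<Rightarrow> (real^3) set" where
  "qsurface B = {v. qform B v = 1}"

definition pos_def_form :: "real^3^3 \<Rightarrow> bool" where
  "pos_def_form B \<longleftrightarrow> (\<forall>v. v \<noteq> 0 \<longrightarrow> qform B v > 0)"

text \<open>Irreducibility in the ring of real polynomials, whose units are the non-zero constants.\<close>

definition irreducible_poly_fun :: "(real^3 \<Rightarrow> real) \<Rightarrow> bool" where
  "irreducible_poly_fun p \<longleftrightarrow>
     real_polynomial_function p \<and> \<not> p constant_on UNIV \<and>
     (\<forall>g h. real_polynomial_function g \<longrightarrow> real_polynomial_function h \<longrightarrow>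
        p = (\<lambda>v. g v * h v) \<longrightarrow> g constant_on UNIV \<or> h constant_on UNIV)"

definition forms :: "nat \<Rightarrow> (real^3 \<Rightarrow> real) set" where
  "forms k = {p. real_polynomial_function p \<and> (\<forall>c v. p (c *\<^sub>R v) = c ^ k * p v)}"

definition forms_Q :: "real^3^3 \<Rightarrow> nat \<Rightarrow> (real^3 \<Rightarrow> real) set" where
  "forms_Q B k =
     {p \<in> forms k. \<exists>g. real_polynomial_function g \<and> p = (\<lambda>v. qform B v * g v)}"

definition l2_inner :: "(real^3) measure \<Rightarrow> (real^3 \<Rightarrow> real) \<Rightarrow> (real^3 \<Rightarrow> real) \<Rightarrow> real" where
  "l2_inner m f g = (LINT v|m. f v * g v)"

definition l2_norm :: "(real^3) measure \<Rightarrow> (real^3 \<Rightarrow> real) \<Rightarrow> real" where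
  "l2_norm m f = sqrt (l2_inner m f f)"

definition l2_integrable :: "(real^3) measure \<Rightarrow> (real^3 \<Rightarrow> real) \<Rightarrow> bool" where
  "l2_integrable m f \<longleftrightarrow> f \<in> borel_measurable m \<and> integrable m (\<lambda>v. (f v)\<^sup>2)"

definition forms_Q_perp :: "(real^3) measure \<Rightarrow> real^3^3 \<Rightarrow> nat \<Rightarrow> (real^3 \<Rightarrow> real) set" where
  "forms_Q_perp m B k = {p \<in> forms k. \<forall>q \<in> forms_Q B k. l2_inner m p q = 0}"

definition orth_proj ::
  "(real^3) measure \<Rightarrow> (real^3 \<Rightarrow> real) set \<Rightarrow> (real^3 \<Rightarrow> real) \<Rightarrow> (real^3 \<Rightarrow> real)" where
  "orth_proj m W p = (THE q. q \<in> W \<and> (\<forall>r \<in> W. l2_inner m (\<lambda>v. p v - q v) r = 0))"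

definition partial_deriv :: "3 \<Rightarrow> (real^3 \<Rightarrow> real) \<Rightarrow> real^3 \<Rightarrow> real" where
  "partial_deriv i p v = frechet_derivative p (at v) (axis i 1)"

definition laplacian_Q :: "real^3^3 \<Rightarrow> (real^3 \<Rightarrow> real) \<Rightarrow> real^3 \<Rightarrow> real" where
  "laplacian_Q B p v =
     (\<Sum>i\<in>UNIV. \<Sum>j\<in>UNIV. matrix_inv B $ i $ j * partial_deriv i (partial_deriv j p) v)"

definition Har_Q :: "real^3^3 \<Rightarrow> nat \<Rightarrow> (real^3 \<Rightarrow> real) set" where
  "Har_Q B k = {p \<in> forms k. \<forall>v. laplacian_Q B p v = 0}"

section \<open>Multipoles\<close>

text \<open>
  A linear form is given by its coefficient vector \<open>a\<close>, and a \<open>k\<close>-tuple of linear forms by an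
  element of \<open>{..<k} \<rightarrow>\<^sub>E UNIV\<close>, the underlying set of the product topology.
\<close>

definition form_prod :: "nat \<Rightarrow> (nat \<Rightarrow> real^3) \<Rightarrow> real^3 \<Rightarrow> real" where
  "form_prod k L v = (\<Prod>\<nu><k. L \<nu> \<bullet> v)"

definition Fact :: "nat \<Rightarrow> (real^3 \<Rightarrow> real) set" where
  "Fact k = form_prod k ` ({..<k} \<rightarrow>\<^sub>E (UNIV - {0}))"

text \<open>
  The orbit relation of the group generated by permutations and by rescalings: since permutations
  normalise the rescalings, every group element is a permutation followed by a rescaling.
\<close>

definition multipole_rel :: "nat \<Rightarrow> ((nat \<Rightarrow> real^3) \<times> (nat \<Rightarrow> real^3)) set" where
  "multipole_rel k =
     {(L, L'). L \<in> {..<k} \<rightarrow>\<^sub>E (UNIV - {0}) \<and> L' \<in> {..<k} \<rightarrow>\<^sub>E (UNIV - {0}) \<and>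
        (\<exists>\<pi> c. \<pi> permutes {..<k} \<and> (\<forall>\<nu><k. c \<nu> \<noteq> (0::real)) \<and> (\<Prod>\<nu><k. c \<nu>) = 1 \<and>
           (\<forall>\<nu><k. L' \<nu> = c \<nu> *\<^sub>R L (\<pi> \<nu>)))}"

datatype multipole =
    Scalar_Multipole real
  | Zero_Multipole
  | Class_Multipole "(nat \<Rightarrow> real^3) set"

text \<open>
  In degree 0 multipoles are real constants, and the zero multipole is the constant 0;
  \<open>Zero_Multipole\<close> is the point added in positive degrees.
\<close>

definition multipoles :: "nat \<Rightarrow> multipole set" where
  "multipoles k =
     (if k = 0 then range Scalar_Multipole
      else insert Zero_Multipole
             (Class_Multipole ` (({..<k} \<rightarrow>\<^sub>E (UNIV - {0})) // multipole_rel k)))"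

lemma form_prod_multipole_rel:
  assumes "(L, L') \<in> multipole_rel k"
  shows "form_prod k L' = form_prod k L"
proof
  fix v
  obtain \<pi> c where \<pi>: "\<pi> permutes {..<k}" and c: "(\<Prod>\<nu><k. c \<nu>) = (1::real)"
    and L': "\<And>\<nu>. \<nu> < k \<Longrightarrow> L' \<nu> = c \<nu> *\<^sub>R L (\<pi> \<nu>)"
    using assms unfolding multipole_rel_def by blast
  have "form_prod k L' v = (\<Prod>\<nu><k. c \<nu> * (L (\<pi> \<nu>) \<bullet> v))"
    unfolding form_prod_def by (rule prod.cong) (simp_all add: L')
  also have "\<dots> = (\<Prod>\<nu><k. L (\<pi> \<nu>) \<bullet> v)"
    by (simp add: prod.distrib c)
  also have "\<dots> = form_prod k L v"
    unfolding form_prod_def using prod.permute[OF \<pi>, of "\<lambda>\<nu>. L \<nu> \<bullet> v"] by (simp add: o_def)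
  finally show "form_prod k L' v = form_prod k L v" .
qed

text \<open>
  By the preceding lemma the set of products over an equivalence class is a singleton.
\<close>

fun Theta :: "nat \<Rightarrow> multipole \<Rightarrow> real^3 \<Rightarrow> real" where
  "Theta k (Scalar_Multipole c) = (\<lambda>v. c)"
| "Theta k Zero_Multipole = (\<lambda>v. 0)"
| "Theta k (Class_Multipole C) = the_elem (form_prod k ` C)"

definition Phi :: "(real^3) measure \<Rightarrow> real^3^3 \<Rightarrow> nat \<Rightarrow> multipole \<Rightarrow> real^3 \<Rightarrow> real" where
  "Phi m B k w = orth_proj m (forms_Q_perp m B k) (Theta k w)"

definition rho_zero :: "(real^3) measure \<Rightarrow> nat \<Rightarrow> multipole \<Rightarrow> real" where
  "rho_zero m k w = l2_norm m (Theta k w)"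

definition quotient_topology :: "'a topology \<Rightarrow> ('a \<Rightarrow> 'b) \<Rightarrow> 'b topology" where
  "quotient_topology X q =
     topology (\<lambda>U. U \<subseteq> q ` topspace X \<and> openin X {x \<in> topspace X. q x \<in> U})"

lemma openin_quotient_topology:
  "openin (quotient_topology X q) U \<longleftrightarrow>
     U \<subseteq> q ` topspace X \<and> openin X {x \<in> topspace X. q x \<in> U}"
proof -
  have "istopology (\<lambda>U. U \<subseteq> q ` topspace X \<and> openin X {x \<in> topspace X. q x \<in> U})"
    unfolding istopology_def
  proof (intro conjI allI impI)
    fix S T
    assume S: "S \<subseteq> q ` topspace X \<and> openin X {x \<in> topspace X. q x \<in> S}"
      and T: "T \<subseteq> q ` topspace X \<and> openin X {x \<in> topspace X. q x \<in> T}"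
    show "S \<inter> T \<subseteq> q ` topspace X" using S by blast
    have "{x \<in> topspace X. q x \<in> S \<inter> T} =
          {x \<in> topspace X. q x \<in> S} \<inter> {x \<in> topspace X. q x \<in> T}" by blast
    then show "openin X {x \<in> topspace X. q x \<in> S \<inter> T}" using S T by (simp add: openin_Int)
  next
    fix K
    assume K: "\<forall>U\<in>K. U \<subseteq> q ` topspace X \<and> openin X {x \<in> topspace X. q x \<in> U}"
    then show "\<Union>K \<subseteq> q ` topspace X" by blast
    have "{x \<in> topspace X. q x \<in> \<Union>K} = (\<Union>U\<in>K. {x \<in> topspace X. q x \<in> U})" by blast
    then show "openin X {x \<in> topspace X. q x \<in> \<Union>K}" using K by auto
  qed
  then show ?thesis by (simp add: quotient_topology_def)
qed

text \<open>
  In positive degree the space of multipoles is the quotient of the space of all \<open>k\<close>-tuples of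
  linear forms in which the tuples having a vanishing entry form the zero multipole.
\<close>

definition multipole_of :: "nat \<Rightarrow> (nat \<Rightarrow> real^3) \<Rightarrow> multipole" where
  "multipole_of k L =
     (if \<exists>\<nu><k. L \<nu> = 0 then Zero_Multipole else Class_Multipole (multipole_rel k `` {L}))"

definition multipole_topology :: "nat \<Rightarrow> multipole topology" where
  "multipole_topology k =
     (if k = 0 then quotient_topology euclideanreal Scalar_Multipole
      else quotient_topology (product_topology (\<lambda>_. euclidean) {..<k}) (multipole_of k))"

lemma topspace_quotient_topology: "topspace (quotient_topology X q) = q ` topspace X"
proof (rule subset_antisym)
  show "topspace (quotient_topology X q) \<subseteq> q ` topspace X"
    using openin_topspace[of "quotient_topology X q"] unfolding openin_quotient_topology
    by (rule conjunct1)
  have "{x \<in> topspace X. q x \<in> q ` topspace X} = topspace X" by auto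
  then have "openin (quotient_topology X q) (q ` topspace X)"
    by (simp add: openin_quotient_topology)
  then show "q ` topspace X \<subseteq> topspace (quotient_topology X q)"
    by (rule openin_subset)
qed

lemma topspace_multipole_topology: "topspace (multipole_topology k) = multipoles k"
proof (cases "k = 0")
  case True
  then show ?thesis
    by (simp add: multipole_topology_def multipoles_def topspace_quotient_topology)
next
  case False
  let ?T = "{..<k} \<rightarrow>\<^sub>E (UNIV :: (real^3) set)"
  let ?N = "{..<k} \<rightarrow>\<^sub>E (UNIV - {0} :: (real^3) set)"
  have zero: "multipole_of k (\<lambda>\<nu>\<in>{..<k}. 0) = Zero_Multipole"
    using False by (auto simp: multipole_of_def)
  have nz: "multipole_of k L = Class_Multipole (multipole_rel k `` {L})" if "L \<in> ?N" for L
    using that by (auto simp: multipole_of_def PiE_iff)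
  have cases: "L \<in> ?N \<or> multipole_of k L = Zero_Multipole" if "L \<in> ?T" for L
    using that by (auto simp: multipole_of_def PiE_iff)
  have sub: "?N \<subseteq> ?T" by (auto simp: PiE_iff)
  have "multipole_of k ` ?T = insert Zero_Multipole (multipole_of k ` ?N)"
  proof
    show "multipole_of k ` ?T \<subseteq> insert Zero_Multipole (multipole_of k ` ?N)"
      using cases by blast
    have "(\<lambda>\<nu>\<in>{..<k}. 0) \<in> ?T" by auto
    then have "Zero_Multipole \<in> multipole_of k ` ?T" using zero by (metis image_eqI)
    then show "insert Zero_Multipole (multipole_of k ` ?N) \<subseteq> multipole_of k ` ?T"
      using sub by blast
  qed
  also have "multipole_of k ` ?N = (\<lambda>L. Class_Multipole (multipole_rel k `` {L})) ` ?N"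
    using nz by (rule image_cong[OF refl])
  also have "\<dots> = Class_Multipole ` (?N // multipole_rel k)"
  proof -
    have "?N // multipole_rel k = (\<lambda>L. multipole_rel k `` {L}) ` ?N"
      unfolding quotient_def by blast
    then show ?thesis by (simp only: image_image)
  qed
  finally show ?thesis
    using False by (simp add: multipole_topology_def multipoles_def topspace_quotient_topology)
qed

section \<open>The minimal angles and representing multipoles\<close>

definition l2_angle :: "(real^3) measure \<Rightarrow> (real^3 \<Rightarrow> real) \<Rightarrow> (real^3 \<Rightarrow> real) \<Rightarrow> real" where
  "l2_angle m p q = arccos (l2_inner m p q / (l2_norm m p * l2_norm m q))"

text \<open>By compactness of unit spheres the infimum is a minimum.\<close>

definition theta :: "(real^3) measure \<Rightarrow> real^3^3 \<Rightarrow> nat \<Rightarrow> real" where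
  "theta m B k =
     (if forms_Q B k = {\<lambda>v. 0} then pi / 2
      else Inf {l2_angle m p q |p q. p \<in> Fact k \<and> q \<in> forms_Q B k - {\<lambda>v. 0}})"

definition converges_in_l2 ::
  "(real^3) measure \<Rightarrow> (nat \<Rightarrow> real^3 \<Rightarrow> real) \<Rightarrow> (real^3 \<Rightarrow> real) \<Rightarrow> bool" where
  "converges_in_l2 m P f \<longleftrightarrow> (\<lambda>d. l2_norm m (\<lambda>v. P d v - f v)) \<longlonglongrightarrow> 0"

definition orth_decomposition ::
  "(real^3) measure \<Rightarrow> real^3^3 \<Rightarrow> (real^3 \<Rightarrow> real) \<Rightarrow> (nat \<Rightarrow> real^3 \<Rightarrow> real) \<Rightarrow> bool" where
  "orth_decomposition m B f F \<longleftrightarrow>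
     (\<forall>k. F k \<in> forms_Q_perp m B k) \<and>
     (\<forall>j k. j \<noteq> k \<longrightarrow> l2_inner m (F j) (F k) = 0) \<and>
     converges_in_l2 m (\<lambda>d v. \<Sum>k\<le>d. F k v) f"

definition representing ::
  "(real^3) measure \<Rightarrow> real^3^3 \<Rightarrow> (real^3 \<Rightarrow> real) \<Rightarrow> (nat \<Rightarrow> multipole) \<Rightarrow> bool" where
  "representing m B f w \<longleftrightarrow>
     (\<forall>k. w k \<in> multipoles k) \<and>
     (\<exists>F. orth_decomposition m B f F \<and> (\<forall>k. Phi m B k (w k) = F k))"

text \<open>A path in the space of continuous functions on \<open>S\<close> with the topology of uniform convergence.\<close>

definition continuous_deformation ::
  "(real^3) set \<Rightarrow> (real \<Rightarrow> real^3 \<Rightarrow> real) \<Rightarrow> bool" where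
  "continuous_deformation S g \<longleftrightarrow>
     (\<forall>t\<in>{0..1}. continuous_on S (g t)) \<and>
     (\<forall>t\<in>{0..1}. uniform_limit S g (g t) (at t within {0..1}))"

definition representing_deformation ::
  "(real^3) measure \<Rightarrow> real^3^3 \<Rightarrow> (real \<Rightarrow> real^3 \<Rightarrow> real) \<Rightarrow> (real \<Rightarrow> nat \<Rightarrow> multipole) \<Rightarrow> bool"
where
  "representing_deformation m B g u \<longleftrightarrow>
     (\<forall>t\<in>{0..1}. representing m B (g t) (u t)) \<and>
     (\<forall>k. continuous_map (top_of_set {0..1}) (multipole_topology k) (\<lambda>t. u t k))"

definition polys_dense_in_l2 :: "(real^3) measure \<Rightarrow> bool" where
  "polys_dense_in_l2 m \<longleftrightarrow>
     (\<forall>g. l2_integrable m g \<longrightarrow>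
        (\<forall>e>0. \<exists>p. real_polynomial_function p \<and> l2_norm m (\<lambda>v. g v - p v) < e))"

text \<open>
  Invariance under the orthogonal group of the form: this is what identifies the orthogonal
  complement of the multiples of a positive definite form with its harmonic polynomials.
\<close>

definition form_invariant_measure :: "(real^3) measure \<Rightarrow> real^3^3 \<Rightarrow> bool" where
  "form_invariant_measure m B \<longleftrightarrow>
     (\<forall>A. (\<forall>v. qform B (A *v v) = qform B v) \<longrightarrow> distr m m (\<lambda>v. A *v v) = m)"

end

theory Submission
  imports Defs "HOL-Computational_Algebra.Fundamental_Theorem_Algebra"
begin

text \<open>
  The analytic part is orthogonal projection.  On the surface \<open>Q = 1\<close> a form agrees with its multiples by
  powers of \<open>Q\<close>, so the spaces \<open>V\<^sub>Q\<^sup>\<bottom>(k)\<close> of equal parity are mutually orthogonal, and those with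
  \<open>k \<le> d\<close> together contain the restrictions of all polynomials of degree at most \<open>d\<close> in their sum; spaces of different parity are separated by the
  odd moments.  The polynomials being dense in \<open>L\<^sub>2\<close>, by the Stone-Weierstrass theorem if the surface is
  compact, the orthogonal projections \<open>f\<^sub>k\<close> of \<open>f\<close> are its unique orthogonal decomposition.

  The algebraic part is that \<open>f\<^sub>k\<close> is congruent modulo \<open>Q\<close> to a product of \<open>k\<close> real linear forms
  (\<open>factorisation_modulo_qform\<close>).  By the fundamental theorem of algebra \<open>f\<^sub>k\<close> has a zero \<open>a + \<i> b\<close> on the
  complex cone \<open>Q = 0\<close>.  If \<open>a\<close> and \<open>b\<close> are independent, the real plane through them contains the conjugate
  zero as well, so that on this plane \<open>f\<^sub>k\<close> vanishes wherever \<open>Q\<close> does and is divisible by \<open>Q\<close>.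
  If \<open>a\<close> and \<open>b\<close> are dependent, \<open>f\<^sub>k\<close> vanishes at a real isotropic vector, and either it does so to second
  order in a plane tangent to the cone or a change of sign produces a second real isotropic zero;
  again \<open>Q\<close> divides \<open>f\<^sub>k\<close> on a plane.  In all cases \<open>f\<^sub>k\<close> is congruent modulo \<open>Q\<close> to a multiple of the linear
  form of the plane (\<open>linear_factor_exists\<close>), and the argument is repeated for the cofactor.

  For the estimate of the angles let \<open>p\<close> be the product of the linear forms.  Unless it is zero, the
  component of \<open>p\<close> in \<open>V\<^sub>Q(k)\<close> makes an angle with \<open>p\<close> that has sine \<open>\<parallel>f\<^sub>k\<parallel> / \<parallel>p\<parallel>\<close> and is at least \<open>\<theta>\<^sub>k\<close>, so Bessel's inequality
  bounds the series.

  Let \<open>Q\<close> be positive definite.  On the real plane \<open>L = 0\<close> of a factor of one product, a congruent product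
  is a multiple of \<open>Q\<close>, and a definite form on a plane divides a product of linear forms only if one of
  them is zero there; so the factors agree up to order and scalars (\<open>linear_factors_unique\<close>).  The
  polynomials are harmonic because invariance makes the infinitesimal rotations antisymmetric: their
  Casimir operator, which is \<open>Q \<Delta>\<^sub>Q - k (k + 1)\<close> on \<open>V(k)\<close>, preserves \<open>V\<^sub>Q\<^sup>\<bottom>(k)\<close>, so \<open>Q \<Delta>\<^sub>Q p\<close> lies in the
  intersection of \<open>V\<^sub>Q\<^sup>\<bottom>(k)\<close> and \<open>V\<^sub>Q(k)\<close> (\<open>perp_harmonic\<close>).  Along a deformation the components \<open>f\<^sub>k\<close> vary
  continuously, and the map from multipoles to components is injective and proper, the latter because
  the projection of a product of unit linear forms is bounded away from 0; hence the multipoles vary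
  continuously too (\<open>multipole_path_continuous\<close>).
\<close>

section \<open>Polynomial functions\<close>

lemma polyf_inner [intro, simp]: "real_polynomial_function (\<lambda>v::'a::euclidean_space. a \<bullet> v)"
  by (intro real_polynomial_function.intros(1) bounded_linear_inner_right)

lemma polyf_cmult [intro]:
  "real_polynomial_function p \<Longrightarrow> real_polynomial_function (\<lambda>v. c * p v)"
  by (intro real_polynomial_function.intros(4) real_polynomial_function.intros(2))

lemma polyf_compose_linear:
  assumes "linear f" "real_polynomial_function p"
  shows "real_polynomial_function (\<lambda>v::'a::euclidean_space. p (f v))"
  using real_polynomial_function_compose[OF polynomial_function_bounded_linear
      [OF linear_conv_bounded_linear[THEN iffD1, OF assms(1)]] assms(2)]
  by (simp add: o_def)

lemma polyf_qform [intro, simp]: "real_polynomial_function (qform B)"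
proof -
  have "qform B = (\<lambda>v. \<Sum>i\<in>UNIV. (axis i 1 \<bullet> v) * ((\<Sum>j\<in>UNIV. (B $ i $ j) *\<^sub>R axis j 1) \<bullet> v))"
    by (simp add: qform_def fun_eq_iff inner_axis' inner_sum_left matrix_vector_mult_def)
       (simp add: inner_vec_def)
  then show ?thesis
    by (simp only:) (intro real_polynomial_function_sum real_polynomial_function.intros(4) polyf_inner finite)
qed

lemma qform_scale: "qform B (c *\<^sub>R v) = c\<^sup>2 * qform B v"
  by (simp add: qform_def matrix_vector_mult_scaleR power2_eq_square)

lemma qform_0 [simp]: "qform B 0 = 0"
  by (simp add: qform_def)

lemma polyf_on_line:
  fixes p :: "'a::real_normed_vector \<Rightarrow> real"
  assumes "real_polynomial_function p"
  shows "\<exists>R::real poly. \<forall>t. p (x + t *\<^sub>R y) = poly R t"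
  using assms
proof (induction p rule: real_polynomial_function.induct)
  case (linear f)
  have "f (x + t *\<^sub>R y) = poly [:f x, f y:] t" for t
    by (simp add: bounded_linear.linear linear linear_add linear_cmul)
  then show ?case by blast
next
  case (const c)
  then show ?case by (intro exI[of _ "[:c:]"]) simp
next
  case (add f g)
  then show ?case by (metis poly_add)
next
  case (mult f g)
  then show ?case by (metis poly_mult)
qed

text \<open>
  Along the line through two points of \<open>U\<close> both factors become univariate polynomials, and those
  have no zero divisors.
\<close>

lemma polyf_zero_product:
  fixes p q :: "'a::real_normed_vector \<Rightarrow> real"
  assumes p: "real_polynomial_function p" and q: "real_polynomial_function q"
    and U: "subspace U" and pq: "\<And>v. v \<in> U \<Longrightarrow> p v * q v = 0"
    and u: "u \<in> U" "p u \<noteq> 0" and v: "v \<in> U"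
  shows "q v = 0"
proof -
  obtain R where R: "\<And>t. p (u + t *\<^sub>R (v - u)) = poly R t" using polyf_on_line[OF p] by blast
  obtain S where S: "\<And>t. q (u + t *\<^sub>R (v - u)) = poly S t" using polyf_on_line[OF q] by blast
  have "poly (R * S) t = 0" for t
  proof -
    have "u + t *\<^sub>R (v - u) \<in> U"
      using U u v by (intro subspace_add subspace_scale subspace_diff)
    then show ?thesis using pq by (simp flip: R S)
  qed
  then have "R * S = 0" using poly_all_0_iff_0 by blast
  moreover have "R \<noteq> 0" using R[of 0] u by auto
  ultimately have "S = 0" by simp
  then show ?thesis using S[of 1] by simp
qed

lemma polyf_cancel:
  fixes p q r :: "'a::real_normed_vector \<Rightarrow> real"
  assumes "real_polynomial_function p" "real_polynomial_function q" "real_polynomial_function r"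
    and "\<And>v. p v * q v = p v * r v" and "p u \<noteq> 0"
  shows "q v = r v"
  using polyf_zero_product[of p "\<lambda>v. q v - r v" UNIV u v] assms
  by (auto simp: right_diff_distrib)

text \<open>
  The shear fixes the hyperplane \<open>a \<bullet> v = 0\<close> pointwise, so the difference vanishes there; the cofactor of
  the linear form is assembled along the construction of \<open>p\<close>.
\<close>

lemma polyf_shear_difference:
  fixes p :: "'a::euclidean_space \<Rightarrow> real"
  assumes "real_polynomial_function p"
  shows "\<exists>g. real_polynomial_function g \<and> (\<forall>v. p v - p (v - (a \<bullet> v) *\<^sub>R u) = (a \<bullet> v) * g v)"
  using assms
proof (induction p rule: real_polynomial_function.induct)
  case (linear f)
  then have "f v - f (v - (a \<bullet> v) *\<^sub>R u) = (a \<bullet> v) * f u" for v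
    by (simp add: bounded_linear.linear linear_diff linear_cmul)
  then show ?case by (intro exI[of _ "\<lambda>_. f u"]) auto
next
  case (const c)
  then show ?case by (intro exI[of _ "\<lambda>_. 0"]) auto
next
  case (add f g)
  then obtain f' g' where fg: "real_polynomial_function f'" "real_polynomial_function g'"
    "\<And>v. f v - f (v - (a \<bullet> v) *\<^sub>R u) = (a \<bullet> v) * f' v"
    "\<And>v. g v - g (v - (a \<bullet> v) *\<^sub>R u) = (a \<bullet> v) * g' v"
    by blast
  have "(f v + g v) - (f (v - (a \<bullet> v) *\<^sub>R u) + g (v - (a \<bullet> v) *\<^sub>R u)) = (a \<bullet> v) * (f' v + g' v)" for v
    using fg(3)[of v] fg(4)[of v] by (simp add: algebra_simps)
  then show ?case using fg by (intro exI[of _ "\<lambda>v. f' v + g' v"]) auto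
next
  case (mult f g)
  then obtain f' g' where fg: "real_polynomial_function f'" "real_polynomial_function g'"
    "\<And>v. f v - f (v - (a \<bullet> v) *\<^sub>R u) = (a \<bullet> v) * f' v"
    "\<And>v. g v - g (v - (a \<bullet> v) *\<^sub>R u) = (a \<bullet> v) * g' v"
    by blast
  let ?s = "\<lambda>v. v - (a \<bullet> v) *\<^sub>R u"
  have lin: "linear ?s"
    by (intro linearI) (simp_all add: inner_add_right algebra_simps)
  have "f v * g v - f (?s v) * g (?s v) = (a \<bullet> v) * (f' v * g v + f (?s v) * g' v)" for v
  proof -
    have "f v * g v - f (?s v) * g (?s v) = (f v - f (?s v)) * g v + f (?s v) * (g v - g (?s v))"
      by (simp add: algebra_simps)
    then show ?thesis by (simp add: fg(3,4) algebra_simps)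
  qed
  moreover have "real_polynomial_function (\<lambda>v. f' v * g v + f (?s v) * g' v)"
    using polyf_compose_linear[OF lin mult.hyps(1)] fg mult.hyps
    by (intro real_polynomial_function.intros(3) real_polynomial_function.intros(4))
  ultimately show ?case by blast
qed

text \<open>
  For \<open>u\<close> the suitable multiple of \<open>a\<close>, the shear is the orthogonal projection onto the hyperplane.
\<close>

lemma polyf_vanishing_on_plane:
  fixes p :: "'a::euclidean_space \<Rightarrow> real"
  assumes p: "real_polynomial_function p" and a: "a \<noteq> 0"
    and van: "\<And>v. a \<bullet> v = 0 \<Longrightarrow> p v = 0"
  obtains g where "real_polynomial_function g" "\<And>v. p v = (a \<bullet> v) * g v"
proof -
  let ?u = "(1 / (a \<bullet> a)) *\<^sub>R a"
  obtain g where g: "real_polynomial_function g"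
    "\<And>v. p v - p (v - (a \<bullet> v) *\<^sub>R ?u) = (a \<bullet> v) * g v"
    using polyf_shear_difference[OF p] by blast
  have "p (v - (a \<bullet> v) *\<^sub>R ?u) = 0" for v
    using a by (intro van) (simp add: inner_diff_right)
  then show ?thesis using g by (intro that[of g]) auto
qed

section \<open>Homogeneous parts\<close>

text \<open>
  Homogeneous parts are read off, as coefficients, from the restrictions to the lines through the origin.
\<close>

definition radial :: "(real^3 \<Rightarrow> real) \<Rightarrow> real^3 \<Rightarrow> real poly" where
  "radial p v = (THE R. \<forall>c. p (c *\<^sub>R v) = poly R c)"

definition hom_part :: "nat \<Rightarrow> (real^3 \<Rightarrow> real) \<Rightarrow> real^3 \<Rightarrow> real" where
  "hom_part n p v = coeff (radial p v) n"

lemma radial_eqI: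
  assumes "\<And>c. p (c *\<^sub>R v) = poly R c"
  shows "radial p v = R"
  unfolding radial_def using assms by (intro the_equality) (auto simp: poly_eq_poly_eq_iff[symmetric])

lemma poly_radial:
  assumes "real_polynomial_function p"
  shows "poly (radial p v) c = p (c *\<^sub>R v)"
proof -
  obtain R where "\<And>t. p (0 + t *\<^sub>R v) = poly R t" using polyf_on_line[OF assms] by blast
  then have "\<And>t. p (t *\<^sub>R v) = poly R t" by simp
  with radial_eqI[OF this] show ?thesis by simp
qed

lemma radial_add:
  assumes "real_polynomial_function p" "real_polynomial_function q"
  shows "radial (\<lambda>v. p v + q v) v = radial p v + radial q v"
  by (rule radial_eqI) (simp add: poly_radial assms)

lemma radial_mult:
  assumes "real_polynomial_function p" "real_polynomial_function q"
  shows "radial (\<lambda>v. p v * q v) v = radial p v * radial q v"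
  by (rule radial_eqI) (simp add: poly_radial assms)

lemma radial_linear: "bounded_linear f \<Longrightarrow> radial f v = [:0, f v:]"
  by (rule radial_eqI) (simp add: bounded_linear.linear linear_cmul)

lemma radial_const: "radial (\<lambda>v. c) v = [:c:]"
  by (rule radial_eqI) simp

lemma radial_form: "p \<in> forms k \<Longrightarrow> radial p v = monom (p v) k"
  by (rule radial_eqI) (simp add: forms_def poly_monom)

lemma hom_part_form: "p \<in> forms k \<Longrightarrow> hom_part n p v = (if n = k then p v else 0)"
  by (simp add: hom_part_def radial_form)

lemma hom_part_mult_form:
  assumes "p \<in> forms k" "real_polynomial_function g"
  shows "hom_part n (\<lambda>v. p v * g v) v = (if n < k then 0 else p v * hom_part (n - k) g v)"
proof -
  have "real_polynomial_function p" using assms by (simp add: forms_def)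
  then show ?thesis
    using assms by (simp add: hom_part_def radial_mult radial_form coeff_monom_mult)
qed

lemma hom_part_add:
  assumes "real_polynomial_function p" "real_polynomial_function q"
  shows "hom_part n (\<lambda>v. p v + q v) v = hom_part n p v + hom_part n q v"
  by (simp add: hom_part_def radial_add assms)

lemma hom_part_in_forms:
  assumes "real_polynomial_function p"
  shows "hom_part n p \<in> forms n"
proof -
  have "real_polynomial_function (hom_part n p)"
    using assms
  proof (induction p arbitrary: n rule: real_polynomial_function.induct)
    case (linear f)
    have "hom_part n f = (if n = 1 then f else (\<lambda>v. 0))"
      by (auto simp: hom_part_def fun_eq_iff radial_linear[OF linear] coeff_pCons split: nat.splits)
    then show ?case using linear by auto
  next
    case (const c)
    have "hom_part n (\<lambda>v. c) = (if n = 0 then (\<lambda>v. c) else (\<lambda>v. 0))"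
      by (auto simp: hom_part_def fun_eq_iff radial_const coeff_pCons split: nat.splits)
    then show ?case by auto
  next
    case (add f g)
    then have "hom_part n (\<lambda>v. f v + g v) = (\<lambda>v. hom_part n f v + hom_part n g v)"
      by (simp add: hom_part_add fun_eq_iff)
    then show ?case using add by auto
  next
    case (mult f g)
    then have "hom_part n (\<lambda>v. f v * g v) = (\<lambda>v. \<Sum>i\<le>n. hom_part i f v * hom_part (n - i) g v)"
      by (simp add: hom_part_def fun_eq_iff radial_mult coeff_mult)
    moreover have "real_polynomial_function (\<lambda>v. hom_part i f v * hom_part (n - i) g v)" for i
      using mult by auto
    ultimately show ?case
      using real_polynomial_function_sum[of "{..n}" "\<lambda>v i. hom_part i f v * hom_part (n - i) g v"]
      by simp
  qed
  moreover have "hom_part n p (c *\<^sub>R v) = c ^ n * hom_part n p v" for c v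
  proof -
    have "radial p (c *\<^sub>R v) = pcompose (radial p v) [:0, c:]"
      by (rule radial_eqI) (simp add: poly_radial assms poly_pcompose mult.commute)
    then show ?thesis by (simp add: hom_part_def coeff_pcompose_linear)
  qed
  ultimately show ?thesis by (simp add: forms_def)
qed

lemma poly_altdef_le:
  fixes R :: "real poly"
  assumes "degree R \<le> d"
  shows "poly R x = (\<Sum>k\<le>d. coeff R k * x ^ k)"
  unfolding poly_altdef using assms
  by (intro sum.mono_neutral_left) (auto simp: coeff_eq_0)

text \<open>
  The restrictions to all lines through the origin have degrees bounded by a common \<open>d\<close>, and the line
  through \<open>v\<close> reaches \<open>v\<close> at the parameter 1.
\<close>

lemma hom_part_sum:
  assumes "real_polynomial_function p"
  obtains d where "\<And>v. p v = (\<Sum>k\<le>d. hom_part k p v)"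
proof -
  have "\<exists>d. \<forall>v. degree (radial p v) \<le> d" using assms
  proof (induction p rule: real_polynomial_function.induct)
    case (linear f)
    then show ?case by (intro exI[of _ 1]) (simp add: radial_linear)
  next
    case (const c)
    then show ?case by (simp add: radial_const)
  next
    case (add f g)
    then obtain d e where "\<And>v. degree (radial f v) \<le> d" "\<And>v. degree (radial g v) \<le> e" by blast
    then have "degree (radial (\<lambda>v. f v + g v) v) \<le> max d e" for v
      using add.hyps by (simp add: radial_add degree_add_le_max max.coboundedI1 max.coboundedI2 degree_add_le)
    then show ?case by blast
  next
    case (mult f g)
    then obtain d e where "\<And>v. degree (radial f v) \<le> d" "\<And>v. degree (radial g v) \<le> e" by blast
    then have "degree (radial (\<lambda>v. f v * g v) v) \<le> d + e" for v
      using mult.hyps by (simp add: radial_mult) (meson add_mono degree_mult_le order_trans)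
    then show ?case by blast
  qed
  then obtain d where d: "\<And>v. degree (radial p v) \<le> d" by blast
  have "p v = (\<Sum>k\<le>d. hom_part k p v)" for v
    using poly_radial[OF assms, of v 1] poly_altdef_le[of "radial p v" d 1, OF d]
    by (simp add: hom_part_def)
  then show ?thesis by (rule that)
qed

section \<open>Forms\<close>

lemma forms_polyf: "p \<in> forms k \<Longrightarrow> real_polynomial_function p"
  by (simp add: forms_def)

lemma forms_scale: "p \<in> forms k \<Longrightarrow> p (c *\<^sub>R v) = c ^ k * p v"
  by (simp add: forms_def)

lemma forms_zero [simp]: "(\<lambda>v. 0) \<in> forms k"
  by (auto simp: forms_def)

lemma forms_add: "p \<in> forms k \<Longrightarrow> q \<in> forms k \<Longrightarrow> (\<lambda>v. p v + q v) \<in> forms k"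
  by (auto simp: forms_def algebra_simps)

lemma forms_diff: "p \<in> forms k \<Longrightarrow> q \<in> forms k \<Longrightarrow> (\<lambda>v. p v - q v) \<in> forms k"
  by (auto simp: forms_def algebra_simps)

lemma forms_cmult: "p \<in> forms k \<Longrightarrow> (\<lambda>v. c * p v) \<in> forms k"
  by (auto simp: forms_def algebra_simps)

lemma forms_mult: "p \<in> forms j \<Longrightarrow> q \<in> forms k \<Longrightarrow> (\<lambda>v. p v * q v) \<in> forms (j + k)"
  by (auto simp: forms_def algebra_simps power_add)

lemma forms_inner: "(\<lambda>v. a \<bullet> v) \<in> forms 1"
  by (auto simp: forms_def)

lemma forms_qform: "qform B \<in> forms 2"
  by (auto simp: forms_def qform_scale)

lemma form_prod_Suc:
  "form_prod (Suc k) L v = (L 0 \<bullet> v) * form_prod k (\<lambda>\<nu>. L (Suc \<nu>)) v"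
  by (simp only: form_prod_def prod.lessThan_Suc_shift)

lemma form_prod_in_forms: "form_prod k L \<in> forms k"
proof -
  have "real_polynomial_function (\<lambda>v. \<Prod>\<nu><k. L \<nu> \<bullet> v)"
    by (intro real_polynomial_function_prod) auto
  then show ?thesis
    unfolding forms_def by (auto simp: form_prod_def[abs_def] prod.distrib)
qed

lemma form_0_const: "p \<in> forms 0 \<Longrightarrow> p v = p 0"
  using forms_scale[of p 0 0 v] by simp

lemma forms_at_0: "p \<in> forms k \<Longrightarrow> k \<noteq> 0 \<Longrightarrow> p 0 = 0"
  using forms_scale[of p k 0 0] by (simp add: power_0_left)

lemma forms_Q_forms: "p \<in> forms_Q B k \<Longrightarrow> p \<in> forms k"
  by (simp add: forms_Q_def)

lemma forms_QI:
  assumes "p \<in> forms k" "real_polynomial_function g" "\<And>v. p v = qform B v * g v"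
  shows "p \<in> forms_Q B k"
  using assms by (auto simp: forms_Q_def fun_eq_iff)

text \<open>
  The homogeneous part of degree \<open>k - 2\<close> of a cofactor of \<open>Q\<close> is again a cofactor.
\<close>

lemma forms_Q_cofactor:
  assumes "p \<in> forms_Q B k"
  obtains "k < 2" "p = (\<lambda>v. 0)"
    | j g where "k = j + 2" "g \<in> forms j" "p = (\<lambda>v. qform B v * g v)"
proof -
  obtain g where g: "real_polynomial_function g" and p: "p = (\<lambda>v. qform B v * g v)" "p \<in> forms k"
    using assms by (auto simp: forms_Q_def)
  have eq: "p v = (if k < 2 then 0 else qform B v * hom_part (k - 2) g v)" for v
    using hom_part_mult_form[OF forms_qform g, of k B v] hom_part_form[OF p(2), of k v]
    by (simp flip: p(1))
  show ?thesis
  proof (cases "k < 2")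
    case True
    then show ?thesis using eq that(1) by auto
  next
    case False
    then show ?thesis
      using eq by (intro that(2)[of "k - 2" "hom_part (k - 2) g"]) (auto simp: hom_part_in_forms g)
  qed
qed

lemma forms_Q_add: "p \<in> forms_Q B k \<Longrightarrow> q \<in> forms_Q B k \<Longrightarrow> (\<lambda>v. p v + q v) \<in> forms_Q B k"
proof -
  assume a: "p \<in> forms_Q B k" "q \<in> forms_Q B k"
  then obtain g h where g: "real_polynomial_function g" "p = (\<lambda>v. qform B v * g v)"
    "real_polynomial_function h" "q = (\<lambda>v. qform B v * h v)" by (auto simp: forms_Q_def)
  show ?thesis
    by (rule forms_QI[where g = "\<lambda>v. g v + h v"])
       (use a g in \<open>auto simp: algebra_simps intro: forms_add dest: forms_Q_forms\<close>)
qed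

lemma forms_Q_cmult: "p \<in> forms_Q B k \<Longrightarrow> (\<lambda>v. c * p v) \<in> forms_Q B k"
proof -
  assume a: "p \<in> forms_Q B k"
  then obtain g where g: "real_polynomial_function g" "p = (\<lambda>v. qform B v * g v)"
    by (auto simp: forms_Q_def)
  show ?thesis
    by (rule forms_QI[where g = "\<lambda>v. c * g v"])
       (use a g in \<open>auto simp: algebra_simps intro: forms_cmult dest: forms_Q_forms\<close>)
qed

lemma forms_Q_zero: "(\<lambda>v. 0) \<in> forms_Q B k"
  by (rule forms_QI[where g = "\<lambda>v. 0"]) auto

lemma forms_Q_diff: "p \<in> forms_Q B k \<Longrightarrow> q \<in> forms_Q B k \<Longrightarrow> (\<lambda>v. p v - q v) \<in> forms_Q B k"
  using forms_Q_add[of p B k "\<lambda>v. - 1 * q v"] forms_Q_cmult[of q B k "- 1"] by simp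

lemma forms_Q_mult_form:
  assumes "p \<in> forms_Q B j" "q \<in> forms k"
  shows "(\<lambda>v. p v * q v) \<in> forms_Q B (j + k)"
proof -
  obtain g where g: "real_polynomial_function g" "p = (\<lambda>v. qform B v * g v)"
    using assms by (auto simp: forms_Q_def)
  show ?thesis
    using assms g forms_mult[OF forms_Q_forms[OF assms(1)] assms(2)]
    by (intro forms_QI[where g = "\<lambda>v. g v * q v"]) (auto dest: forms_polyf)
qed

section \<open>Isotropic planes\<close>

unbundle cross3_syntax

lemma symmetric_inner_swap:
  assumes "transpose B = (B::real^'n^'n)"
  shows "u \<bullet> (B *v w) = w \<bullet> (B *v u)"
  by (metis assms dot_lmul_matrix inner_commute vector_transpose_matrix)

lemma qform_combination2:
  assumes "transpose B = B"
  shows "qform B (x *\<^sub>R a + y *\<^sub>R b) = x\<^sup>2 * qform B a + 2 * x * y * (a \<bullet> (B *v b)) + y\<^sup>2 * qform B b"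
  by (simp add: qform_def matrix_vector_right_distrib matrix_vector_mult_scaleR inner_add_left
      inner_add_right symmetric_inner_swap[OF assms, of b a] power2_eq_square algebra_simps)

lemma qform_combination3:
  assumes "transpose B = B"
  shows "qform B (x *\<^sub>R a + y *\<^sub>R b + z *\<^sub>R c) =
    x\<^sup>2 * qform B a + y\<^sup>2 * qform B b + z\<^sup>2 * qform B c +
    2 * (x * y * (a \<bullet> (B *v b)) + x * z * (a \<bullet> (B *v c)) + y * z * (b \<bullet> (B *v c)))"
  by (simp add: qform_def matrix_vector_right_distrib matrix_vector_mult_scaleR inner_add_left
      inner_add_right symmetric_inner_swap[OF assms, of b a] symmetric_inner_swap[OF assms, of c a]
      symmetric_inner_swap[OF assms, of c b] power2_eq_square algebra_simps)

lemma orthogonal_to_two_exists: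
  fixes p q :: "real^3"
  obtains x where "x \<noteq> 0" "x \<bullet> p = 0" "x \<bullet> q = 0"
proof -
  have "dim {p, q} \<le> card {p, q}" by (rule dim_le_card') simp
  also have "\<dots> \<le> 2" by (simp add: card_insert_if)
  finally have "dim {p, q} < DIM(real^3)" by simp
  from orthogonal_to_subspace_exists[OF this] obtain x where "x \<noteq> 0"
    "\<And>y. y \<in> span {p, q} \<Longrightarrow> orthogonal x y" by blast
  then show ?thesis by (intro that[of x]) (auto simp: orthogonal_def span_base)
qed

lemma cross_nonzero_if_orthogonal:
  fixes a b :: "real^3"
  assumes "a \<noteq> 0" "b \<noteq> 0" "a \<bullet> b = 0"
  shows "a \<times> b \<noteq> 0"
  using norm_cross_dot[of a b] assms by auto

lemma cross_zero_cases:
  fixes a b :: "real^3"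
  assumes "a \<times> b = 0"
  obtains u x y where "u \<noteq> 0" "a = x *\<^sub>R u" "b = y *\<^sub>R u"
proof -
  have "a = 0 \<or> b = 0 \<or> (\<exists>c. b = c *\<^sub>R a)"
    using assms by (simp add: cross_eq_0 collinear_lemma)
  then consider "a = 0" "b = 0" | "a = 0" "b \<noteq> 0" | "a \<noteq> 0" "b = 0" | c where "a \<noteq> 0" "b = c *\<^sub>R a"
    by blast
  then show ?thesis
  proof cases
    case 1
    obtain u :: "real^3" where "u \<noteq> 0" using orthogonal_to_two_exists by metis
    with 1 show ?thesis by (intro that[of u 0 0]) auto
  next
    case 2
    then show ?thesis by (intro that[of b 0 1]) auto
  next
    case 3
    then show ?thesis by (intro that[of a 1 0]) auto
  next
    case 4
    then show ?thesis by (intro that[of a 1 c]) auto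
  qed
qed

text \<open>
  Cramer's rule for the coordinates of \<open>v\<close> with respect to \<open>a\<close>, \<open>b\<close>, \<open>c\<close>.
\<close>

lemma cross_expansion:
  fixes a b c v :: "real^3"
  shows "(a \<bullet> (b \<times> c)) *\<^sub>R v = ((b \<times> c) \<bullet> v) *\<^sub>R a + ((c \<times> a) \<bullet> v) *\<^sub>R b + ((a \<times> b) \<bullet> v) *\<^sub>R c"
  by (simp add: cross3_simps forall_3)

text \<open>\<open>X\<close> and \<open>Y\<close> belong to the basis dual to \<open>a\<close>, \<open>b\<close>, \<open>a \<times> b\<close>; the condition \<open>a \<times> b \<noteq> 0\<close> expresses independence.\<close>

lemma plane_coordinates:
  fixes a b :: "real^3"
  assumes "a \<times> b \<noteq> 0"
  obtains X Y where "X \<bullet> a = 1" "X \<bullet> b = 0" "Y \<bullet> a = 0" "Y \<bullet> b = 1"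
    "\<And>v. v = (X \<bullet> v) *\<^sub>R a + (Y \<bullet> v) *\<^sub>R b + (((a \<times> b) \<bullet> v) / ((a \<times> b) \<bullet> (a \<times> b))) *\<^sub>R (a \<times> b)"
proof -
  define n where "n = a \<times> b"
  define X where "X = (1 / (n \<bullet> n)) *\<^sub>R (b \<times> n)"
  define Y where "Y = (1 / (n \<bullet> n)) *\<^sub>R (n \<times> a)"
  have nn: "n \<bullet> n \<noteq> 0" using assms by (simp add: n_def)
  have det: "a \<bullet> (b \<times> n) = n \<bullet> n" "b \<bullet> (n \<times> a) = n \<bullet> n"
    by (simp_all add: n_def cross3_simps)
  have exp: "v = (X \<bullet> v) *\<^sub>R a + (Y \<bullet> v) *\<^sub>R b + ((n \<bullet> v) / (n \<bullet> n)) *\<^sub>R n" for v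
  proof -
    have "v = (1 / (n \<bullet> n)) *\<^sub>R ((a \<bullet> (b \<times> n)) *\<^sub>R v)" using nn by (simp add: det)
    also have "\<dots> = (X \<bullet> v) *\<^sub>R a + (Y \<bullet> v) *\<^sub>R b + ((n \<bullet> v) / (n \<bullet> n)) *\<^sub>R n"
      unfolding cross_expansion by (simp add: X_def Y_def n_def[symmetric] scaleR_add_right divide_simps)
    finally show ?thesis .
  qed
  show ?thesis
  proof (rule that[of X Y])
    show "X \<bullet> a = 1" "Y \<bullet> b = 1" using nn det by (simp_all add: X_def Y_def inner_commute)
    show "X \<bullet> b = 0" "Y \<bullet> a = 0" by (simp_all add: X_def Y_def dot_cross_self)
  qed (use exp in \<open>simp add: n_def\<close>)
qed

text \<open>
  A form vanishing on a plane is divisible by the linear form of the plane.  Irreducibility would make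
  the cofactor constant, so the quadratic form, being even, would vanish.
\<close>

lemma no_isotropic_plane:
  assumes sym: "transpose B = B" and irred: "irreducible_poly_fun (qform B)"
    and ind: "a \<times> b \<noteq> 0" and iso: "qform B a = 0" "qform B b = 0" "a \<bullet> (B *v b) = 0"
  shows False
proof -
  let ?n = "a \<times> b"
  obtain X Y where XY: "\<And>v. v = (X \<bullet> v) *\<^sub>R a + (Y \<bullet> v) *\<^sub>R b + ((?n \<bullet> v) / (?n \<bullet> ?n)) *\<^sub>R ?n"
    using plane_coordinates[OF ind] by metis
  have "qform B v = 0" if "?n \<bullet> v = 0" for v
  proof -
    have "v = (X \<bullet> v) *\<^sub>R a + (Y \<bullet> v) *\<^sub>R b" using XY[of v] that by simp
    then show ?thesis using qform_combination2[OF sym, of "X \<bullet> v" a "Y \<bullet> v" b] iso by simp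
  qed
  then obtain g where g: "real_polynomial_function g" "\<And>v. qform B v = (?n \<bullet> v) * g v"
    using polyf_vanishing_on_plane[OF polyf_qform ind] by blast
  have "(\<lambda>v. ?n \<bullet> v) constant_on UNIV \<or> g constant_on UNIV"
    using irred g unfolding irreducible_poly_fun_def by (metis ext polyf_inner)
  moreover have "\<not> (\<lambda>v. ?n \<bullet> v) constant_on UNIV"
  proof
    assume "(\<lambda>v. ?n \<bullet> v) constant_on UNIV"
    then have "?n \<bullet> ?n = ?n \<bullet> 0" unfolding constant_on_def by (metis UNIV_I)
    with ind show False by simp
  qed
  ultimately obtain c where c: "\<And>v. g v = c" by (auto simp: constant_on_def)
  have "qform B v = 0" for v
    using qform_scale[of B "- 1" v] g(2)[of v] g(2)[of "- v"] c by simp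
  then have "qform B constant_on UNIV" by (auto simp: constant_on_def)
  then show False using irred by (simp add: irreducible_poly_fun_def)
qed

section \<open>Complexification\<close>

text \<open>
  The extension of a polynomial function to complex arguments.  As an inductive relation it supports
  proofs along a common construction of the function and its extension.
\<close>

inductive complexifies :: "(real^3 \<Rightarrow> real) \<Rightarrow> (complex^3 \<Rightarrow> complex) \<Rightarrow> bool" where
  linear: "complexifies (\<lambda>v. a \<bullet> v) (\<lambda>z. \<Sum>i\<in>UNIV. of_real (a $ i) * z $ i)"
| const: "complexifies (\<lambda>v. c) (\<lambda>z. of_real c)"
| add: "complexifies p P \<Longrightarrow> complexifies q R \<Longrightarrow> complexifies (\<lambda>v. p v + q v) (\<lambda>z. P z + R z)"
| mult: "complexifies p P \<Longrightarrow> complexifies q R \<Longrightarrow> complexifies (\<lambda>v. p v * q v) (\<lambda>z. P z * R z)"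

lemma complexification_exists:
  assumes "real_polynomial_function p"
  obtains P where "complexifies p P"
proof -
  have "\<exists>P. complexifies p P" using assms
  proof (induction p rule: real_polynomial_function.induct)
    case (linear f)
    have "f = (\<lambda>v. (\<chi> i. f (axis i 1)) \<bullet> v)"
    proof
      fix v
      have "f v = f (\<Sum>i\<in>UNIV. (v $ i) *\<^sub>R axis i 1)"
        by (simp add: basis_expansion scalar_mult_eq_scaleR[symmetric])
      also have "\<dots> = (\<Sum>i\<in>UNIV. v $ i * f (axis i 1))"
        using linear by (simp add: bounded_linear.linear linear_sum linear_cmul)
      finally show "f v = (\<chi> i. f (axis i 1)) \<bullet> v" by (simp add: inner_vec_def mult.commute)
    qed
    then show ?case using complexifies.linear by metis
  qed (use complexifies.intros in blast)+
  then show ?thesis using that by blast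
qed

lemma complexifies_polyf: "complexifies p P \<Longrightarrow> real_polynomial_function p"
  by (induction rule: complexifies.induct) auto

definition complex_vec :: "real^3 \<Rightarrow> real^3 \<Rightarrow> complex^3" where
  "complex_vec a b = (\<chi> i. of_real (a $ i) + \<i> * of_real (b $ i))"

lemma complex_vec_surj: "\<exists>a b. z = complex_vec a b"
  by (rule exI[of _ "\<chi> i. Re (z $ i)"], rule exI[of _ "\<chi> i. Im (z $ i)"])
     (simp add: complex_vec_def vec_eq_iff complex_eq_iff)

text \<open>
  This is what makes the fundamental theorem of algebra applicable to zeros on a rational curve.
\<close>

lemma complexifies_poly_curve:
  assumes "complexifies p P" "\<And>i. \<exists>R. \<forall>s. z s $ i = poly R s"
  shows "\<exists>R. \<forall>s. P (z s) = poly R s"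
  using assms(1)
proof (induction rule: complexifies.induct)
  case (linear a)
  from assms(2) obtain R where "\<And>i s. z s $ i = poly (R i) s" by metis
  then have "\<forall>s. (\<Sum>i\<in>UNIV. of_real (a $ i) * z s $ i) = poly (\<Sum>i\<in>UNIV. smult (of_real (a $ i)) (R i)) s"
    by (simp add: poly_sum)
  then show ?case by blast
next
  case (const c)
  show ?case by (rule exI[of _ "[:of_real c:]"]) simp
next
  case (add p P q R)
  then show ?case by (metis poly_add)
next
  case (mult p P q R)
  then show ?case by (metis poly_mult)
qed

lemma complexifies_real:
  assumes "complexifies p P"
  shows "P (\<chi> i. of_real (v $ i)) = of_real (p v)"
  using assms by (induction rule: complexifies.induct) (simp_all add: inner_vec_def)

lemma complex_poly_eq_if_eq_on_reals:
  fixes R S :: "complex poly"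
  assumes "\<And>t::real. poly R (of_real t) = poly S (of_real t)"
  shows "R = S"
proof (rule ccontr)
  assume "R \<noteq> S"
  then have "finite {x. poly (R - S) x = 0}" by (intro poly_roots_finite) simp
  moreover have "range complex_of_real \<subseteq> {x. poly (R - S) x = 0}" using assms by auto
  ultimately have "finite (range complex_of_real)" by (rule rev_finite_subset)
  then show False using finite_imageD[of complex_of_real UNIV] inj_of_real infinite_UNIV_char_0 by blast
qed

text \<open>
  Both sides are polynomial along every complex line, so the homogeneity of the real form first
  extends from real to complex arguments and then from real to complex factors.
\<close>

lemma complexified_form_scale:
  assumes p: "p \<in> forms k" and P: "complexifies p P"
  shows "P (c *s z) = c ^ k * P z"
proof -
  have real: "P (of_real r *s z) = of_real r ^ k * P z" for r z
  proof -
    obtain a b where z: "z = complex_vec a b" using complex_vec_surj by blast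
    let ?l = "\<lambda>t. (\<chi> i. of_real (a $ i) + t * of_real (b $ i)) :: complex^3"
    have "\<exists>R. \<forall>t. P (of_real r *s ?l t) = poly R t"
    proof (rule complexifies_poly_curve[OF P])
      fix i
      show "\<exists>R. \<forall>t. (of_real r *s ?l t) $ i = poly R t"
        by (rule exI[of _ "[:of_real (r * a $ i), of_real (r * b $ i):]"]) (simp add: algebra_simps)
    qed
    then obtain R where R: "\<And>t. P (of_real r *s ?l t) = poly R t" by blast
    have "\<exists>R. \<forall>t. P (?l t) = poly R t"
    proof (rule complexifies_poly_curve[OF P])
      fix i
      show "\<exists>R. \<forall>t. ?l t $ i = poly R t"
        by (rule exI[of _ "[:of_real (a $ i), of_real (b $ i):]"]) simp
    qed
    then obtain S where S: "\<And>t. P (?l t) = poly S t" by blast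
    have "R = smult (of_real r ^ k) S"
    proof (rule complex_poly_eq_if_eq_on_reals)
      fix t :: real
      have "?l (of_real t) = (\<chi> i. of_real ((a + t *\<^sub>R b) $ i))" by (simp add: vec_eq_iff)
      moreover have "of_real r *s ?l (of_real t) = (\<chi> i. of_real ((r *\<^sub>R (a + t *\<^sub>R b)) $ i))"
        by (simp add: vec_eq_iff algebra_simps)
      ultimately show "poly R (of_real t) = poly (smult (of_real r ^ k) S) (of_real t)"
        using complexifies_real[OF P, of "r *\<^sub>R (a + t *\<^sub>R b)"] complexifies_real[OF P, of "a + t *\<^sub>R b"]
          forms_scale[OF p, of r "a + t *\<^sub>R b"] by (simp flip: R S)
    qed
    moreover have "?l \<i> = z" by (simp add: z complex_vec_def)
    ultimately show ?thesis using R[of \<i>] S[of \<i>] by simp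
  qed
  have "\<exists>R. \<forall>t. P (t *s z) = poly R t"
  proof (rule complexifies_poly_curve[OF P])
    fix i
    show "\<exists>R. \<forall>t. (t *s z) $ i = poly R t"
      by (rule exI[of _ "[:0, z $ i:]"]) simp
  qed
  then obtain R where R: "\<And>t. P (t *s z) = poly R t" by blast
  have "R = monom (P z) k"
    by (rule complex_poly_eq_if_eq_on_reals) (simp add: poly_monom real mult.commute flip: R)
  then show ?thesis by (simp add: R poly_monom)
qed

section \<open>Complex zeros on the isotropic cone\<close>

lemma qform_nonzero_exists:
  assumes "irreducible_poly_fun (qform B)"
  obtains u where "qform B u \<noteq> 0"
  using assms unfolding irreducible_poly_fun_def constant_on_def by blast

text \<open>
  A plane orthogonal to \<open>u1\<close> on which \<open>Q\<close> vanished would be totally isotropic, which irreducibility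
  excludes.  The third vector may be isotropic: then \<open>Q\<close> has rank two.
\<close>

lemma orthogonal_triple_exists:
  assumes sym: "transpose B = B" and irred: "irreducible_poly_fun (qform B)"
  obtains u1 u2 u3 where "qform B u1 \<noteq> 0" "qform B u2 \<noteq> 0" "u3 \<noteq> 0"
    "u1 \<bullet> (B *v u2) = 0" "u1 \<bullet> (B *v u3) = 0" "u2 \<bullet> (B *v u3) = 0"
proof -
  obtain u1 where u1: "qform B u1 \<noteq> 0" using qform_nonzero_exists[OF irred] .
  have "\<exists>u2. u2 \<bullet> (B *v u1) = 0 \<and> qform B u2 \<noteq> 0"
  proof (rule ccontr)
    assume none: "\<not> ?thesis"
    obtain a where a: "a \<noteq> 0" "a \<bullet> (B *v u1) = 0" using orthogonal_to_two_exists by metis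
    obtain b where b: "b \<noteq> 0" "b \<bullet> (B *v u1) = 0" "b \<bullet> a = 0" using orthogonal_to_two_exists by metis
    have "(a + b) \<bullet> (B *v u1) = 0" using a b by (simp add: inner_add_left)
    then have "qform B a = 0" "qform B b = 0" "qform B (a + b) = 0" using none a b by blast+
    moreover from this have "a \<bullet> (B *v b) = 0"
      using qform_combination2[OF sym, of 1 a 1 b] by simp
    moreover have "a \<times> b \<noteq> 0" using a b cross_nonzero_if_orthogonal by (simp add: inner_commute)
    ultimately show False using no_isotropic_plane[OF sym irred] by blast
  qed
  then obtain u2 where u2: "u2 \<bullet> (B *v u1) = 0" "qform B u2 \<noteq> 0" by blast
  obtain u3 where "u3 \<noteq> 0" "u3 \<bullet> (B *v u1) = 0" "u3 \<bullet> (B *v u2) = 0"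
    using orthogonal_to_two_exists by metis
  then show ?thesis
    using u1 u2 symmetric_inner_swap[OF sym] by (intro that[of u1 u2 u3]) metis+
qed

lemma orthogonal_triple_independent:
  assumes sym: "transpose B = B"
    and u: "qform B u1 \<noteq> 0" "qform B u2 \<noteq> 0" "u3 \<noteq> 0"
    "u1 \<bullet> (B *v u2) = 0" "u1 \<bullet> (B *v u3) = 0" "u2 \<bullet> (B *v u3) = 0"
    and z: "x1 *\<^sub>R u1 + x2 *\<^sub>R u2 + x3 *\<^sub>R u3 = 0"
  shows "x1 = 0 \<and> x2 = 0 \<and> x3 = 0"
proof -
  let ?v = "x1 *\<^sub>R u1 + x2 *\<^sub>R u2 + x3 *\<^sub>R u3"
  have "u1 \<bullet> (B *v ?v) = x1 * qform B u1" "u2 \<bullet> (B *v ?v) = x2 * qform B u2"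
    using u(4-6) symmetric_inner_swap[OF sym, of u2 u1]
    by (simp_all add: qform_def matrix_vector_right_distrib matrix_vector_mult_scaleR inner_add_right)
  then have "x1 = 0" "x2 = 0" using u z by simp_all
  then show ?thesis using z u(3) by simp
qed

definition binary_quadratic :: "complex \<Rightarrow> complex \<Rightarrow> complex \<Rightarrow> complex \<Rightarrow> complex \<Rightarrow> complex" where
  "binary_quadratic \<alpha> \<beta> \<gamma> s t = \<alpha> * s\<^sup>2 + \<beta> * s * t + \<gamma> * t\<^sup>2"

text \<open>
  Up to square roots of the coefficients this is the identity
  \<open>(s\<^sup>2 - t\<^sup>2)\<^sup>2 - (s\<^sup>2 + t\<^sup>2)\<^sup>2 + (2 s t)\<^sup>2 = 0\<close>.  For \<open>c3 = 0\<close> the conic is a pair of lines, and a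
  parametrisation of one of them by \<open>s\<^sup>2\<close> and \<open>t\<^sup>2\<close> serves.
\<close>

lemma conic_parametrisation:
  fixes c1 c2 c3 :: complex
  assumes "c1 \<noteq> 0" "c2 \<noteq> 0"
  obtains \<alpha> \<beta> \<gamma> :: "nat \<Rightarrow> complex" where
    "\<And>s t. c1 * (binary_quadratic (\<alpha> 0) (\<beta> 0) (\<gamma> 0) s t)\<^sup>2 + c2 * (binary_quadratic (\<alpha> 1) (\<beta> 1) (\<gamma> 1) s t)\<^sup>2
       + c3 * (binary_quadratic (\<alpha> 2) (\<beta> 2) (\<gamma> 2) s t)\<^sup>2 = 0"
    "\<And>s t. (s, t) \<noteq> (0, 0) \<Longrightarrow> binary_quadratic (\<alpha> 0) (\<beta> 0) (\<gamma> 0) s t \<noteq> 0 \<or>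
       binary_quadratic (\<alpha> 1) (\<beta> 1) (\<gamma> 1) s t \<noteq> 0 \<or> binary_quadratic (\<alpha> 2) (\<beta> 2) (\<gamma> 2) s t \<noteq> 0"
proof -
  obtain r1 where r1: "r1\<^sup>2 = c1" using power2_csqrt by blast
  obtain r2 where r2: "r2\<^sup>2 = c2" using power2_csqrt by blast
  have n: "r1 \<noteq> 0" "r2 \<noteq> 0" using assms r1 r2 by auto
  show ?thesis
  proof (cases "c3 = 0")
    case True
    let ?\<alpha> = "\<lambda>i::nat. if i = 0 then 1 / r1 else if i = 1 then \<i> / r2 else 0"
    let ?\<gamma> = "\<lambda>i::nat. if i = 2 then 1 else (0::complex)"
    show ?thesis
    proof (rule that[of ?\<alpha> "\<lambda>i. 0" ?\<gamma>])
      fix s t :: complex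
      show "c1 * (binary_quadratic (?\<alpha> 0) 0 (?\<gamma> 0) s t)\<^sup>2 + c2 * (binary_quadratic (?\<alpha> 1) 0 (?\<gamma> 1) s t)\<^sup>2
         + c3 * (binary_quadratic (?\<alpha> 2) 0 (?\<gamma> 2) s t)\<^sup>2 = 0"
        using n by (simp add: True binary_quadratic_def flip: r1 r2) (simp add: field_simps power2_eq_square)
      assume "(s, t) \<noteq> (0, 0)"
      then show "binary_quadratic (?\<alpha> 0) 0 (?\<gamma> 0) s t \<noteq> 0 \<or>
          binary_quadratic (?\<alpha> 1) 0 (?\<gamma> 1) s t \<noteq> 0 \<or> binary_quadratic (?\<alpha> 2) 0 (?\<gamma> 2) s t \<noteq> 0"
        using n by (cases "s = 0") (auto simp: binary_quadratic_def)
    qed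
  next
    case False
    obtain r3 where r3: "r3\<^sup>2 = c3" using power2_csqrt by blast
    have n3: "r3 \<noteq> 0" using r3 False by auto
    let ?\<alpha> = "\<lambda>i::nat. if i = 0 then 1 / r1 else if i = 1 then \<i> / r2 else 0"
    let ?\<beta> = "\<lambda>i::nat. if i = 2 then 2 / r3 else 0"
    let ?\<gamma> = "\<lambda>i::nat. if i = 0 then - 1 / r1 else if i = 1 then \<i> / r2 else 0"
    have bq: "binary_quadratic (?\<alpha> 0) (?\<beta> 0) (?\<gamma> 0) s t = (s\<^sup>2 - t\<^sup>2) / r1"
      "binary_quadratic (?\<alpha> 1) (?\<beta> 1) (?\<gamma> 1) s t = \<i> * (s\<^sup>2 + t\<^sup>2) / r2"
      "binary_quadratic (?\<alpha> 2) (?\<beta> 2) (?\<gamma> 2) s t = 2 * s * t / r3" for s t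
      using n n3 by (simp_all add: binary_quadratic_def field_simps)
    show ?thesis
    proof (rule that[of ?\<alpha> ?\<beta> ?\<gamma>])
      fix s t :: complex
      show "c1 * (binary_quadratic (?\<alpha> 0) (?\<beta> 0) (?\<gamma> 0) s t)\<^sup>2 + c2 * (binary_quadratic (?\<alpha> 1) (?\<beta> 1) (?\<gamma> 1) s t)\<^sup>2
         + c3 * (binary_quadratic (?\<alpha> 2) (?\<beta> 2) (?\<gamma> 2) s t)\<^sup>2 = 0"
        unfolding bq using n n3
        by (simp add: power_divide power_mult_distrib flip: r1 r2 r3) (simp add: power2_eq_square algebra_simps)
      assume st: "(s, t) \<noteq> (0, 0)"
      have "s\<^sup>2 - t\<^sup>2 \<noteq> 0 \<or> s\<^sup>2 + t\<^sup>2 \<noteq> 0"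
      proof (rule ccontr)
        assume "\<not> ?thesis"
        then have "s\<^sup>2 = t\<^sup>2" "s\<^sup>2 + s\<^sup>2 = 0" by auto
        then show False using st by auto
      qed
      then show "binary_quadratic (?\<alpha> 0) (?\<beta> 0) (?\<gamma> 0) s t \<noteq> 0 \<or>
          binary_quadratic (?\<alpha> 1) (?\<beta> 1) (?\<gamma> 1) s t \<noteq> 0 \<or> binary_quadratic (?\<alpha> 2) (?\<beta> 2) (?\<gamma> 2) s t \<noteq> 0"
        unfolding bq using n by auto
    qed
  qed
qed

text \<open>
  On the parametrised conic a form of positive degree becomes a binary form of positive degree, which
  has a zero by the fundamental theorem of algebra: either a root of its dehomogenisation, or the
  point at infinity if that is constant.
\<close>

lemma isotropic_zero_exists:
  assumes sym: "transpose B = B" and irred: "irreducible_poly_fun (qform B)"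
    and p: "p \<in> forms k" and k: "k \<noteq> 0" and P: "complexifies p P"
  obtains a b where "a \<noteq> 0 \<or> b \<noteq> 0" "qform B a = qform B b" "a \<bullet> (B *v b) = 0"
    "P (complex_vec a b) = 0"
proof -
  obtain u1 u2 u3 where u: "qform B u1 \<noteq> 0" "qform B u2 \<noteq> 0" "u3 \<noteq> 0"
    "u1 \<bullet> (B *v u2) = 0" "u1 \<bullet> (B *v u3) = 0" "u2 \<bullet> (B *v u3) = 0"
    using orthogonal_triple_exists[OF sym irred] .
  let ?c = "\<lambda>u. complex_of_real (qform B u)"
  have c: "?c u1 \<noteq> 0" "?c u2 \<noteq> 0" using u by auto
  obtain \<alpha> \<beta> \<gamma> :: "nat \<Rightarrow> complex" where
    iso: "\<And>s t. ?c u1 * (binary_quadratic (\<alpha> 0) (\<beta> 0) (\<gamma> 0) s t)\<^sup>2 +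
        ?c u2 * (binary_quadratic (\<alpha> 1) (\<beta> 1) (\<gamma> 1) s t)\<^sup>2
       + ?c u3 * (binary_quadratic (\<alpha> 2) (\<beta> 2) (\<gamma> 2) s t)\<^sup>2 = 0" and
    nz: "\<And>s t. (s, t) \<noteq> (0, 0) \<Longrightarrow> binary_quadratic (\<alpha> 0) (\<beta> 0) (\<gamma> 0) s t \<noteq> 0 \<or>
       binary_quadratic (\<alpha> 1) (\<beta> 1) (\<gamma> 1) s t \<noteq> 0 \<or> binary_quadratic (\<alpha> 2) (\<beta> 2) (\<gamma> 2) s t \<noteq> 0"
    by (rule conic_parametrisation[OF c, of "?c u3"]) (rule that)
  define x where "x i s t = binary_quadratic (\<alpha> i) (\<beta> i) (\<gamma> i) s t" for i s t
  define z where "z s t = (\<chi> j. x 0 s t * of_real (u1 $ j) + x 1 s t * of_real (u2 $ j) + x 2 s t * of_real (u3 $ j))" for s t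
  have x_poly: "\<exists>R. \<forall>s. x i s 1 = poly R s" "\<exists>R. \<forall>s. x i 1 s = poly R s" for i
    by (rule exI[of _ "[:\<gamma> i, \<beta> i, \<alpha> i:]"], simp add: x_def binary_quadratic_def algebra_simps power2_eq_square)
       (rule exI[of _ "[:\<alpha> i, \<beta> i, \<gamma> i:]"], simp add: x_def binary_quadratic_def algebra_simps power2_eq_square)
  obtain R1 where R1: "\<And>i s. x i s 1 = poly (R1 i) s" using x_poly(1) by metis
  obtain R2 where R2: "\<And>i s. x i 1 s = poly (R2 i) s" using x_poly(2) by metis
  have "\<exists>R. \<forall>s. P (z s 1) = poly R s"
  proof (rule complexifies_poly_curve[OF P])
    fix j
    show "\<exists>R. \<forall>s. z s 1 $ j = poly R s"
      by (rule exI[of _ "smult (of_real (u1 $ j)) (R1 0) + smult (of_real (u2 $ j)) (R1 1) + smult (of_real (u3 $ j)) (R1 2)"])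
         (simp add: z_def mult.commute flip: R1)
  qed
  then obtain R where R: "\<And>s. P (z s 1) = poly R s" by blast
  have "\<exists>R. \<forall>s. P (z 1 s) = poly R s"
  proof (rule complexifies_poly_curve[OF P])
    fix j
    show "\<exists>R. \<forall>s. z 1 s $ j = poly R s"
      by (rule exI[of _ "smult (of_real (u1 $ j)) (R2 0) + smult (of_real (u2 $ j)) (R2 1) + smult (of_real (u3 $ j)) (R2 2)"])
         (simp add: z_def mult.commute flip: R2)
  qed
  then obtain S where S: "\<And>s. P (z 1 s) = poly S s" by blast
  have "\<exists>s t. (s, t) \<noteq> (0, 0) \<and> P (z s t) = 0"
  proof (cases "constant (poly R)")
    case False
    then obtain s where "poly R s = 0" using fundamental_theorem_of_algebra by blast
    then show ?thesis using R by (metis prod.inject zero_neq_one)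
  next
    case True
    define \<kappa> where "\<kappa> = poly R 0"
    have \<kappa>: "P (z s 1) = \<kappa>" for s using True R by (simp add: \<kappa>_def constant_def)
    \<comment> \<open>by homogeneity of degree \<open>2 k\<close>, the binary form is \<open>\<kappa> t\<^sup>2\<^sup>k\<close>, which vanishes at \<open>(1, 0)\<close>\<close>
    have "poly S e = poly (monom \<kappa> (2 * k)) e" if "e \<noteq> 0" for e
    proof -
      have "z 1 e = e\<^sup>2 *s z (1 / e) 1"
        using that by (simp add: z_def x_def binary_quadratic_def vec_eq_iff field_simps power2_eq_square)
      then show ?thesis
        using complexified_form_scale[OF p P, of "e\<^sup>2" "z (1 / e) 1"] S[of e]
        by (simp add: \<kappa> poly_monom mult.commute flip: power_mult)
    qed
    then have "poly ([:0, 1:] * S) = poly ([:0, 1:] * monom \<kappa> (2 * k))" by (auto simp: fun_eq_iff)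
    then have "[:0, 1:] * S = [:0, 1:] * monom \<kappa> (2 * k)" by (simp only: poly_eq_poly_eq_iff)
    then have "S = monom \<kappa> (2 * k)" by (rule mult_left_cancel[THEN iffD1, rotated]) simp
    then have "P (z 1 0) = 0" using S[of 0] k by (simp add: poly_monom power_0_left)
    then show ?thesis by (metis prod.inject zero_neq_one)
  qed
  then obtain s t where st: "(s, t) \<noteq> (0, 0)" "P (z s t) = 0" by blast
  define a where "a = Re (x 0 s t) *\<^sub>R u1 + Re (x 1 s t) *\<^sub>R u2 + Re (x 2 s t) *\<^sub>R u3"
  define b where "b = Im (x 0 s t) *\<^sub>R u1 + Im (x 1 s t) *\<^sub>R u2 + Im (x 2 s t) *\<^sub>R u3"
  have "z s t = complex_vec a b"
    by (simp add: z_def complex_vec_def a_def b_def vec_eq_iff complex_eq_iff)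
  moreover have "a \<noteq> 0 \<or> b \<noteq> 0"
  proof (rule ccontr)
    assume "\<not> (a \<noteq> 0 \<or> b \<noteq> 0)"
    then have "Re (x 0 s t) = 0 \<and> Re (x 1 s t) = 0 \<and> Re (x 2 s t) = 0"
      "Im (x 0 s t) = 0 \<and> Im (x 1 s t) = 0 \<and> Im (x 2 s t) = 0"
      unfolding a_def b_def using orthogonal_triple_independent[OF sym u] by blast+
    then have "x 0 s t = 0" "x 1 s t = 0" "x 2 s t = 0" by (auto simp: complex_eq_iff)
    then show False using nz[OF st(1)] unfolding x_def by blast
  qed
  moreover
  have eq: "?c u1 * (x 0 s t)\<^sup>2 + ?c u2 * (x 1 s t)\<^sup>2 + ?c u3 * (x 2 s t)\<^sup>2 = 0"
    using iso by (simp add: x_def)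
  have "qform B a - qform B b = 0"
    using arg_cong[OF eq, of Re] u(4-6)
    by (simp add: a_def b_def qform_combination3[OF sym]) (simp add: algebra_simps power2_eq_square)
  moreover have "2 * (a \<bullet> (B *v b)) = 0"
    using arg_cong[OF eq, of Im] u(4-6) symmetric_inner_swap[OF sym, of u2 u1]
      symmetric_inner_swap[OF sym, of u3 u1] symmetric_inner_swap[OF sym, of u3 u2]
    by (simp add: a_def b_def matrix_vector_right_distrib matrix_vector_mult_scaleR inner_add_left
        inner_add_right flip: qform_def) (simp add: algebra_simps power2_eq_square)
  ultimately show ?thesis using st by (intro that[of a b]) auto
qed

section \<open>Division by a pair of lines\<close>

lemma polyf_poly: "real_polynomial_function f \<Longrightarrow> real_polynomial_function (\<lambda>v. poly A (f v))"
  by (induction A) auto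

text \<open>
  Division with remainder by the two equations \<open>n \<bullet> v = 0\<close> and \<open>y\<^sup>2 + \<epsilon> x\<^sup>2 = 0\<close> of a pair of lines in
  the plane spanned by \<open>a\<close> and \<open>b\<close>; the remainder is linear in \<open>y\<close>.  For \<open>\<epsilon> = 1\<close> the lines are complex
  conjugate, and the remainder is recorded as the value of the complexification on one of them.
\<close>

lemma division_by_line_pair:
  assumes P: "complexifies p P"
    and XY: "X \<bullet> a = 1" "X \<bullet> b = 0" "Y \<bullet> a = 0" "Y \<bullet> b = 1"
    and exp: "\<And>v. v = (X \<bullet> v) *\<^sub>R a + (Y \<bullet> v) *\<^sub>R b + ((n \<bullet> v) / d) *\<^sub>R n"
  shows "\<exists>A C g h. real_polynomial_function g \<and> real_polynomial_function h \<and>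
     (\<forall>v. p v = ((Y \<bullet> v)\<^sup>2 + \<epsilon> * (X \<bullet> v)\<^sup>2) * g v + (n \<bullet> v) * h v + (poly A (X \<bullet> v) + poly C (X \<bullet> v) * (Y \<bullet> v))) \<and>
     (\<epsilon> = 1 \<longrightarrow> (\<forall>s. P (complex_vec (s *\<^sub>R a) (s *\<^sub>R b)) = of_real (poly A s) + \<i> * of_real (poly C s * s)))"
  using P
proof (induction rule: complexifies.induct)
  case (linear w)
  have lin: "w \<bullet> v = (n \<bullet> v) * ((w \<bullet> n) / d) + ((w \<bullet> a) * (X \<bullet> v) + (w \<bullet> b) * (Y \<bullet> v))" for v
    using arg_cong[OF exp[of v], of "\<lambda>v. w \<bullet> v"] by (simp add: inner_add_right algebra_simps)
  have cpl: "(\<Sum>i\<in>UNIV. of_real (w $ i) * complex_vec (s *\<^sub>R a) (s *\<^sub>R b) $ i) =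
      of_real (s * (w \<bullet> a)) + \<i> * of_real ((w \<bullet> b) * s)" for s
    by (simp add: complex_vec_def inner_vec_def complex_eq_iff sum_distrib_left mult_ac)
  show ?case
  proof (intro exI conjI allI impI)
    show "w \<bullet> v = ((Y \<bullet> v)\<^sup>2 + \<epsilon> * (X \<bullet> v)\<^sup>2) * 0 + (n \<bullet> v) * ((w \<bullet> n) / d) +
       (poly [:0, w \<bullet> a:] (X \<bullet> v) + poly [:w \<bullet> b:] (X \<bullet> v) * (Y \<bullet> v))" for v
      by (subst lin) (simp add: mult.commute)
    show "(\<Sum>i\<in>UNIV. of_real (w $ i) * complex_vec (s *\<^sub>R a) (s *\<^sub>R b) $ i) =
       of_real (poly [:0, w \<bullet> a:] s) + \<i> * of_real (poly [:w \<bullet> b:] s * s)" for s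
      by (subst cpl) simp
  qed auto
next
  case (const c)
  show ?case
    by (intro exI[of _ "[:c:]"] exI[of _ 0] exI[of _ "\<lambda>v. 0"]) auto
next
  case (add p P q R)
  then obtain A C g h A' C' g' h' where
    1: "real_polynomial_function g" "real_polynomial_function h" "real_polynomial_function g'" "real_polynomial_function h'"
    and 2: "\<And>v. p v = ((Y \<bullet> v)\<^sup>2 + \<epsilon> * (X \<bullet> v)\<^sup>2) * g v + (n \<bullet> v) * h v + (poly A (X \<bullet> v) + poly C (X \<bullet> v) * (Y \<bullet> v))"
    "\<And>v. q v = ((Y \<bullet> v)\<^sup>2 + \<epsilon> * (X \<bullet> v)\<^sup>2) * g' v + (n \<bullet> v) * h' v + (poly A' (X \<bullet> v) + poly C' (X \<bullet> v) * (Y \<bullet> v))"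
    and 3: "\<And>s. \<epsilon> = 1 \<Longrightarrow> P (complex_vec (s *\<^sub>R a) (s *\<^sub>R b)) = of_real (poly A s) + \<i> * of_real (poly C s * s)"
    "\<And>s. \<epsilon> = 1 \<Longrightarrow> R (complex_vec (s *\<^sub>R a) (s *\<^sub>R b)) = of_real (poly A' s) + \<i> * of_real (poly C' s * s)"
    by metis
  show ?case
    using 1
    by (intro exI[of _ "A + A'"] exI[of _ "C + C'"] exI[of _ "\<lambda>v. g v + g' v"] exI[of _ "\<lambda>v. h v + h' v"] conjI)
       (auto simp: 2 3 algebra_simps)
next
  case (mult p P q R)
  then obtain A C g h A' C' g' h' where
    1: "real_polynomial_function g" "real_polynomial_function h" "real_polynomial_function g'" "real_polynomial_function h'"
    and 2: "\<And>v. p v = ((Y \<bullet> v)\<^sup>2 + \<epsilon> * (X \<bullet> v)\<^sup>2) * g v + (n \<bullet> v) * h v + (poly A (X \<bullet> v) + poly C (X \<bullet> v) * (Y \<bullet> v))"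
    "\<And>v. q v = ((Y \<bullet> v)\<^sup>2 + \<epsilon> * (X \<bullet> v)\<^sup>2) * g' v + (n \<bullet> v) * h' v + (poly A' (X \<bullet> v) + poly C' (X \<bullet> v) * (Y \<bullet> v))"
    and 3: "\<And>s. \<epsilon> = 1 \<Longrightarrow> P (complex_vec (s *\<^sub>R a) (s *\<^sub>R b)) = of_real (poly A s) + \<i> * of_real (poly C s * s)"
    "\<And>s. \<epsilon> = 1 \<Longrightarrow> R (complex_vec (s *\<^sub>R a) (s *\<^sub>R b)) = of_real (poly A' s) + \<i> * of_real (poly C' s * s)"
    by metis
  have pq: "real_polynomial_function p" "real_polynomial_function q"
    using mult.hyps complexifies_polyf by auto
  define r where "r v = poly A (X \<bullet> v) + poly C (X \<bullet> v) * (Y \<bullet> v)" for v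
  have pX: "real_polynomial_function (\<lambda>v. poly A (X \<bullet> v))" for A
    by (rule polyf_poly[OF polyf_inner])
  have r: "real_polynomial_function r" unfolding r_def[abs_def]
    by (intro real_polynomial_function.intros(3,4) pX polyf_inner)
  let ?g = "\<lambda>v. (g v * q v + r v * g' v) + poly C (X \<bullet> v) * poly C' (X \<bullet> v)"
  let ?h = "\<lambda>v. h v * q v + r v * h' v"
  let ?A = "A * A' - smult \<epsilon> (monom 1 2 * (C * C'))" and ?C = "A * C' + A' * C"
  have eq: "p v * q v = ((Y \<bullet> v)\<^sup>2 + \<epsilon> * (X \<bullet> v)\<^sup>2) * ?g v + (n \<bullet> v) * ?h v +
      (poly ?A (X \<bullet> v) + poly ?C (X \<bullet> v) * (Y \<bullet> v))" for v
  proof -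
    have p: "p v = ((Y \<bullet> v)\<^sup>2 + \<epsilon> * (X \<bullet> v)\<^sup>2) * g v + (n \<bullet> v) * h v + r v"
      using 2(1)[of v] by (simp add: r_def)
    have q: "q v = ((Y \<bullet> v)\<^sup>2 + \<epsilon> * (X \<bullet> v)\<^sup>2) * g' v + (n \<bullet> v) * h' v +
       (poly A' (X \<bullet> v) + poly C' (X \<bullet> v) * (Y \<bullet> v))"
      using 2(2)[of v] .
    have "p v * q v = ((Y \<bullet> v)\<^sup>2 + \<epsilon> * (X \<bullet> v)\<^sup>2) * (g v * q v) + (n \<bullet> v) * (h v * q v) + r v * q v"
      by (subst p) (simp add: algebra_simps)
    moreover have "r v * q v = ((Y \<bullet> v)\<^sup>2 + \<epsilon> * (X \<bullet> v)\<^sup>2) * (r v * g' v) + (n \<bullet> v) * (r v * h' v) +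
        r v * (poly A' (X \<bullet> v) + poly C' (X \<bullet> v) * (Y \<bullet> v))"
      by (subst q) (simp add: algebra_simps)
    moreover have "r v * (poly A' (X \<bullet> v) + poly C' (X \<bullet> v) * (Y \<bullet> v)) =
       ((Y \<bullet> v)\<^sup>2 + \<epsilon> * (X \<bullet> v)\<^sup>2) * (poly C (X \<bullet> v) * poly C' (X \<bullet> v)) + (poly ?A (X \<bullet> v) + poly ?C (X \<bullet> v) * (Y \<bullet> v))"
      by (simp add: r_def poly_monom algebra_simps power2_eq_square)
    ultimately show ?thesis by (simp add: algebra_simps)
  qed
  have "P z * R z = of_real (poly ?A s) + \<i> * of_real (poly ?C s * s)"
    if "\<epsilon> = 1" "z = complex_vec (s *\<^sub>R a) (s *\<^sub>R b)" for z s
    by (simp add: 3 that poly_monom algebra_simps power2_eq_square complex_eq_iff)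
  moreover have "real_polynomial_function ?g" "real_polynomial_function ?h"
    by (intro real_polynomial_function.intros(3,4) pX pq r 1)+
  ultimately show ?case using eq
    by (intro exI[of _ ?A] exI[of _ ?C] exI[of _ ?g] exI[of _ ?h] conjI allI impI) simp_all
qed

section \<open>Factorisation into linear forms modulo the quadratic form\<close>

text \<open>
  On the plane, division of \<open>p\<close> by the pair of lines \<open>Q = 0\<close> leaves a remainder that is linear in one
  coordinate; the zeros of \<open>p\<close> on both lines, or a double zero if they coincide, force it to vanish.
  So \<open>Q\<close> divides \<open>p\<close> on the plane.
\<close>

lemma linear_factor_from_plane:
  assumes sym: "transpose B = B" and p: "p \<in> forms (Suc k)" and P: "complexifies p P"
    and ind: "a \<times> b \<noteq> 0" and \<kappa>: "\<kappa> \<noteq> 0"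
    and Qa: "qform B a = \<kappa> * \<epsilon>" and Qb: "qform B b = \<kappa>" and Qab: "a \<bullet> (B *v b) = 0"
    and zeros: "\<epsilon> = 1 \<and> P (complex_vec a b) = 0 \<or> \<epsilon> = - 1 \<and> p (a + b) = 0 \<and> p (a - b) = 0 \<or>
      \<epsilon> = 0 \<and> p a = 0 \<and> (\<exists>D. (p has_derivative D) (at a) \<and> D b = 0)"
  shows "\<exists>l h. l \<noteq> 0 \<and> h \<in> forms k \<and> (\<lambda>v. p v - (l \<bullet> v) * h v) \<in> forms_Q B (Suc k)"
proof -
  let ?n = "a \<times> b"
  obtain X Y where XY: "X \<bullet> a = 1" "X \<bullet> b = 0" "Y \<bullet> a = 0" "Y \<bullet> b = 1"
    and exp: "\<And>v. v = (X \<bullet> v) *\<^sub>R a + (Y \<bullet> v) *\<^sub>R b + ((?n \<bullet> v) / (?n \<bullet> ?n)) *\<^sub>R ?n"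
    by (rule plane_coordinates[OF ind]) (rule that; assumption)
  obtain A C g h where g: "real_polynomial_function g" and h: "real_polynomial_function h"
    and dec: "\<And>v. p v = ((Y \<bullet> v)\<^sup>2 + \<epsilon> * (X \<bullet> v)\<^sup>2) * g v + (?n \<bullet> v) * h v + (poly A (X \<bullet> v) + poly C (X \<bullet> v) * (Y \<bullet> v))"
    and cpl: "\<And>s. \<epsilon> = 1 \<Longrightarrow> P (complex_vec (s *\<^sub>R a) (s *\<^sub>R b)) = of_real (poly A s) + \<i> * of_real (poly C s * s)"
    using division_by_line_pair[OF P XY exp, of \<epsilon>] by metis
  have n0: "?n \<bullet> a = 0" "?n \<bullet> b = 0" by (simp_all add: dot_cross_self)
  \<comment> \<open>on the plane itself the third coordinate disappears\<close>
  have dec_plane: "p (s *\<^sub>R a + t *\<^sub>R b) = (t\<^sup>2 + \<epsilon> * s\<^sup>2) * g (s *\<^sub>R a + t *\<^sub>R b) + (poly A s + poly C s * t)" for s t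
    using dec[of "s *\<^sub>R a + t *\<^sub>R b"] by (simp add: inner_add_right XY n0)
  have rem: "poly A s = 0 \<and> poly C s * s = 0" for s
    using zeros
  proof (elim disjE conjE)
    assume e: "\<epsilon> = 1" and z: "P (complex_vec a b) = 0"
    have "complex_vec (s *\<^sub>R a) (s *\<^sub>R b) = of_real s *s complex_vec a b"
      by (simp add: complex_vec_def vec_eq_iff algebra_simps)
    then have "of_real (poly A s) + \<i> * of_real (poly C s * s) = 0"
      using complexified_form_scale[OF p P, of "of_real s" "complex_vec a b"] z cpl[OF e, of s] by simp
    then show ?thesis by (simp add: complex_eq_iff)
  next
    assume e: "\<epsilon> = - 1" and z: "p (a + b) = 0" "p (a - b) = 0"
    have "p (s *\<^sub>R a + s *\<^sub>R b) = 0" "p (s *\<^sub>R a + (- s) *\<^sub>R b) = 0"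
      using forms_scale[OF p, of s "a + b"] forms_scale[OF p, of s "a - b"] z by (simp_all add: algebra_simps)
    then show ?thesis using dec_plane[of s s] dec_plane[of s "- s"] e by auto
  next
    assume e: "\<epsilon> = 0" and z: "p a = 0" and "\<exists>D. (p has_derivative D) (at a) \<and> D b = 0"
    then obtain D where D: "(p has_derivative D) (at a)" "D b = 0" by blast
    have "poly A s = 0" using dec_plane[of s 0] forms_scale[OF p, of s a] z e by simp
    moreover have "poly C s = 0" if "s \<noteq> 0"
    proof -
      obtain R where R: "\<And>t. g (s *\<^sub>R a + t *\<^sub>R b) = poly R t" using polyf_on_line[OF g] by blast
      have eq: "s ^ Suc k * p (a + (t / s) *\<^sub>R b) = t\<^sup>2 * poly R t + (poly A s + poly C s * t)" for t
        using dec_plane[of s t] forms_scale[OF p, of s "a + (t / s) *\<^sub>R b"] that e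
        by (simp add: R algebra_simps)
      have "((\<lambda>t. t\<^sup>2 * poly R t + (poly A s + poly C s * t)) has_real_derivative poly C s) (at 0)"
        by (auto intro!: derivative_eq_intros)
      moreover have "((\<lambda>t. s ^ Suc k * p (a + (t / s) *\<^sub>R b)) has_real_derivative 0) (at 0)"
      proof -
        have D': "(p has_derivative D) (at (a + (0 / s) *\<^sub>R b))" using D by simp
        have "((\<lambda>t. a + (t / s) *\<^sub>R b) has_derivative (\<lambda>t. (t / s) *\<^sub>R b)) (at 0)"
          using that by (auto intro!: derivative_eq_intros)
        from has_derivative_compose[OF this D']
        have "((\<lambda>t. p (a + (t / s) *\<^sub>R b)) has_derivative (\<lambda>t. D ((t / s) *\<^sub>R b))) (at 0)" .
        moreover have "D ((t / s) *\<^sub>R b) = 0" for t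
          using has_derivative_linear[OF D(1)] D(2) by (simp add: linear_cmul)
        ultimately have "((\<lambda>t. p (a + (t / s) *\<^sub>R b)) has_real_derivative 0) (at 0)"
          by (simp add: has_field_derivative_def flip: lambda_zero)
        from DERIV_cmult[OF this, of "s ^ Suc k"] show ?thesis by simp
      qed
      ultimately show ?thesis unfolding eq by (rule DERIV_unique)
    qed
    ultimately show ?thesis by auto
  qed
  have "A = 0" using rem poly_all_0_iff_0 by blast
  moreover have "C * [:0, 1:] = 0"
  proof -
    have "poly (C * [:0, 1:]) s = 0" for s using rem[of s] by (simp add: mult.commute)
    then show ?thesis using poly_all_0_iff_0 by blast
  qed
  then have "C = 0" by simp
  ultimately have dec0: "p v = ((Y \<bullet> v)\<^sup>2 + \<epsilon> * (X \<bullet> v)\<^sup>2) * g v + (?n \<bullet> v) * h v" for v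
    using dec by simp
  let ?d = "\<lambda>v. qform B v - \<kappa> * ((Y \<bullet> v)\<^sup>2 + \<epsilon> * (X \<bullet> v)\<^sup>2)"
  have "?d v = 0" if "?n \<bullet> v = 0" for v
  proof -
    have "v = (X \<bullet> v) *\<^sub>R a + (Y \<bullet> v) *\<^sub>R b" using exp[of v] that by simp
    then show ?thesis using qform_combination2[OF sym, of "X \<bullet> v" a "Y \<bullet> v" b] Qa Qb Qab
      by (simp add: algebra_simps)
  qed
  moreover have "real_polynomial_function ?d"
    by (intro real_polynomial_function_diff polyf_cmult real_polynomial_function.intros(3)
        real_polynomial_function_power polyf_inner polyf_qform)
  ultimately obtain M where M: "real_polynomial_function M" "\<And>v. ?d v = (?n \<bullet> v) * M v"
    using polyf_vanishing_on_plane[OF _ ind, of ?d] by blast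
  \<comment> \<open>replace \<open>y\<^sup>2 + \<epsilon> x\<^sup>2\<close> by \<open>Q / \<kappa>\<close>, which agrees with it on the plane\<close>
  let ?g = "\<lambda>v. (1 / \<kappa>) * g v" and ?h = "\<lambda>v. h v - M v * ((1 / \<kappa>) * g v)"
  have rp: "real_polynomial_function ?g" "real_polynomial_function ?h"
    by (intro polyf_cmult real_polynomial_function_diff real_polynomial_function.intros(4) g h M(1))+
  have dec1: "p v = qform B v * ?g v + (?n \<bullet> v) * ?h v" for v
  proof -
    have "y = Q * ((1 / \<kappa>) * g) + N * (h - M * ((1 / \<kappa>) * g))"
      if "y = q * g + N * h" "Q - \<kappa> * q = N * M" for y Q q N g h M :: real
    proof -
      have q: "q = (Q - N * M) / \<kappa>" using that(2) \<kappa> by (simp add: field_simps)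
      show ?thesis unfolding that(1) q using \<kappa> by (simp add: field_simps)
    qed
    from this[OF dec0[of v] M(2)[of v]] show ?thesis .
  qed
  \<comment> \<open>pass to homogeneous parts; in degree 1 nothing is left of the multiple of \<open>Q\<close>\<close>
  have "p v = qform B v * (if Suc k < 2 then 0 else hom_part (Suc k - 2) ?g v) + (?n \<bullet> v) * hom_part k ?h v" for v
  proof -
    have "hom_part (Suc k) p v = hom_part (Suc k) (\<lambda>v. qform B v * ?g v) v + hom_part (Suc k) (\<lambda>v. (?n \<bullet> v) * ?h v) v"
      unfolding dec1[abs_def]
      by (intro hom_part_add real_polynomial_function.intros(4) polyf_qform polyf_inner rp)
    then show ?thesis
      by (simp only: hom_part_mult_form[OF forms_qform rp(1)] hom_part_mult_form[OF forms_inner rp(2)]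
          hom_part_form[OF p]) (simp split: if_splits)
  qed
  then have "p v - (?n \<bullet> v) * hom_part k ?h v = qform B v * (if Suc k < 2 then 0 else hom_part (Suc k - 2) ?g v)" for v
    by (simp add: algebra_simps)
  moreover have "(\<lambda>v. p v - (?n \<bullet> v) * hom_part k ?h v) \<in> forms (Suc k)"
  proof -
    have "(\<lambda>v. (?n \<bullet> v) * hom_part k ?h v) \<in> forms (Suc k)"
      using forms_mult[OF forms_inner hom_part_in_forms[OF rp(2)], of ?n k] by simp
    then show ?thesis by (rule forms_diff[OF p])
  qed
  moreover have "real_polynomial_function (\<lambda>v. if Suc k < 2 then 0 else hom_part (Suc k - 2) ?g v)"
    using forms_polyf[OF hom_part_in_forms[OF rp(1)]] by (cases "Suc k < 2") auto
  ultimately have "(\<lambda>v. p v - (?n \<bullet> v) * hom_part k ?h v) \<in> forms_Q B (Suc k)"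
    by (intro forms_QI)
  then show ?thesis using ind hom_part_in_forms[OF rp(2)] by blast
qed

text \<open>
  If \<open>a\<close> is in the radical of the form, every plane through \<open>a\<close> is tangent to the cone, and in one of
  them \<open>p\<close> vanishes to second order at \<open>a\<close>, because the derivative of \<open>p\<close> at \<open>a\<close> annihilates \<open>a\<close> and a
  further direction.  Otherwise there is one tangent plane; if \<open>p\<close> vanishes to second order at \<open>a\<close> in
  it, this plane works.  If not, \<open>p\<close> changes sign at \<open>a\<close> along a
  parametrisation of the conic of isotropic lines, and, the degree of \<open>p\<close> on the conic being even, it
  has to change sign at a second isotropic line.
\<close>

lemma linear_factor_from_real_zero:
  assumes sym: "transpose B = B" and irred: "irreducible_poly_fun (qform B)"
    and p: "p \<in> forms (Suc k)" and a: "a \<noteq> 0" "qform B a = 0" "p a = 0"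
  shows "\<exists>l h. l \<noteq> 0 \<and> h \<in> forms k \<and> (\<lambda>v. p v - (l \<bullet> v) * h v) \<in> forms_Q B (Suc k)"
proof -
  obtain P where P: "complexifies p P" using complexification_exists[OF forms_polyf[OF p]] .
  have "p differentiable (at a)"
    using differentiable_at_real_polynomial_function[OF forms_polyf[OF p]] .
  then obtain D where D: "(p has_derivative D) (at a)" by (auto simp: differentiable_def)
  have linD: "linear D" using has_derivative_linear[OF D] .
  have tangent: ?thesis if u: "a \<times> u \<noteq> 0" "a \<bullet> (B *v u) = 0" "D u = 0" for u
  proof -
    have "qform B u \<noteq> 0" using no_isotropic_plane[OF sym irred u(1) a(2) _ u(2)] by blast
    then show ?thesis
      by (intro linear_factor_from_plane[OF sym p P u(1), of "qform B u" 0]) (use a u D in auto)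
  qed
  show ?thesis
  proof (cases "B *v a = 0")
    case True
    have "\<exists>n. \<forall>v. D v = n \<bullet> v"
    proof -
      have "D v = (\<chi> i. D (axis i 1)) \<bullet> v" for v
      proof -
        have "D v = D (\<Sum>i\<in>UNIV. (v $ i) *\<^sub>R axis i 1)"
          by (simp add: basis_expansion scalar_mult_eq_scaleR[symmetric])
        also have "\<dots> = (\<Sum>i\<in>UNIV. v $ i * D (axis i 1))"
          using linD by (simp add: linear_sum linear_cmul)
        finally show ?thesis by (simp add: inner_vec_def mult.commute)
      qed
      then show ?thesis by blast
    qed
    then obtain n where n: "\<And>v. D v = n \<bullet> v" by blast
    obtain u where u: "u \<noteq> 0" "u \<bullet> a = 0" "u \<bullet> n = 0" using orthogonal_to_two_exists .
    show ?thesis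
    proof (rule tangent)
      show "a \<times> u \<noteq> 0" using a u by (intro cross_nonzero_if_orthogonal) (simp_all add: inner_commute)
      show "a \<bullet> (B *v u) = 0" using symmetric_inner_swap[OF sym, of a u] True by simp
      show "D u = 0" using u n by (simp add: inner_commute)
    qed
  next
    case False
    \<comment> \<open>\<open>B a\<close> is not orthogonal to \<open>a\<close> with respect to the form; adding a multiple of \<open>a\<close> makes it isotropic\<close>
    let ?Ba = "B *v a"
    let ?w = "?Ba - (qform B ?Ba / (2 * (a \<bullet> (B *v ?Ba)))) *\<^sub>R a"
    have aw0: "a \<bullet> (B *v ?Ba) \<noteq> 0" using symmetric_inner_swap[OF sym, of a ?Ba] False by simp
    obtain w where aw: "a \<bullet> (B *v w) \<noteq> 0" and w: "qform B w = 0"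
    proof (rule that[of ?w])
      have "a \<bullet> (B *v ?w) = a \<bullet> (B *v ?Ba)" using a(2)
        by (simp add: matrix_vector_mult_diff_distrib matrix_vector_mult_scaleR inner_diff_right flip: qform_def)
      then show "a \<bullet> (B *v ?w) \<noteq> 0" using aw0 by simp
      show "qform B ?w = 0"
        using qform_combination2[OF sym, of 1 ?Ba "- (qform B ?Ba / (2 * (a \<bullet> (B *v ?Ba))))" a]
          aw0 a(2) symmetric_inner_swap[OF sym, of a ?Ba] by simp
    qed
    obtain u where u: "u \<noteq> 0" "u \<bullet> (B *v a) = 0" "u \<bullet> (B *v w) = 0" using orthogonal_to_two_exists .
    have au: "a \<bullet> (B *v u) = 0" using u symmetric_inner_swap[OF sym] by metis
    have ind: "a \<times> u \<noteq> 0"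
    proof
      assume "a \<times> u = 0"
      then obtain e x y where e: "e \<noteq> 0" "a = x *\<^sub>R e" "u = y *\<^sub>R e" by (rule cross_zero_cases)
      have "e \<bullet> (B *v w) = 0" using u e by auto
      then show False using aw e by simp
    qed
    show ?thesis
    proof (cases "D u = 0")
      case True
      then show ?thesis using tangent ind au by blast
    next
      case Du: False
      \<comment> \<open>with this \<open>c\<close> the curve \<open>\<gamma>\<close> below runs through isotropic vectors, starting in \<open>a\<close> with tangent \<open>u\<close>\<close>
      define c where "c = - qform B u / (2 * (a \<bullet> (B *v w)))"
      have Qu: "qform B u \<noteq> 0" using no_isotropic_plane[OF sym irred ind a(2) _ au] by blast
      then have c: "c \<noteq> 0" using aw by (simp add: c_def)
      define \<gamma> where "\<gamma> s t = s\<^sup>2 *\<^sub>R a + (s * t) *\<^sub>R u + (t\<^sup>2 * c) *\<^sub>R w" for s t :: real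
      have iso: "qform B (\<gamma> s t) = 0" for s t
        using a(2) w au u(3) aw
        by (simp add: \<gamma>_def qform_combination3[OF sym]) (simp add: c_def field_simps power2_eq_square)
      have "((\<lambda>t. \<gamma> 1 t) has_derivative (\<lambda>t. t *\<^sub>R u)) (at 0)"
        unfolding \<gamma>_def by (auto intro!: derivative_eq_intros)
      moreover have "(p has_derivative D) (at (\<gamma> 1 0))" using D by (simp add: \<gamma>_def)
      ultimately have "((\<lambda>t. p (\<gamma> 1 t)) has_derivative (\<lambda>t. D (t *\<^sub>R u))) (at 0)"
        by (rule has_derivative_compose)
      then have der: "((\<lambda>t. p (\<gamma> 1 t)) has_real_derivative D u) (at 0)"
        using linD by (simp add: has_field_derivative_def linear_cmul mult_commute_abs)
      have p0: "p (\<gamma> 1 0) = 0" using a by (simp add: \<gamma>_def)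
      have "\<exists>e>0. p (\<gamma> 1 e) * p (\<gamma> 1 (- e)) < 0"
      proof (cases "D u > 0")
        case True
        obtain d1 where d1: "d1 > 0" "\<And>h. 0 < h \<Longrightarrow> h < d1 \<Longrightarrow> p (\<gamma> 1 0) < p (\<gamma> 1 (0 + h))"
          using DERIV_pos_inc_right[OF der True] by blast
        obtain d2 where d2: "d2 > 0" "\<And>h. 0 < h \<Longrightarrow> h < d2 \<Longrightarrow> p (\<gamma> 1 (0 - h)) < p (\<gamma> 1 0)"
          using DERIV_pos_inc_left[OF der True] by blast
        let ?e = "min d1 d2 / 2"
        have "?e > 0" "?e < d1" "?e < d2" using d1(1) d2(1) by auto
        then have "p (\<gamma> 1 ?e) > 0" "p (\<gamma> 1 (- ?e)) < 0" using d1(2)[of ?e] d2(2)[of ?e] p0 by auto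
        then show ?thesis using \<open>?e > 0\<close> mult_pos_neg by blast
      next
        case False
        then have neg: "D u < 0" using Du by simp
        obtain d1 where d1: "d1 > 0" "\<And>h. 0 < h \<Longrightarrow> h < d1 \<Longrightarrow> p (\<gamma> 1 0) > p (\<gamma> 1 (0 + h))"
          using DERIV_neg_dec_right[OF der neg] by blast
        obtain d2 where d2: "d2 > 0" "\<And>h. 0 < h \<Longrightarrow> h < d2 \<Longrightarrow> p (\<gamma> 1 (0 - h)) > p (\<gamma> 1 0)"
          using DERIV_neg_dec_left[OF der neg] by blast
        let ?e = "min d1 d2 / 2"
        have "?e > 0" "?e < d1" "?e < d2" using d1(1) d2(1) by auto
        then have "p (\<gamma> 1 ?e) < 0" "p (\<gamma> 1 (- ?e)) > 0" using d1(2)[of ?e] d2(2)[of ?e] p0 by auto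
        then show ?thesis using \<open>?e > 0\<close> mult_neg_pos by blast
      qed
      then obtain e where e: "e > 0" "p (\<gamma> 1 e) * p (\<gamma> 1 (- e)) < 0" by blast
      \<comment> \<open>the even degree \<open>2 (k + 1)\<close> on the curve preserves the change of sign when \<open>t = 1 / s\<close> is exchanged for \<open>s\<close>\<close>
      have scale: "p (\<gamma> s 1) = (s\<^sup>2) ^ Suc k * p (\<gamma> 1 (1 / s))" if "s \<noteq> 0" for s
      proof -
        have "\<gamma> s 1 = s\<^sup>2 *\<^sub>R \<gamma> 1 (1 / s)"
          using that by (simp add: \<gamma>_def scaleR_add_right power2_eq_square)
        then show ?thesis using forms_scale[OF p] by simp
      qed
      have cont: "continuous_on S (\<lambda>s. p (\<gamma> s 1))" for S
      proof -
        have "continuous_on S (p \<circ> (\<lambda>s. \<gamma> s 1))"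
          unfolding \<gamma>_def
          by (intro continuous_on_compose continuous_intros)
             (use p in \<open>simp add: forms_polyf continuous_on_polymonial_function flip: real_polynomial_function_eq\<close>)
        then show ?thesis by (simp add: o_def)
      qed
      have "p (\<gamma> (1 / e) 1) * p (\<gamma> (- 1 / e) 1) < 0"
        using e scale[of "1 / e"] scale[of "- 1 / e"]
        by (simp add: mult_less_0_iff zero_less_mult_iff)
      then have "\<exists>s. p (\<gamma> s 1) = 0"
        using IVT'[of "\<lambda>s. p (\<gamma> s 1)" "- 1 / e" 0 "1 / e", OF _ _ _ cont]
          IVT2'[of "\<lambda>s. p (\<gamma> s 1)" "1 / e" 0 "- 1 / e", OF _ _ _ cont] e(1)
        by (auto simp: mult_less_0_iff)
      then obtain s where s: "p (\<gamma> s 1) = 0" by blast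
      define b where "b = \<gamma> s 1"
      have b: "p b = 0" "qform B b = 0" using s iso by (simp_all add: b_def)
      have ab: "a \<bullet> (B *v b) \<noteq> 0"
        using aw c au a(2) by (simp add: b_def \<gamma>_def matrix_vector_right_distrib matrix_vector_mult_scaleR
            inner_add_right flip: qform_def)
      \<comment> \<open>in the basis \<open>a + b\<close>, \<open>a - b\<close> the isotropic lines through \<open>a\<close> and \<open>b\<close> become \<open>y\<^sup>2 - x\<^sup>2 = 0\<close>\<close>
      have "(a + b) \<times> (a - b) \<noteq> 0"
      proof
        assume "(a + b) \<times> (a - b) = 0"
        then obtain e x y where e: "e \<noteq> 0" "a + b = x *\<^sub>R e" "a - b = y *\<^sub>R e" by (rule cross_zero_cases)
        have "a = (1/2) *\<^sub>R ((a + b) + (a - b))" "b = (1/2) *\<^sub>R ((a + b) - (a - b))"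
          by (simp_all add: scaleR_add_right scaleR_diff_right flip: scaleR_add_left)
        then obtain x' y' where e': "a = x' *\<^sub>R e" "b = y' *\<^sub>R e"
          unfolding e(2,3) by (metis scaleR_add_left scaleR_diff_left scaleR_scaleR)
        have "x' \<noteq> 0" using a e' by auto
        then have "qform B e = 0" using a(2) e' qform_scale[of B x' e] by simp
        then show False using ab e' by (simp add: matrix_vector_mult_scaleR flip: qform_def)
      qed
      then show ?thesis
      proof (rule linear_factor_from_plane[OF sym p P, of _ _ "- 2 * (a \<bullet> (B *v b))" "- 1"])
        show "qform B (a + b) = - 2 * (a \<bullet> (B *v b)) * - 1"
          using qform_combination2[OF sym, of 1 a 1 b] a b by simp
        show "qform B (a - b) = - 2 * (a \<bullet> (B *v b))"
          using qform_combination2[OF sym, of 1 a "- 1" b] a b by simp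
        show "(a + b) \<bullet> (B *v (a - b)) = 0"
          using a(2) b(2) symmetric_inner_swap[OF sym, of a b]
          by (simp add: matrix_vector_mult_diff_distrib inner_add_left inner_diff_right qform_def)
        have "p (2 *\<^sub>R a) = 0" "p (2 *\<^sub>R b) = 0" using a b forms_scale[OF p] by simp_all
        then show "- 1 = (1::real) \<and> P (complex_vec (a + b) (a - b)) = 0 \<or>
          - 1 = (- 1::real) \<and> p (a + b + (a - b)) = 0 \<and> p (a + b - (a - b)) = 0 \<or>
          - 1 = (0::real) \<and> p (a + b) = 0 \<and> (\<exists>D. (p has_derivative D) (at (a + b)) \<and> D (a - b) = 0)"
          by (simp add: scaleR_2)
      qed (use ab in simp)
    qed
  qed
qed

text \<open>
  A complex isotropic zero \<open>a + \<i> b\<close> of \<open>p\<close> comes with its conjugate.  If \<open>a\<close> and \<open>b\<close> are independent, these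
  two lie in a real plane on which \<open>Q\<close> is a multiple of \<open>x\<^sup>2 + y\<^sup>2\<close>; otherwise the zero is a complex
  multiple of a real isotropic vector.
\<close>

lemma linear_factor_exists:
  assumes sym: "transpose B = B" and irred: "irreducible_poly_fun (qform B)"
    and p: "p \<in> forms (Suc k)"
  shows "\<exists>l h. l \<noteq> 0 \<and> h \<in> forms k \<and> (\<lambda>v. p v - (l \<bullet> v) * h v) \<in> forms_Q B (Suc k)"
proof -
  obtain P where P: "complexifies p P" using complexification_exists[OF forms_polyf[OF p]] .
  obtain a b where ab: "a \<noteq> 0 \<or> b \<noteq> 0" "qform B a = qform B b" "a \<bullet> (B *v b) = 0"
    "P (complex_vec a b) = 0"
    using isotropic_zero_exists[OF sym irred p _ P] by auto
  show ?thesis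
  proof (cases "a \<times> b = 0")
    case False
    have "qform B b \<noteq> 0" using no_isotropic_plane[OF sym irred False] ab by auto
    then show ?thesis
      by (intro linear_factor_from_plane[OF sym p P False, of "qform B b" 1]) (use ab in auto)
  next
    case True
    then obtain u x y where u: "u \<noteq> 0" "a = x *\<^sub>R u" "b = y *\<^sub>R u" by (rule cross_zero_cases)
    have xy: "x\<^sup>2 * qform B u = y\<^sup>2 * qform B u" "x * y * qform B u = 0" "x \<noteq> 0 \<or> y \<noteq> 0"
      using ab u by (auto simp: qform_scale matrix_vector_mult_scaleR qform_def)
    have Qu: "qform B u = 0"
    proof (rule ccontr)
      assume "qform B u \<noteq> 0"
      with xy have "x\<^sup>2 = y\<^sup>2" "x * y = 0" by auto
      then show False using xy(3) by auto
    qed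
    have "complex_vec a b = Complex x y *s (\<chi> i. of_real (u $ i))"
      by (simp add: complex_vec_def u vec_eq_iff complex_eq_iff)
    then have "Complex x y ^ Suc k * of_real (p u) = 0"
      using complexified_form_scale[OF p P, of "Complex x y"] complexifies_real[OF P, of u] ab(4) by simp
    moreover have "Complex x y \<noteq> 0" using xy(3) by (auto simp: complex_eq_iff)
    ultimately have "p u = 0" by auto
    then show ?thesis using linear_factor_from_real_zero[OF sym irred p u(1) Qu] by blast
  qed
qed

theorem factorisation_modulo_qform:
  assumes sym: "transpose B = B" and irred: "irreducible_poly_fun (qform B)"
    and p: "p \<in> forms k"
  shows "\<exists>c L. (\<forall>\<nu><k. L \<nu> \<noteq> 0) \<and> (\<lambda>v. p v - c * form_prod k L v) \<in> forms_Q B k"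
  using p
proof (induction k arbitrary: p)
  case 0
  have "(\<lambda>v. p v - p 0 * form_prod 0 L v) = (\<lambda>v. 0)" for L
    using form_0_const[OF 0] by (simp add: form_prod_def fun_eq_iff)
  then have "(\<lambda>v. p v - p 0 * form_prod 0 (\<lambda>_. 0) v) \<in> forms_Q B 0"
    using forms_Q_zero by simp
  then show ?case by blast
next
  case (Suc k)
  obtain l h where l: "l \<noteq> 0" "h \<in> forms k" "(\<lambda>v. p v - (l \<bullet> v) * h v) \<in> forms_Q B (Suc k)"
    using linear_factor_exists[OF sym irred Suc.prems] by blast
  obtain c L where L: "\<forall>\<nu><k. L \<nu> \<noteq> 0" "(\<lambda>v. h v - c * form_prod k L v) \<in> forms_Q B k"
    using Suc.IH[OF l(2)] by blast
  let ?L = "\<lambda>\<nu>. case \<nu> of 0 \<Rightarrow> l | Suc i \<Rightarrow> L i"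
  have "(\<lambda>v. (p v - (l \<bullet> v) * h v) + (h v - c * form_prod k L v) * (l \<bullet> v)) \<in> forms_Q B (Suc k)"
    using forms_Q_mult_form[OF L(2) forms_inner[of l]] by (intro forms_Q_add l) simp
  also have "(\<lambda>v. (p v - (l \<bullet> v) * h v) + (h v - c * form_prod k L v) * (l \<bullet> v)) =
      (\<lambda>v. p v - c * form_prod (Suc k) ?L v)"
    by (simp add: form_prod_Suc fun_eq_iff algebra_simps)
  finally show ?case using L(1) l(1)
    by (intro exI[of _ c] exI[of _ ?L] conjI) (auto split: nat.split)
qed

unbundle no cross3_syntax

section \<open>Uniqueness of the factors for definite forms\<close>

lemma pos_def_eq_0: "pos_def_form B \<Longrightarrow> qform B v = 0 \<longleftrightarrow> v = 0"
  by (auto simp: pos_def_form_def)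

text \<open>
  A definite quadratic form vanishes only at 0, also on the hyperplanes of the linear factors, so each of
  these would have to divide the cofactor \<open>g\<close>; cancelling all of them leaves a non-zero constant divisible by \<open>Q\<close>.
\<close>

lemma pos_def_not_dvd_linear_product:
  fixes M :: "'i \<Rightarrow> real^3"
  assumes pd: "pos_def_form B" and U: "subspace U"
    and meets: "\<And>l. \<exists>w\<in>U. w \<noteq> 0 \<and> l \<bullet> w = 0"
    and "finite A" "\<And>i. i \<in> A \<Longrightarrow> \<exists>u\<in>U. M i \<bullet> u \<noteq> 0" "real_polynomial_function g" "d \<noteq> 0"
    and "\<And>v. v \<in> U \<Longrightarrow> d * (\<Prod>i\<in>A. M i \<bullet> v) = qform B v * g v"
  shows False
  using assms(4-)
proof (induction A arbitrary: g rule: finite_induct)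
  case empty
  then show ?case using empty(4)[of 0] subspace_0[OF U] by simp
next
  case (insert i A)
  obtain u0 where u0: "u0 \<in> U" "M i \<bullet> u0 \<noteq> 0" using insert.prems(1) by blast
  define u where "u = (1 / (M i \<bullet> u0)) *\<^sub>R u0"
  have u: "u \<in> U" "M i \<bullet> u = 1" using u0 U by (auto simp: u_def subspace_scale)
  let ?H = "U \<inter> {v. M i \<bullet> v = 0}"
  have H: "subspace ?H" using U subspace_hyperplane by (rule subspace_inter)
  obtain w where w: "w \<in> ?H" "w \<noteq> 0" using meets by blast
  have gH: "g v = 0" if "v \<in> ?H" for v
  proof (rule polyf_zero_product[OF polyf_qform insert.prems(2) H _ w(1) _ that])
    show "qform B w \<noteq> 0" using w pd by (simp add: pos_def_eq_0)
    show "qform B v * g v = 0" if "v \<in> ?H" for v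
      using insert.prems(4)[of v] that insert.hyps by simp
  qed
  obtain g' where g': "real_polynomial_function g'"
    "\<And>v. g v - g (v - (M i \<bullet> v) *\<^sub>R u) = (M i \<bullet> v) * g' v"
    using polyf_shear_difference[OF insert.prems(2)] by blast
  have g_eq: "g v = (M i \<bullet> v) * g' v" if "v \<in> U" for v
  proof -
    have "v - (M i \<bullet> v) *\<^sub>R u \<in> ?H"
      using that u U by (simp add: subspace_diff subspace_scale inner_diff_right)
    then show ?thesis using gH g'(2)[of v] by simp
  qed
  have "d * (\<Prod>i\<in>A. M i \<bullet> v) - qform B v * g' v = 0" if "v \<in> U" for v
  proof (rule polyf_zero_product[OF polyf_inner[of "M i"] _ U _ u(1) _ that])
    show "real_polynomial_function (\<lambda>v. d * (\<Prod>i\<in>A. M i \<bullet> v) - qform B v * g' v)"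
      by (intro real_polynomial_function_diff polyf_cmult real_polynomial_function_prod
          real_polynomial_function.intros(4) polyf_qform g' insert.hyps polyf_inner)
    show "(M i \<bullet> v) * (d * (\<Prod>i\<in>A. M i \<bullet> v) - qform B v * g' v) = 0" if "v \<in> U" for v
      using insert.prems(4)[OF that] g_eq[OF that] insert.hyps by (simp add: algebra_simps)
  qed (use u in simp)
  then show ?case by (intro insert.IH[OF insert.prems(1) g'(1) insert.prems(3)]) auto
qed

lemma linear_product_not_in_forms_Q:
  assumes pd: "pos_def_form B" and L: "\<And>\<nu>. \<nu> < k \<Longrightarrow> L \<nu> \<noteq> 0" and d: "d \<noteq> 0"
  shows "(\<lambda>v. d * form_prod k L v) \<notin> forms_Q B k"
proof
  assume "(\<lambda>v. d * form_prod k L v) \<in> forms_Q B k"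
  then obtain g where g: "real_polynomial_function g" "(\<lambda>v. d * form_prod k L v) = (\<lambda>v. qform B v * g v)"
    by (auto simp: forms_Q_def)
  have "\<exists>w\<in>UNIV. w \<noteq> 0 \<and> l \<bullet> w = 0" for l :: "real^3"
    by (metis orthogonal_to_two_exists inner_commute UNIV_I)
  moreover have "\<exists>u\<in>UNIV. L \<nu> \<bullet> u \<noteq> 0" if "\<nu> \<in> {..<k}" for \<nu>
    using L[of \<nu>] that by (intro bexI[of _ "L \<nu>"]) auto
  ultimately show False
    using pos_def_not_dvd_linear_product[OF pd subspace_UNIV _ finite_lessThan _ g(1) d, of k L] fun_cong[OF g(2)]
    by (simp add: form_prod_def)
qed

text \<open>
  On the plane of a linear factor \<open>L\<^sub>i\<close> of the first product the second product becomes divisible by the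
  definite form \<open>Q\<close>, so one of its factors vanishes there, that is, it is proportional to \<open>L\<^sub>i\<close>; then
  \<open>L\<^sub>i\<close> also divides the cofactor of \<open>Q\<close> and can be cancelled.
\<close>

lemma linear_factors_unique:
  fixes L :: "'i \<Rightarrow> real^3" and L' :: "'j \<Rightarrow> real^3"
  assumes pd: "pos_def_form B"
    and "finite A" "finite A'" "card A = card A'" "\<And>i. i \<in> A \<Longrightarrow> L i \<noteq> 0" "\<And>j. j \<in> A' \<Longrightarrow> L' j \<noteq> 0"
    and "real_polynomial_function g" "d \<noteq> 0"
    and "\<And>v. (\<Prod>i\<in>A. L i \<bullet> v) = d * (\<Prod>j\<in>A'. L' j \<bullet> v) + qform B v * g v"
  shows "\<exists>\<sigma> c. bij_betw \<sigma> A' A \<and> (\<forall>j\<in>A'. c j \<noteq> 0 \<and> L' j = c j *\<^sub>R L (\<sigma> j))"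
  using assms(2-)
proof (induction A arbitrary: A' d g rule: finite_induct)
  case empty
  then show ?case by (auto simp: bij_betw_def)
next
  case (insert i A)
  let ?U = "{v. L i \<bullet> v = 0}"
  have U: "subspace ?U" by (rule subspace_hyperplane)
  have Li: "L i \<noteq> 0" using insert.prems by blast
  have meets: "\<exists>w\<in>?U. w \<noteq> 0 \<and> l \<bullet> w = 0" for l
  proof -
    obtain w where "w \<noteq> 0" "w \<bullet> l = 0" "w \<bullet> L i = 0" using orthogonal_to_two_exists .
    then show ?thesis by (intro bexI[of _ w]) (simp_all add: inner_commute)
  qed
  have "\<exists>j\<in>A'. \<forall>v\<in>?U. L' j \<bullet> v = 0"
  proof (rule ccontr)
    assume *: "\<not> ?thesis"
    show False
    proof (rule pos_def_not_dvd_linear_product[OF pd U meets insert.prems(1)])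
      show "real_polynomial_function (\<lambda>v. - g v)" using insert.prems(5) by (rule real_polynomial_function_minus)
      show "\<exists>u\<in>?U. L' j \<bullet> u \<noteq> 0" if "j \<in> A'" for j using * that by blast
      show "d * (\<Prod>j\<in>A'. L' j \<bullet> v) = qform B v * - g v" if "v \<in> ?U" for v
        using insert.prems(7)[of v] insert.hyps that by simp
    qed (fact insert.prems)
  qed
  then obtain j where j: "j \<in> A'" "\<And>v. L i \<bullet> v = 0 \<Longrightarrow> L' j \<bullet> v = 0" by blast
  define c where "c = (L i \<bullet> L' j) / (L i \<bullet> L i)"
  have L'j: "L' j = c *\<^sub>R L i"
  proof -
    let ?w = "L' j - c *\<^sub>R L i"
    have "L i \<bullet> ?w = 0" using Li by (simp add: c_def inner_diff_right)
    moreover from this have "L' j \<bullet> ?w = 0" by (rule j)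
    ultimately have "?w \<bullet> ?w = 0" by (simp add: inner_diff_left)
    then show ?thesis by simp
  qed
  have c: "c \<noteq> 0" using L'j insert.prems(4)[OF j(1)] by auto
  have prodA': "(\<Prod>j\<in>A'. L' j \<bullet> v) = c * (L i \<bullet> v) * (\<Prod>j\<in>A' - {j}. L' j \<bullet> v)" for v
    using prod.remove[OF insert.prems(1) j(1), of "\<lambda>j. L' j \<bullet> v"] L'j by simp
  obtain w where w: "w \<noteq> 0" "w \<bullet> L i = 0" using orthogonal_to_two_exists by metis
  have "g v = 0" if "L i \<bullet> v = 0" for v
  proof (rule polyf_zero_product[OF polyf_qform insert.prems(5) U, of B w])
    show "qform B v * g v = 0" if "v \<in> ?U" for v
      using insert.prems(7)[of v] insert.hyps that by (simp add: prodA')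
  qed (use w that pd in \<open>auto simp: pos_def_eq_0 inner_commute\<close>)
  then obtain g' where g': "real_polynomial_function g'" "\<And>v. g v = (L i \<bullet> v) * g' v"
    using polyf_vanishing_on_plane[OF insert.prems(5) Li] by blast
  have rest: "(\<Prod>i\<in>A. L i \<bullet> v) = (d * c) * (\<Prod>j\<in>A' - {j}. L' j \<bullet> v) + qform B v * g' v" for v
  proof (rule polyf_cancel[OF polyf_inner[of "L i"]])
    show "(L i \<bullet> v) * (\<Prod>i\<in>A. L i \<bullet> v) = (L i \<bullet> v) * ((d * c) * (\<Prod>j\<in>A' - {j}. L' j \<bullet> v) + qform B v * g' v)" for v
      using insert.prems(7)[of v] insert.hyps by (simp add: prodA' g' algebra_simps)
    show "real_polynomial_function (\<lambda>v. (d * c) * (\<Prod>j\<in>A' - {j}. L' j \<bullet> v) + qform B v * g' v)"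
      using insert.prems(1) by (intro real_polynomial_function.intros(3) polyf_cmult real_polynomial_function_prod
          real_polynomial_function.intros(4) polyf_qform g' polyf_inner) auto
    show "real_polynomial_function (\<lambda>v. \<Prod>i\<in>A. L i \<bullet> v)"
      using insert.hyps by (intro real_polynomial_function_prod polyf_inner)
    show "L i \<bullet> L i \<noteq> 0" using Li by simp
  qed
  have "\<exists>\<sigma> c. bij_betw \<sigma> (A' - {j}) A \<and> (\<forall>l\<in>A' - {j}. c l \<noteq> 0 \<and> L' l = c l *\<^sub>R L (\<sigma> l))"
  proof (rule insert.IH[OF _ _ _ _ g'(1) _ rest])
    show "card A = card (A' - {j})"
      using insert.prems(1,2) insert.hyps j(1) by (simp add: card_Diff_singleton)
  qed (use insert.prems c in auto)
  then obtain \<sigma> e where \<sigma>: "bij_betw \<sigma> (A' - {j}) A"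
    "\<And>l. l \<in> A' - {j} \<Longrightarrow> e l \<noteq> 0 \<and> L' l = e l *\<^sub>R L (\<sigma> l)"
    by blast
  have "bij_betw (\<sigma>(j := i)) A' (insert i A)"
  proof -
    have "bij_betw (\<sigma>(j := i)) (A' - {j}) A"
      using \<sigma>(1) by (rule bij_betw_cong[THEN iffD1, rotated]) auto
    then have "bij_betw (\<sigma>(j := i)) (insert j (A' - {j})) (insert ((\<sigma>(j := i)) j) A)"
      using insert.hyps by (intro notIn_Un_bij_betw[where b = j, simplified]) auto
    then show ?thesis using j(1) by (simp add: insert_absorb)
  qed
  moreover have "\<forall>l\<in>A'. (e(j := c)) l \<noteq> 0 \<and> L' l = (e(j := c)) l *\<^sub>R L ((\<sigma>(j := i)) l)"
    using \<sigma>(2) L'j c by auto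
  ultimately show ?case by blast
qed

section \<open>Multipoles\<close>

lemma multipole_relE:
  assumes "(L, L') \<in> multipole_rel k"
  obtains \<pi> c where "L \<in> {..<k} \<rightarrow>\<^sub>E (UNIV - {0})" "L' \<in> {..<k} \<rightarrow>\<^sub>E (UNIV - {0})"
    "\<pi> permutes {..<k}" "\<forall>\<nu><k. c \<nu> \<noteq> 0" "(\<Prod>\<nu><k. c \<nu>) = 1"
    "\<forall>\<nu><k. L' \<nu> = c \<nu> *\<^sub>R L (\<pi> \<nu>)"
  using assms unfolding multipole_rel_def by blast

lemma equiv_multipole_rel: "equiv ({..<k} \<rightarrow>\<^sub>E (UNIV - {0})) (multipole_rel k)"
proof (rule equivI)
  let ?N = "{..<k} \<rightarrow>\<^sub>E (UNIV - {0 :: real^3})"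
  show "multipole_rel k \<subseteq> ?N \<times> ?N" by (auto simp: multipole_rel_def)
  show "refl_on ?N (multipole_rel k)"
  proof (rule refl_onI)
    fix L :: "nat \<Rightarrow> real^3" assume "L \<in> ?N"
    then show "(L, L) \<in> multipole_rel k"
      unfolding multipole_rel_def
      by (intro CollectI case_prodI conjI exI[of _ id] exI[of _ "\<lambda>_. 1"] permutes_id) simp_all
  qed
  show "sym (multipole_rel k)"
  proof (rule symI)
    fix L L' :: "nat \<Rightarrow> real^3" assume "(L, L') \<in> multipole_rel k"
    then obtain \<pi> c where N: "L \<in> ?N" "L' \<in> ?N" and \<pi>: "\<pi> permutes {..<k}"
      and c_all: "\<forall>\<nu><k. c \<nu> \<noteq> (0::real)" "(\<Prod>\<nu><k. c \<nu>) = 1"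
      and L'_all: "\<forall>\<nu><k. L' \<nu> = c \<nu> *\<^sub>R L (\<pi> \<nu>)"
      by (rule multipole_relE)
    note c = c_all[rule_format] and L' = L'_all[rule_format]
    let ?\<rho> = "inv \<pi>"
    have \<rho>: "?\<rho> permutes {..<k}" using \<pi> by (rule permutes_inv)
    have lt: "?\<rho> \<nu> < k" if "\<nu> < k" for \<nu> using permutes_in_image[OF \<rho>, of \<nu>] that by simp
    have "(\<Prod>\<nu><k. 1 / c (?\<rho> \<nu>)) = (\<Prod>\<nu><k. 1 / c \<nu>)"
      using prod.permute[OF \<rho>, of "\<lambda>\<nu>. 1 / c \<nu>"] by (simp add: o_def)
    also have "\<dots> = 1" using c(2) by (simp add: prod_dividef)
    finally have "(\<Prod>\<nu><k. 1 / c (?\<rho> \<nu>)) = 1" .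
    moreover have "L \<nu> = (1 / c (?\<rho> \<nu>)) *\<^sub>R L' (?\<rho> \<nu>)" if "\<nu> < k" for \<nu>
      using L'[OF lt[OF that]] c(1)[OF lt[OF that]] permutes_inverses(1)[OF \<pi>, of \<nu>] by simp
    moreover have "1 / c (?\<rho> \<nu>) \<noteq> 0" if "\<nu> < k" for \<nu> using c(1)[OF lt[OF that]] by simp
    ultimately show "(L', L) \<in> multipole_rel k"
      unfolding multipole_rel_def using N \<rho>
      by (intro CollectI case_prodI conjI exI[of _ ?\<rho>] exI[of _ "\<lambda>\<nu>. 1 / c (?\<rho> \<nu>)"]) auto
  qed
  show "trans (multipole_rel k)"
  proof (rule transI)
    fix L L' L'' :: "nat \<Rightarrow> real^3"
    assume LL: "(L, L') \<in> multipole_rel k" and LL': "(L', L'') \<in> multipole_rel k"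
    obtain \<pi> c where NL: "L \<in> ?N" "L' \<in> ?N" and \<pi>1: "\<pi> permutes {..<k}"
      and c_all: "\<forall>\<nu><k. c \<nu> \<noteq> (0::real)" "(\<Prod>\<nu><k. c \<nu>) = 1"
      and L'_all: "\<forall>\<nu><k. L' \<nu> = c \<nu> *\<^sub>R L (\<pi> \<nu>)"
      using LL by (rule multipole_relE)
    obtain \<pi>' c' where NL'': "L' \<in> ?N" "L'' \<in> ?N" and \<pi>2: "\<pi>' permutes {..<k}"
      and c'_all: "\<forall>\<nu><k. c' \<nu> \<noteq> (0::real)" "(\<Prod>\<nu><k. c' \<nu>) = 1"
      and L''_all: "\<forall>\<nu><k. L'' \<nu> = c' \<nu> *\<^sub>R L' (\<pi>' \<nu>)"
      using LL' by (rule multipole_relE)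
    note c = c_all[rule_format] and L' = L'_all[rule_format]
      and c' = c'_all[rule_format] and L'' = L''_all[rule_format]
    note \<pi> = \<pi>1 \<pi>2 and N = NL(1) NL''(2)
    have lt: "\<pi>' \<nu> < k" if "\<nu> < k" for \<nu> using permutes_in_image[OF \<pi>(2), of \<nu>] that by simp
    have "(\<Prod>\<nu><k. c (\<pi>' \<nu>)) = 1" using prod.permute[OF \<pi>(2), of c] c by (simp add: o_def)
    then have "(\<Prod>\<nu><k. c' \<nu> * c (\<pi>' \<nu>)) = 1" using c' by (simp add: prod.distrib)
    moreover have "L'' \<nu> = (c' \<nu> * c (\<pi>' \<nu>)) *\<^sub>R L ((\<pi> \<circ> \<pi>') \<nu>)" if "\<nu> < k" for \<nu>
      using L''[OF that] L'[OF lt[OF that]] by simp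
    moreover have "c' \<nu> * c (\<pi>' \<nu>) \<noteq> 0" if "\<nu> < k" for \<nu> using c(1)[OF lt[OF that]] c'(1)[OF that] by simp
    ultimately show "(L, L'') \<in> multipole_rel k"
      unfolding multipole_rel_def using N permutes_compose[OF \<pi>(2,1)]
      by (intro CollectI case_prodI conjI exI[of _ "\<pi> \<circ> \<pi>'"] exI[of _ "\<lambda>\<nu>. c' \<nu> * c (\<pi>' \<nu>)"]) auto
  qed
qed

text \<open>
  The factors are proportional up to a permutation, and the product of the proportionality constants
  has to be 1, because no non-zero multiple of a product of linear forms is divisible by \<open>Q\<close>.
\<close>

lemma multipole_relI:
  assumes pd: "pos_def_form B"
    and N: "L \<in> {..<k} \<rightarrow>\<^sub>E (UNIV - {0})" "L' \<in> {..<k} \<rightarrow>\<^sub>E (UNIV - {0})"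
    and diff: "(\<lambda>v. form_prod k L v - form_prod k L' v) \<in> forms_Q B k"
  shows "(L, L') \<in> multipole_rel k"
proof -
  have nz: "L \<nu> \<noteq> 0" "L' \<nu> \<noteq> 0" if "\<nu> < k" for \<nu> using N that by (auto simp: PiE_iff)
  obtain g where g: "real_polynomial_function g"
    "(\<lambda>v. form_prod k L v - form_prod k L' v) = (\<lambda>v. qform B v * g v)"
    using diff by (auto simp: forms_Q_def)
  have "\<exists>\<sigma> c. bij_betw \<sigma> {..<k} {..<k} \<and> (\<forall>\<nu>\<in>{..<k}. c \<nu> \<noteq> 0 \<and> L' \<nu> = c \<nu> *\<^sub>R L (\<sigma> \<nu>))"
  proof (rule linear_factors_unique[OF pd _ _ _ _ _ g(1), of _ _ _ _ 1])
    show "(\<Prod>i<k. L i \<bullet> v) = 1 * (\<Prod>j<k. L' j \<bullet> v) + qform B v * g v" for v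
      using fun_cong[OF g(2), of v] by (simp add: form_prod_def)
  qed (use nz in auto)
  then obtain \<sigma> c where \<sigma>: "bij_betw \<sigma> {..<k} {..<k}"
    and c: "\<And>\<nu>. \<nu> < k \<Longrightarrow> c \<nu> \<noteq> 0" "\<And>\<nu>. \<nu> < k \<Longrightarrow> L' \<nu> = c \<nu> *\<^sub>R L (\<sigma> \<nu>)" by auto
  define \<pi> where "\<pi> \<nu> = (if \<nu> < k then \<sigma> \<nu> else \<nu>)" for \<nu>
  have "bij_betw \<pi> {..<k} {..<k}"
    using \<sigma> by (rule bij_betw_cong[THEN iffD1, rotated]) (simp add: \<pi>_def)
  then have \<pi>: "\<pi> permutes {..<k}" by (rule bij_imp_permutes) (simp add: \<pi>_def)
  have L': "L' \<nu> = c \<nu> *\<^sub>R L (\<pi> \<nu>)" if "\<nu> < k" for \<nu> using c that by (simp add: \<pi>_def)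
  have "form_prod k L' v = (\<Prod>\<nu><k. c \<nu>) * form_prod k L v" for v
  proof -
    have "form_prod k L' v = (\<Prod>\<nu><k. c \<nu> * (L (\<pi> \<nu>) \<bullet> v))"
      unfolding form_prod_def by (rule prod.cong) (simp_all add: L')
    also have "\<dots> = (\<Prod>\<nu><k. c \<nu>) * (\<Prod>\<nu><k. L (\<pi> \<nu>) \<bullet> v)" by (simp add: prod.distrib)
    also have "(\<Prod>\<nu><k. L (\<pi> \<nu>) \<bullet> v) = form_prod k L v"
      unfolding form_prod_def using prod.permute[OF \<pi>, of "\<lambda>\<nu>. L \<nu> \<bullet> v"] by (simp add: o_def)
    finally show ?thesis .
  qed
  then have "(\<lambda>v. (1 - (\<Prod>\<nu><k. c \<nu>)) * form_prod k L v) \<in> forms_Q B k"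
    using diff by (simp add: algebra_simps)
  then have "(\<Prod>\<nu><k. c \<nu>) = 1"
    using linear_product_not_in_forms_Q[OF pd nz(1), where d = "1 - (\<Prod>\<nu><k. c \<nu>)"] by fastforce
  then show ?thesis
    unfolding multipole_rel_def using N \<pi> c(1) L'
    by (intro CollectI case_prodI conjI exI[of _ \<pi>] exI[of _ c]) auto
qed

lemma Theta_multipole_of:
  assumes "L \<in> {..<k} \<rightarrow>\<^sub>E UNIV"
  shows "Theta k (multipole_of k L) = form_prod k L"
proof (cases "\<exists>\<nu><k. L \<nu> = 0")
  case True
  then have "form_prod k L v = 0" for v by (force simp: form_prod_def)
  then show ?thesis using True by (simp add: multipole_of_def fun_eq_iff)
next
  case False
  then have "L \<in> {..<k} \<rightarrow>\<^sub>E (UNIV - {0})" using assms by (auto simp: PiE_iff)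
  then have L: "L \<in> multipole_rel k `` {L}"
    by (rule equiv_class_self[OF equiv_multipole_rel])
  have eq: "form_prod k L' = form_prod k L" if "L' \<in> multipole_rel k `` {L}" for L'
    using that by (auto intro: form_prod_multipole_rel)
  have "form_prod k ` (multipole_rel k `` {L}) = (\<lambda>_. form_prod k L) ` (multipole_rel k `` {L})"
    by (rule image_cong[OF refl]) (rule eq)
  also have "\<dots> = {form_prod k L}" using L by (rule image_constant)
  finally have "form_prod k ` (multipole_rel k `` {L}) = {form_prod k L}" .
  then show ?thesis using False by (auto simp: multipole_of_def)
qed

lemma multipoles_pos:
  assumes "k \<noteq> 0"
  shows "multipoles k = multipole_of k ` ({..<k} \<rightarrow>\<^sub>E UNIV)"
  using topspace_multipole_topology[of k] assms
  by (simp add: multipole_topology_def topspace_quotient_topology)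

lemma forms_Q_0: "forms_Q B 0 = {\<lambda>v. 0}"
proof (intro set_eqI iffI)
  fix p assume "p \<in> forms_Q B 0"
  then show "p \<in> {\<lambda>v. 0}" by (rule forms_Q_cofactor) auto
qed (simp add: forms_Q_zero)

lemma Theta_in_forms:
  assumes "w \<in> multipoles k"
  shows "Theta k w \<in> forms k"
proof (cases "k = 0")
  case True
  then show ?thesis using assms by (auto simp: multipoles_def forms_def)
next
  case False
  then show ?thesis using assms Theta_multipole_of form_prod_in_forms by (auto simp: multipoles_pos)
qed

lemma Theta_injective_modulo_qform:
  assumes pd: "pos_def_form B" and w: "w \<in> multipoles k" "w' \<in> multipoles k"
    and diff: "(\<lambda>v. Theta k w v - Theta k w' v) \<in> forms_Q B k"
  shows "w = w'"
proof (cases "k = 0")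
  case True
  then obtain c c' where "w = Scalar_Multipole c" "w' = Scalar_Multipole c'"
    using w by (auto simp: multipoles_def)
  then show ?thesis using diff True by (auto simp: forms_Q_0 fun_eq_iff)
next
  case False
  then obtain L L' where L: "L \<in> {..<k} \<rightarrow>\<^sub>E UNIV" "w = multipole_of k L"
    and L': "L' \<in> {..<k} \<rightarrow>\<^sub>E UNIV" "w' = multipole_of k L'"
    using w by (auto simp: multipoles_pos)
  have fp: "(\<lambda>v. form_prod k L v - form_prod k L' v) \<in> forms_Q B k"
    using diff L L' by (simp add: Theta_multipole_of)
  have zero: "form_prod k M v = 0" if "\<exists>\<nu><k. M \<nu> = 0" for M v
    using that by (force simp: form_prod_def)
  have nonzero: False if "\<forall>\<nu><k. M \<nu> \<noteq> 0" "(\<lambda>v. d * form_prod k M v) \<in> forms_Q B k" "d \<noteq> 0" for M and d :: real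
    using linear_product_not_in_forms_Q[OF pd, of k M d] that by blast
  show ?thesis
  proof (cases "\<exists>\<nu><k. L \<nu> = 0"; cases "\<exists>\<nu><k. L' \<nu> = 0")
    assume "\<exists>\<nu><k. L \<nu> = 0" "\<exists>\<nu><k. L' \<nu> = 0"
    then show ?thesis using L L' by (simp add: multipole_of_def)
  next
    assume "\<exists>\<nu><k. L \<nu> = 0" "\<not> (\<exists>\<nu><k. L' \<nu> = 0)"
    then show ?thesis using nonzero[of L' "- 1"] fp zero[of L] by simp
  next
    assume "\<not> (\<exists>\<nu><k. L \<nu> = 0)" "\<exists>\<nu><k. L' \<nu> = 0"
    then show ?thesis using nonzero[of L 1] fp zero[of L'] by simp
  next
    assume n: "\<not> (\<exists>\<nu><k. L \<nu> = 0)" "\<not> (\<exists>\<nu><k. L' \<nu> = 0)"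
    then have "(L, L') \<in> multipole_rel k"
      using L L' by (intro multipole_relI[OF pd _ _ fp]) (auto simp: PiE_iff)
    then have "multipole_rel k `` {L} = multipole_rel k `` {L'}"
      by (rule equiv_class_eq[OF equiv_multipole_rel])
    then show ?thesis using n L L' by (simp add: multipole_of_def)
  qed
qed

text \<open>
  The constant of the factorisation is absorbed into the first linear form; the constant 0 gives the
  zero multipole.
\<close>

lemma Theta_surjective_modulo_qform:
  assumes sym: "transpose B = B" and irred: "irreducible_poly_fun (qform B)" and p: "p \<in> forms k"
  obtains w where "w \<in> multipoles k" "(\<lambda>v. p v - Theta k w v) \<in> forms_Q B k"
proof (cases "k = 0")
  case True
  have "(\<lambda>v. p v - Theta k (Scalar_Multipole (p 0)) v) = (\<lambda>v. 0)"
    using p form_0_const True by (simp add: fun_eq_iff)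
  moreover have "Scalar_Multipole (p 0) \<in> multipoles k" using True by (simp add: multipoles_def)
  ultimately show ?thesis using that forms_Q_zero by metis
next
  case False
  obtain c L where L: "(\<lambda>v. p v - c * form_prod k L v) \<in> forms_Q B k"
    using factorisation_modulo_qform[OF sym irred p] by blast
  let ?L = "\<lambda>\<nu>\<in>{..<k}. if \<nu> = 0 then c *\<^sub>R L 0 else L \<nu>"
  obtain j where j: "k = Suc j" using False by (cases k) auto
  have "form_prod k ?L v = c * form_prod k L v" for v
    by (simp only: form_prod_def j prod.lessThan_Suc_shift) simp
  then have "(\<lambda>v. p v - Theta k (multipole_of k ?L) v) \<in> forms_Q B k"
    using L by (simp add: Theta_multipole_of)
  moreover have "multipole_of k ?L \<in> multipoles k" using False by (simp add: multipoles_pos)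
  ultimately show ?thesis using that by blast
qed

section \<open>Square integrable functions\<close>

lemma l2_mult_integrable:
  assumes "l2_integrable m f" "l2_integrable m g"
  shows "integrable m (\<lambda>v. f v * g v)"
proof (rule Bochner_Integration.integrable_bound)
  show "integrable m (\<lambda>v. (f v)\<^sup>2 + (g v)\<^sup>2)" using assms by (simp add: l2_integrable_def)
  show "(\<lambda>v. f v * g v) \<in> borel_measurable m"
    using assms by (auto simp: l2_integrable_def intro: borel_measurable_times)
  have "\<bar>f v * g v\<bar> \<le> (f v)\<^sup>2 + (g v)\<^sup>2" for v
  proof -
    have "0 \<le> (\<bar>f v\<bar> - \<bar>g v\<bar>)\<^sup>2" by simp
    then have "2 * (\<bar>f v\<bar> * \<bar>g v\<bar>) \<le> (f v)\<^sup>2 + (g v)\<^sup>2" by (simp add: power2_diff)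
    moreover have "0 \<le> \<bar>f v\<bar> * \<bar>g v\<bar>" by simp
    ultimately show ?thesis unfolding abs_mult by linarith
  qed
  then show "AE v in m. norm (f v * g v) \<le> norm ((f v)\<^sup>2 + (g v)\<^sup>2)" by simp
qed

lemma l2_integrable_add:
  assumes "l2_integrable m f" "l2_integrable m g"
  shows "l2_integrable m (\<lambda>v. f v + g v)"
proof -
  have "(\<lambda>v. (f v + g v)\<^sup>2) = (\<lambda>v. (f v)\<^sup>2 + (g v)\<^sup>2 + 2 * (f v * g v))"
    by (simp add: power2_sum fun_eq_iff)
  then show ?thesis
    using assms l2_mult_integrable[OF assms]
    by (auto simp: l2_integrable_def intro: borel_measurable_add)
qed

lemma l2_integrable_cmult: "l2_integrable m f \<Longrightarrow> l2_integrable m (\<lambda>v. c * f v)"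
  by (auto simp: l2_integrable_def power_mult_distrib intro: borel_measurable_times)

lemma l2_integrable_diff: "l2_integrable m f \<Longrightarrow> l2_integrable m g \<Longrightarrow> l2_integrable m (\<lambda>v. f v - g v)"
  using l2_integrable_add[of m f "\<lambda>v. - 1 * g v"] l2_integrable_cmult[of m g "- 1"] by simp

lemma l2_integrable_zero: "l2_integrable m (\<lambda>v. 0)"
  by (simp add: l2_integrable_def)

lemma l2_integrable_sum:
  "(\<And>i. i \<in> I \<Longrightarrow> l2_integrable m (f i)) \<Longrightarrow> l2_integrable m (\<lambda>v. \<Sum>i\<in>I. f i v)"
  by (induction I rule: infinite_finite_induct) (auto intro: l2_integrable_zero l2_integrable_add)

lemma l2_inner_commute: "l2_inner m f g = l2_inner m g f"
  by (simp add: l2_inner_def mult.commute)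

lemma l2_inner_self_nonneg: "0 \<le> l2_inner m f f"
  by (simp add: l2_inner_def)

lemma l2_inner_cmult: "l2_inner m (\<lambda>v. c * f v) g = c * l2_inner m f g"
  by (simp add: l2_inner_def mult.assoc)

lemma l2_inner_cmult_right: "l2_inner m g (\<lambda>v. c * f v) = c * l2_inner m g f"
  by (simp add: l2_inner_commute[of m g] l2_inner_cmult)

lemma l2_inner_add:
  assumes "l2_integrable m f" "l2_integrable m g" "l2_integrable m h"
  shows "l2_inner m (\<lambda>v. f v + g v) h = l2_inner m f h + l2_inner m g h"
  by (simp add: l2_inner_def distrib_right Bochner_Integration.integral_add l2_mult_integrable assms)

lemma l2_inner_diff:
  assumes "l2_integrable m f" "l2_integrable m g" "l2_integrable m h"
  shows "l2_inner m (\<lambda>v. f v - g v) h = l2_inner m f h - l2_inner m g h"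
  by (simp add: l2_inner_def left_diff_distrib Bochner_Integration.integral_diff l2_mult_integrable assms)

lemma l2_inner_add_right:
  assumes "l2_integrable m f" "l2_integrable m g" "l2_integrable m h"
  shows "l2_inner m h (\<lambda>v. f v + g v) = l2_inner m h f + l2_inner m h g"
  by (simp add: l2_inner_commute[of m h] l2_inner_add assms)

lemma l2_inner_diff_right:
  assumes "l2_integrable m f" "l2_integrable m g" "l2_integrable m h"
  shows "l2_inner m h (\<lambda>v. f v - g v) = l2_inner m h f - l2_inner m h g"
  by (simp add: l2_inner_commute[of m h] l2_inner_diff assms)

lemma l2_inner_zero: "l2_inner m (\<lambda>v. 0) f = 0"
  by (simp add: l2_inner_def)

lemma l2_inner_sum:
  assumes "\<And>i. i \<in> I \<Longrightarrow> l2_integrable m (f i)" "l2_integrable m g"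
  shows "l2_inner m (\<lambda>v. \<Sum>i\<in>I. f i v) g = (\<Sum>i\<in>I. l2_inner m (f i) g)"
  using assms
  by (induction I rule: infinite_finite_induct)
     (simp_all add: l2_inner_zero l2_inner_add l2_integrable_sum)

lemma l2_norm_nonneg: "0 \<le> l2_norm m f"
  by (simp add: l2_norm_def l2_inner_self_nonneg)

lemma l2_norm_square: "(l2_norm m f)\<^sup>2 = l2_inner m f f"
  by (simp add: l2_norm_def l2_inner_self_nonneg)

lemma l2_norm_cmult: "l2_norm m (\<lambda>v. c * f v) = \<bar>c\<bar> * l2_norm m f"
  by (simp add: l2_norm_def l2_inner_cmult l2_inner_cmult_right real_sqrt_mult flip: mult.assoc)

lemma l2_norm_minus_commute: "l2_norm m (\<lambda>v. f v - g v) = l2_norm m (\<lambda>v. g v - f v)"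
  using l2_norm_cmult[of m "- 1" "\<lambda>v. f v - g v"] by simp

lemma l2_inner_diff_self:
  assumes "l2_integrable m f" "l2_integrable m g"
  shows "l2_inner m (\<lambda>v. f v - g v) (\<lambda>v. f v - g v) = l2_inner m f f - 2 * l2_inner m f g + l2_inner m g g"
  by (simp add: l2_inner_diff l2_inner_diff_right l2_integrable_diff assms l2_inner_commute[of m g f])

lemma l2_Cauchy_Schwarz:
  assumes f: "l2_integrable m f" and g: "l2_integrable m g"
  shows "\<bar>l2_inner m f g\<bar> \<le> l2_norm m f * l2_norm m g"
proof -
  let ?a = "l2_inner m g g" and ?b = "l2_inner m f g" and ?c = "l2_inner m f f"
  have q: "0 \<le> s\<^sup>2 * ?c - 2 * s * t * ?b + t\<^sup>2 * ?a" for s t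
    using l2_inner_self_nonneg[of m "\<lambda>v. s * f v - t * g v"]
      l2_inner_diff_self[OF l2_integrable_cmult[OF f] l2_integrable_cmult[OF g], of s t]
    by (simp add: l2_inner_cmult l2_inner_cmult_right power2_eq_square mult.assoc)
  have "?b\<^sup>2 \<le> ?c * ?a"
  proof (cases "?a = 0")
    case True
    have "?b = 0"
    proof (rule ccontr)
      assume "?b \<noteq> 0"
      then show False using q[of 1 "(?c + 1) / (2 * ?b)"] True by (simp add: field_simps)
    qed
    then show ?thesis using True by simp
  next
    case False
    then have a: "?a > 0" using l2_inner_self_nonneg[of m g] by simp
    have "0 \<le> ?a * (?c * ?a - ?b\<^sup>2)" using q[of ?a ?b] by (simp add: algebra_simps power2_eq_square)
    then show ?thesis using a by (simp add: zero_le_mult_iff)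
  qed
  then have "\<bar>?b\<bar>\<^sup>2 \<le> (l2_norm m f * l2_norm m g)\<^sup>2" by (simp add: power_mult_distrib l2_norm_square)
  then show ?thesis by (rule power2_le_imp_le) (simp add: l2_norm_nonneg)
qed

lemma l2_Pythagoras:
  assumes "l2_integrable m f" "l2_integrable m g" "l2_inner m f g = 0"
  shows "(l2_norm m (\<lambda>v. f v + g v))\<^sup>2 = (l2_norm m f)\<^sup>2 + (l2_norm m g)\<^sup>2"
  by (simp add: l2_norm_square l2_inner_add l2_inner_add_right l2_integrable_add assms l2_inner_commute[of m g f])

section \<open>Finite-dimensional spaces of functions\<close>

inductive_set fun_span :: "('a \<Rightarrow> real) set \<Rightarrow> ('a \<Rightarrow> real) set" for E where
  zero: "(\<lambda>v. 0) \<in> fun_span E"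
| add: "f \<in> fun_span E \<Longrightarrow> e \<in> E \<Longrightarrow> (\<lambda>v. f v + c * e v) \<in> fun_span E"

lemma fun_span_base: "e \<in> E \<Longrightarrow> e \<in> fun_span E"
  using fun_span.add[OF fun_span.zero, of e E 1] by simp

lemma fun_span_mono:
  assumes "E \<subseteq> E'" shows "fun_span E \<subseteq> fun_span E'"
proof
  fix f assume "f \<in> fun_span E"
  then show "f \<in> fun_span E'" by induction (use assms in \<open>auto intro: fun_span.intros\<close>)
qed

lemma fun_span_add:
  assumes "f \<in> fun_span E" "g \<in> fun_span E"
  shows "(\<lambda>v. f v + g v) \<in> fun_span E"
  using assms(2)
proof induction
  case zero
  then show ?case using assms by simp
next
  case (add g e c)
  from fun_span.add[OF add.IH add.hyps(2), of c] show ?case by (simp add: add.assoc)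
qed

lemma fun_span_cmult:
  assumes "f \<in> fun_span E"
  shows "(\<lambda>v. c * f v) \<in> fun_span E"
  using assms
proof induction
  case zero
  show ?case using fun_span.zero by simp
next
  case (add f e d)
  from fun_span.add[OF add.IH add.hyps(2), of "c * d"] show ?case by (simp add: algebra_simps)
qed

lemma fun_span_mult:
  assumes "f \<in> fun_span E"
  shows "(\<lambda>v. h v * f v) \<in> fun_span ((\<lambda>e v. h v * e v) ` E)"
  using assms
proof induction
  case zero
  show ?case using fun_span.zero by simp
next
  case (add f e d)
  then have "(\<lambda>v. h v * e v) \<in> (\<lambda>e v. h v * e v) ` E" by blast
  from fun_span.add[OF add.IH this, of d] show ?case by (simp add: algebra_simps)
qed

lemma fun_span_l2_integrable:
  assumes "\<And>e. e \<in> E \<Longrightarrow> l2_integrable m e" "f \<in> fun_span E"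
  shows "l2_integrable m f"
  using assms(2)
proof induction
  case zero
  show ?case by (rule l2_integrable_zero)
next
  case (add f e c)
  show ?case by (intro l2_integrable_add l2_integrable_cmult add.IH assms(1) add.hyps)
qed

lemma fun_span_orthogonal:
  assumes "\<And>e. e \<in> E \<Longrightarrow> l2_integrable m e" "l2_integrable m f" "\<And>e. e \<in> E \<Longrightarrow> l2_inner m f e = 0"
    and "r \<in> fun_span E"
  shows "l2_inner m f r = 0"
  using assms(4)
proof induction
  case zero
  show ?case by (simp add: l2_inner_def)
next
  case (add r e c)
  then show ?case
    by (simp add: l2_inner_add_right l2_inner_cmult_right assms l2_integrable_cmult fun_span_l2_integrable[OF assms(1)])
qed

text \<open>
  Gram-Schmidt.  The inner product may be degenerate: if the orthogonal component \<open>s\<close> of a new vector has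
  norm zero, everything is orthogonal to \<open>s\<close> by the Cauchy-Schwarz inequality.
\<close>

lemma orthogonal_projection_exists:
  assumes "finite E" "\<And>e. e \<in> E \<Longrightarrow> l2_integrable m e" "l2_integrable m f"
  shows "\<exists>q\<in>fun_span E. \<forall>r\<in>fun_span E. l2_inner m (\<lambda>v. f v - q v) r = 0"
  using assms
proof (induction E arbitrary: f rule: finite_induct)
  case empty
  have "r = (\<lambda>v. 0)" if "r \<in> fun_span {}" for r :: "real^3 \<Rightarrow> real"
    using that by (cases rule: fun_span.cases) auto
  then show ?case using fun_span.zero by (fastforce simp: l2_inner_def)
next
  case (insert e E)
  have L2: "\<And>e. e \<in> E \<Longrightarrow> l2_integrable m e" "l2_integrable m e" using insert.prems by auto
  obtain q where q: "q \<in> fun_span E" "\<And>r. r \<in> fun_span E \<Longrightarrow> l2_inner m (\<lambda>v. f v - q v) r = 0"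
    using insert.IH[OF L2(1) insert.prems(2)] by blast
  obtain d where d: "d \<in> fun_span E" "\<And>r. r \<in> fun_span E \<Longrightarrow> l2_inner m (\<lambda>v. e v - d v) r = 0"
    using insert.IH[OF L2(1) L2(2)] by blast
  let ?s = "\<lambda>v. e v - d v"
  have L2s: "l2_integrable m ?s" "l2_integrable m (\<lambda>v. f v - q v)" "l2_integrable m q" "l2_integrable m d"
    using L2 insert.prems(2) fun_span_l2_integrable[OF L2(1)] q(1) d(1) by (auto intro!: l2_integrable_diff)
  define t where "t = l2_inner m (\<lambda>v. f v - q v) ?s / l2_inner m ?s ?s"
  have ts: "t * l2_inner m ?s ?s = l2_inner m (\<lambda>v. f v - q v) ?s"
  proof (cases "l2_inner m ?s ?s = 0")
    case True
    then show ?thesis using l2_Cauchy_Schwarz[OF L2s(2,1)] by (simp add: l2_norm_def)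
  qed (simp add: t_def)
  let ?q = "\<lambda>v. q v + t * (e v - d v)"
  have sub: "fun_span E \<subseteq> fun_span (insert e E)" by (rule fun_span_mono) blast
  have "(\<lambda>v. e v + - 1 * d v) \<in> fun_span (insert e E)"
    using subsetD[OF sub d(1)] by (intro fun_span_add fun_span_cmult) (auto intro: fun_span_base)
  from fun_span_cmult[OF this, of t] have "(\<lambda>v. t * (e v - d v)) \<in> fun_span (insert e E)" by simp
  then have "?q \<in> fun_span (insert e E)" using q(1) sub by (intro fun_span_add) auto
  moreover have "l2_inner m (\<lambda>v. f v - ?q v) r = 0" if "r \<in> fun_span (insert e E)" for r
  proof (rule fun_span_orthogonal[OF insert.prems(1) _ _ that])
    show L2r: "l2_integrable m (\<lambda>v. f v - ?q v)"
      by (intro l2_integrable_diff l2_integrable_add l2_integrable_cmult L2s insert.prems(2) L2(2))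
    have eq: "(\<lambda>v. f v - ?q v) = (\<lambda>v. (f v - q v) - t * ?s v)" by (simp add: algebra_simps)
    have E: "l2_inner m (\<lambda>v. f v - ?q v) r = 0" if "r \<in> fun_span E" for r
      unfolding eq using q(2)[OF that] d(2)[OF that] fun_span_l2_integrable[OF L2(1) that]
      by (simp add: l2_inner_diff l2_inner_cmult L2s l2_integrable_cmult)
    fix e' assume "e' \<in> insert e E"
    then consider "e' = e" | "e' \<in> E" by blast
    then show "l2_inner m (\<lambda>v. f v - ?q v) e' = 0"
    proof cases
      case 1
      have "l2_inner m (\<lambda>v. f v - ?q v) ?s = 0"
        unfolding eq using ts by (simp add: l2_inner_diff l2_inner_cmult L2s l2_integrable_cmult)
      then show ?thesis
        using E[OF d(1)] 1 L2(2) L2s(4) L2r by (simp add: l2_inner_diff_right)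
    next
      case 2
      then show ?thesis using E fun_span_base by blast
    qed
  qed
  ultimately show ?case by (intro bexI[of _ ?q] ballI)
qed

lemma polyf_coordinate_expansion:
  fixes p :: "real^3 \<Rightarrow> real"
  assumes "real_polynomial_function p"
  shows "\<exists>g :: 3 \<Rightarrow> real^3 \<Rightarrow> real. (\<forall>i. real_polynomial_function (g i)) \<and>
    (\<forall>v. p v = p 0 + (\<Sum>i\<in>UNIV. (axis i 1 \<bullet> v) * g i v))"
  using assms
proof (induction p rule: real_polynomial_function.induct)
  case (linear f)
  have exp: "f v = f 0 + (\<Sum>i\<in>UNIV. (axis i 1 \<bullet> v) * f (axis i 1))" for v
  proof -
    have "f v = f (\<Sum>i\<in>UNIV. (v $ i) *\<^sub>R axis i 1)"
      by (simp add: basis_expansion scalar_mult_eq_scaleR[symmetric])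
    then show ?thesis
      using linear by (simp add: bounded_linear.linear linear_sum linear_cmul linear_0 inner_axis')
  qed
  show ?case
    by (intro exI[of _ "\<lambda>i v. f (axis i 1)"] conjI allI real_polynomial_function.intros(2)) (rule exp)
next
  case (const c)
  show ?case by (intro exI[of _ "\<lambda>i v. 0"]) auto
next
  case (add p q)
  then obtain g h :: "3 \<Rightarrow> real^3 \<Rightarrow> real" where
    "\<And>i. real_polynomial_function (g i)" "\<And>i. real_polynomial_function (h i)"
    "\<And>v. p v = p 0 + (\<Sum>i\<in>UNIV. (axis i 1 \<bullet> v) * g i v)"
    "\<And>v. q v = q 0 + (\<Sum>i\<in>UNIV. (axis i 1 \<bullet> v) * h i v)" by blast
  note gh = this
  have "p v + q v = (p 0 + q 0) + (\<Sum>i\<in>UNIV. (axis i 1 \<bullet> v) * (g i v + h i v))" for v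
    using gh(3)[of v] gh(4)[of v] by (simp add: distrib_left sum.distrib)
  then show ?case
    by (intro exI[of _ "\<lambda>i v. g i v + h i v"] conjI allI real_polynomial_function.intros(3) gh(1,2))
next
  case (mult p q)
  then obtain g h :: "3 \<Rightarrow> real^3 \<Rightarrow> real" where
    "\<And>i. real_polynomial_function (g i)" "\<And>i. real_polynomial_function (h i)"
    "\<And>v. p v = p 0 + (\<Sum>i\<in>UNIV. (axis i 1 \<bullet> v) * g i v)"
    "\<And>v. q v = q 0 + (\<Sum>i\<in>UNIV. (axis i 1 \<bullet> v) * h i v)" by blast
  note gh = this
  have prod_exp: "p v * q v = p 0 * q 0 + (\<Sum>i\<in>UNIV. (axis i 1 \<bullet> v) * (p 0 * h i v + g i v * q v))" for v
  proof -
    have "p v * q v = p 0 * q v + (\<Sum>i\<in>UNIV. (axis i 1 \<bullet> v) * g i v) * q v"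
      by (subst gh(3)) (rule distrib_right)
    also have "p 0 * q v = p 0 * q 0 + p 0 * (\<Sum>i\<in>UNIV. (axis i 1 \<bullet> v) * h i v)"
      by (subst gh(4)) (rule distrib_left)
    also have "p 0 * (\<Sum>i\<in>UNIV. (axis i 1 \<bullet> v) * h i v) = (\<Sum>i\<in>UNIV. (axis i 1 \<bullet> v) * (p 0 * h i v))"
      by (simp only: sum_distrib_left mult.left_commute)
    also have "(\<Sum>i\<in>UNIV. (axis i 1 \<bullet> v) * g i v) * q v = (\<Sum>i\<in>UNIV. (axis i 1 \<bullet> v) * (g i v * q v))"
      by (simp only: sum_distrib_right mult.assoc)
    finally show ?thesis by (simp only: distrib_left sum.distrib add.assoc)
  qed
  have "real_polynomial_function (\<lambda>v. p 0 * h i v + g i v * q v)" for i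
    by (intro real_polynomial_function.intros(3,4) polyf_cmult gh(1,2) mult.hyps)
  with prod_exp show ?case
    by (intro exI[of _ "\<lambda>i v. p 0 * h i v + g i v * q v"] conjI allI)
qed

text \<open>
  The homogeneous parts of the coordinate expansion of a form of positive degree express it by the
  coordinates and forms of one degree less.
\<close>

lemma forms_finite_dimensional:
  "\<exists>E. finite E \<and> E \<subseteq> forms k \<and> forms k \<subseteq> fun_span E"
proof (induction k)
  case 0
  have "p \<in> fun_span {\<lambda>v. 1}" if "p \<in> forms 0" for p
  proof -
    have "(\<lambda>v. 0 + p 0 * 1) \<in> fun_span {\<lambda>v::real^3. 1}" by (intro fun_span.intros) simp
    also have "(\<lambda>v. 0 + p 0 * 1) = p" using form_0_const[OF that] by (simp add: fun_eq_iff) metis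
    finally show ?thesis .
  qed
  then show ?case by (intro exI[of _ "{\<lambda>v. 1}"]) (auto simp: forms_def)
next
  case (Suc k)
  then obtain E where E: "finite E" "E \<subseteq> forms k" "forms k \<subseteq> fun_span E" by blast
  let ?x = "\<lambda>(i::3) v. axis i 1 \<bullet> v :: real"
  let ?E = "\<Union>i. (\<lambda>e v. ?x i v * e v) ` E"
  have "finite ?E" using E by simp
  moreover have "?E \<subseteq> forms (Suc k)"
  proof -
    have "(\<lambda>v. ?x i v * e v) \<in> forms (Suc k)" if "e \<in> E" for e i
      using forms_mult[OF forms_inner, of e k "axis i 1"] that E by auto
    then show ?thesis by blast
  qed
  moreover have "p \<in> fun_span ?E" if p: "p \<in> forms (Suc k)" for p
  proof -
    obtain g where g: "\<And>i. real_polynomial_function (g i)"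
      "\<And>v. p v = p 0 + (\<Sum>i\<in>UNIV. ?x i v * g i v)"
      using polyf_coordinate_expansion[OF forms_polyf[OF p]] by blast
    have part: "(\<lambda>v. ?x i v * hom_part k (g i) v) \<in> fun_span ?E" for i
    proof -
      have "hom_part k (g i) \<in> fun_span E" using E(3) hom_part_in_forms[OF g(1)] by blast
      from fun_span_mult[OF this, of "?x i"] show ?thesis
        using fun_span_mono[of "(\<lambda>e v. ?x i v * e v) ` E" ?E] by blast
    qed
    have "p = (\<lambda>v. ?x 1 v * g 1 v + (?x 2 v * g 2 v + ?x 3 v * g 3 v))"
      using g(2) forms_at_0[OF p] by (simp add: sum_3 fun_eq_iff)
    then have "hom_part (Suc k) p v = hom_part (Suc k) (\<lambda>v. ?x 1 v * g 1 v + (?x 2 v * g 2 v + ?x 3 v * g 3 v)) v" for v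
      by simp
    also have "\<dots> v = hom_part (Suc k) (\<lambda>v. ?x 1 v * g 1 v) v + (hom_part (Suc k) (\<lambda>v. ?x 2 v * g 2 v) v +
         hom_part (Suc k) (\<lambda>v. ?x 3 v * g 3 v) v)" for v
      by (subst hom_part_add; (intro real_polynomial_function.intros(3,4) polyf_inner g)?)+ (rule refl)
    finally have "p v = ?x 1 v * hom_part k (g 1) v + (?x 2 v * hom_part k (g 2) v + ?x 3 v * hom_part k (g 3) v)" for v
      by (simp add: hom_part_form[OF p] hom_part_mult_form[OF forms_inner g(1)])
    then have "p = (\<lambda>v. ?x 1 v * hom_part k (g 1) v + (?x 2 v * hom_part k (g 2) v + ?x 3 v * hom_part k (g 3) v))"
      by blast
    then show ?thesis using fun_span_add[OF part[of 1] fun_span_add[OF part[of 2] part[of 3]]] by simp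
  qed
  ultimately show ?case by blast
qed

lemma forms_Q_finite_dimensional:
  "\<exists>E. finite E \<and> E \<subseteq> forms_Q B k \<and> forms_Q B k \<subseteq> fun_span E"
proof (cases "k < 2")
  case True
  have "p \<in> fun_span {}" if "p \<in> forms_Q B k" for p
    using that True fun_span.zero by (auto elim: forms_Q_cofactor)
  then show ?thesis by (intro exI[of _ "{}"]) auto
next
  case False
  obtain E where E: "finite E" "E \<subseteq> forms (k - 2)" "forms (k - 2) \<subseteq> fun_span E"
    using forms_finite_dimensional by blast
  let ?E = "(\<lambda>e v. qform B v * e v) ` E"
  have "?E \<subseteq> forms_Q B k"
  proof
    fix p assume "p \<in> ?E"
    then obtain e where e: "e \<in> forms (k - 2)" "p = (\<lambda>v. qform B v * e v)" using E by blast
    then show "p \<in> forms_Q B k"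
    proof (intro forms_QI[OF _ forms_polyf[OF e(1)]])
      have "2 + (k - 2) = k" using False by simp
      then show "p \<in> forms k" using forms_mult[OF forms_qform e(1), of B] e(2) by metis
    qed (simp add: e(2))
  qed
  moreover have "p \<in> fun_span ?E" if "p \<in> forms_Q B k" for p
    using that
  proof (rule forms_Q_cofactor)
    assume "p = (\<lambda>v. 0)" then show ?thesis using fun_span.zero by simp
  next
    fix j g assume "k = j + 2" "g \<in> forms j" "p = (\<lambda>v. qform B v * g v)"
    then show ?thesis using fun_span_mult[of g E "qform B"] E by auto
  qed
  ultimately show ?thesis using E(1) by blast
qed

section \<open>The components of a function\<close>

text \<open>
  Definiteness makes the product of \<open>L\<^sub>2\<close> an inner product on each space \<open>V(k)\<close>, although it is not one on
  all polynomials: \<open>1\<close> and \<open>Q\<close> agree on the surface.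
\<close>

locale quadric_measure =
  fixes B :: "real^3^3" and m :: "(real^3) measure"
  assumes symB: "transpose B = B"
    and sets_m: "sets m = sets (restrict_space borel (qsurface B))"
    and poly_L2: "\<And>p. real_polynomial_function p \<Longrightarrow> l2_integrable m p"
    and inner_definite: "\<And>k p. p \<in> forms k \<Longrightarrow> l2_inner m p p = 0 \<Longrightarrow> p = (\<lambda>v. 0)"
    and odd_moment: "\<And>k p. odd k \<Longrightarrow> p \<in> forms k \<Longrightarrow> (LINT v|m. p v) = 0"
begin

abbreviation perp :: "nat \<Rightarrow> (real^3 \<Rightarrow> real) set" where
  "perp k \<equiv> forms_Q_perp m B k"

abbreviation component :: "(real^3 \<Rightarrow> real) \<Rightarrow> nat \<Rightarrow> real^3 \<Rightarrow> real" where
  "component f k \<equiv> orth_proj m (perp k) f"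

lemma space_m: "space m = qsurface B"
  using sets_eq_imp_space_eq[OF sets_m] by (simp add: space_restrict_space)

lemma l2_inner_cong:
  assumes "\<And>v. v \<in> qsurface B \<Longrightarrow> f v = f' v" "\<And>v. v \<in> qsurface B \<Longrightarrow> g v = g' v"
  shows "l2_inner m f g = l2_inner m f' g'"
  unfolding l2_inner_def using assms by (intro Bochner_Integration.integral_cong) (simp_all add: space_m)

lemma form_L2: "p \<in> forms k \<Longrightarrow> l2_integrable m p"
  by (intro poly_L2 forms_polyf)

lemma l2_inner_qform_mult: "l2_inner m f (\<lambda>v. qform B v * g v) = l2_inner m f g"
  by (rule l2_inner_cong) (simp_all add: qsurface_def)

lemma perp_forms: "p \<in> perp k \<Longrightarrow> p \<in> forms k"
  by (simp add: forms_Q_perp_def)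

lemma perp_L2: "p \<in> perp k \<Longrightarrow> l2_integrable m p"
  by (intro form_L2 perp_forms)

lemma perp_forms_Q: "p \<in> perp k \<Longrightarrow> q \<in> forms_Q B k \<Longrightarrow> l2_inner m p q = 0"
  by (simp add: forms_Q_perp_def)

lemma forms_Q_L2: "p \<in> forms_Q B k \<Longrightarrow> l2_integrable m p"
  by (intro form_L2 forms_Q_forms)

lemma perp_diff:
  assumes p: "p \<in> perp k" and q: "q \<in> perp k"
  shows "(\<lambda>v. p v - q v) \<in> perp k"
  unfolding forms_Q_perp_def
proof (intro CollectI conjI ballI)
  show "(\<lambda>v. p v - q v) \<in> forms k" by (intro forms_diff perp_forms p q)
  fix r assume r: "r \<in> forms_Q B k"
  show "l2_inner m (\<lambda>v. p v - q v) r = 0"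
    by (simp add: l2_inner_diff perp_L2[OF p] perp_L2[OF q] forms_Q_L2[OF r]
        perp_forms_Q[OF p r] perp_forms_Q[OF q r])
qed

lemma perp_cmult: "p \<in> perp k \<Longrightarrow> (\<lambda>v. c * p v) \<in> perp k"
  by (simp add: forms_Q_perp_def forms_cmult l2_inner_cmult)

lemma perp_inter_forms_Q:
  assumes "p \<in> perp k" "p \<in> forms_Q B k"
  shows "p = (\<lambda>v. 0)"
  using inner_definite[OF perp_forms[OF assms(1)] perp_forms_Q[OF assms]] .

lemma perp_decomposition:
  assumes p: "p \<in> forms k"
  obtains q where "q \<in> perp k" "(\<lambda>v. p v - q v) \<in> forms_Q B k"
proof -
  obtain E where E: "finite E" "E \<subseteq> forms_Q B k" "forms_Q B k \<subseteq> fun_span E"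
    using forms_Q_finite_dimensional[of B k] by blast
  have sub: "r \<in> forms_Q B k" if "r \<in> fun_span E" for r
    using that
  proof induction
    case zero
    show ?case by (rule forms_Q_zero)
  next
    case (add f e c)
    then show ?case using E by (intro forms_Q_add forms_Q_cmult) auto
  qed
  obtain r where r: "r \<in> fun_span E" "\<And>s. s \<in> fun_span E \<Longrightarrow> l2_inner m (\<lambda>v. p v - r v) s = 0"
    using orthogonal_projection_exists[OF E(1) forms_Q_L2[OF subsetD[OF E(2)]] form_L2[OF p]] by blast
  have "(\<lambda>v. p v - r v) \<in> perp k"
    unfolding forms_Q_perp_def
  proof (intro CollectI conjI ballI)
    show "(\<lambda>v. p v - r v) \<in> forms k" by (rule forms_diff[OF p forms_Q_forms[OF sub[OF r(1)]]])
    fix q assume "q \<in> forms_Q B k"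
    then show "l2_inner m (\<lambda>v. p v - r v) q = 0" using E(3) by (intro r(2)) (rule subsetD)
  qed
  moreover have "(\<lambda>v. p v - (p v - r v)) \<in> forms_Q B k" using sub[OF r(1)] by simp
  ultimately show ?thesis using that by blast
qed

text \<open>
  Project to the finite-dimensional space \<open>V(k)\<close> first and then remove the component in \<open>V\<^sub>Q(k)\<close>.
\<close>

lemma orth_proj_exists:
  assumes f: "l2_integrable m f"
  obtains q where "q \<in> perp k" "\<And>r. r \<in> perp k \<Longrightarrow> l2_inner m (\<lambda>v. f v - q v) r = 0"
proof -
  obtain E where E: "finite E" "E \<subseteq> forms k" "forms k \<subseteq> fun_span E"
    using forms_finite_dimensional[of k] by blast
  have sub: "r \<in> forms k" if "r \<in> fun_span E" for r
    using that
  proof induction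
    case zero
    show ?case by (rule forms_zero)
  next
    case (add f e c)
    then show ?case using E by (intro forms_add forms_cmult) auto
  qed
  obtain p where p: "p \<in> fun_span E" "\<And>s. s \<in> fun_span E \<Longrightarrow> l2_inner m (\<lambda>v. f v - p v) s = 0"
    using orthogonal_projection_exists[OF E(1) form_L2[OF subsetD[OF E(2)]] f] by blast
  obtain q where q: "q \<in> perp k" "(\<lambda>v. p v - q v) \<in> forms_Q B k"
    using perp_decomposition[OF sub[OF p(1)]] .
  have "l2_inner m (\<lambda>v. f v - q v) r = 0" if r: "r \<in> perp k" for r
  proof -
    have "l2_inner m (\<lambda>v. p v - q v) r = 0"
      using perp_forms_Q[OF r q(2)] by (simp add: l2_inner_commute)
    moreover have "l2_inner m (\<lambda>v. f v - p v) r = 0"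
      using p(2) perp_forms[OF r] E(3) by blast
    ultimately show ?thesis
      using f form_L2[OF sub[OF p(1)]] perp_L2[OF q(1)] perp_L2[OF r] by (simp add: l2_inner_diff)
  qed
  then show ?thesis using q(1) that by blast
qed

lemma orth_proj_eqI:
  assumes f: "l2_integrable m f" and q: "q \<in> perp k"
    and orth: "\<And>r. r \<in> perp k \<Longrightarrow> l2_inner m (\<lambda>v. f v - q v) r = 0"
  shows "component f k = q"
  unfolding orth_proj_def
proof (rule the_equality)
  fix q' assume q': "q' \<in> perp k \<and> (\<forall>r\<in>perp k. l2_inner m (\<lambda>v. f v - q' v) r = 0)"
  let ?d = "\<lambda>v. q v - q' v"
  have d: "?d \<in> perp k" using q q' perp_diff by blast
  have "l2_inner m (\<lambda>v. f v - q' v) ?d = 0" "l2_inner m (\<lambda>v. f v - q v) ?d = 0"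
    using q' orth d by blast+
  moreover have "l2_integrable m q'" "l2_integrable m q" using perp_L2 q q' by blast+
  ultimately have "l2_inner m ?d ?d = 0"
    using f perp_L2[OF d] by (simp add: l2_inner_diff)
  then have "?d = (\<lambda>v. 0)" using inner_definite[OF perp_forms[OF d]] by blast
  then show "q' = q" by (simp add: fun_eq_iff)
qed (use q orth in blast)

lemma
  assumes f: "l2_integrable m f"
  shows component_perp: "component f k \<in> perp k"
    and component_orth: "r \<in> perp k \<Longrightarrow> l2_inner m (\<lambda>v. f v - component f k v) r = 0"
proof -
  obtain q where q: "q \<in> perp k" "\<And>r. r \<in> perp k \<Longrightarrow> l2_inner m (\<lambda>v. f v - q v) r = 0"
    using orth_proj_exists[OF f] by metis
  then have "component f k = q" by (rule orth_proj_eqI[OF f])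
  then show "component f k \<in> perp k" "r \<in> perp k \<Longrightarrow> l2_inner m (\<lambda>v. f v - component f k v) r = 0"
    using q by auto
qed

lemma component_L2: "l2_integrable m f \<Longrightarrow> l2_integrable m (component f k)"
  by (rule perp_L2[OF component_perp])

lemma component_inner:
  assumes "l2_integrable m f" "r \<in> perp k"
  shows "l2_inner m (component f k) r = l2_inner m f r"
  using component_orth[OF assms] component_L2[OF assms(1)] assms(1) perp_L2[OF assms(2)]
  by (simp add: l2_inner_diff)

lemma component_form_eqI:
  assumes p: "p \<in> forms k" and q: "q \<in> perp k" and d: "(\<lambda>v. p v - q v) \<in> forms_Q B k"
  shows "component p k = q"
  using perp_forms_Q[OF _ d] by (intro orth_proj_eqI[OF form_L2[OF p] q]) (simp add: l2_inner_commute)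

lemma component_form_diff:
  assumes p: "p \<in> forms k"
  shows "(\<lambda>v. p v - component p k v) \<in> forms_Q B k"
  using perp_decomposition[OF p] component_form_eqI[OF p] by metis

lemma Phi_eqI:
  assumes "w \<in> multipoles k" "q \<in> perp k" "(\<lambda>v. Theta k w v - q v) \<in> forms_Q B k"
  shows "Phi m B k w = q"
  unfolding Phi_def by (rule component_form_eqI[OF Theta_in_forms[OF assms(1)] assms(2,3)])

lemma Phi_perp: "w \<in> multipoles k \<Longrightarrow> Phi m B k w \<in> perp k"
  unfolding Phi_def by (intro component_perp form_L2[OF Theta_in_forms])

lemma Theta_Phi_diff: "w \<in> multipoles k \<Longrightarrow> (\<lambda>v. Theta k w v - Phi m B k w v) \<in> forms_Q B k"
  unfolding Phi_def by (intro component_form_diff Theta_in_forms)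

lemma component_norm_le:
  assumes f: "l2_integrable m f"
  shows "l2_norm m (component f k) \<le> l2_norm m f"
proof (rule power2_le_imp_le)
  have L2: "l2_integrable m (component f k)" by (rule component_L2[OF f])
  have "(l2_norm m (\<lambda>v. (f v - component f k v) + component f k v))\<^sup>2 =
      (l2_norm m (\<lambda>v. f v - component f k v))\<^sup>2 + (l2_norm m (component f k))\<^sup>2"
    by (rule l2_Pythagoras[OF l2_integrable_diff[OF f L2] L2 component_orth[OF f component_perp[OF f]]])
  then show "(l2_norm m (component f k))\<^sup>2 \<le> (l2_norm m f)\<^sup>2" by simp
qed (rule l2_norm_nonneg)

lemma component_diff:
  assumes f: "l2_integrable m f" and g: "l2_integrable m g"
  shows "component (\<lambda>v. f v - g v) k = (\<lambda>v. component f k v - component g k v)"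
proof (rule orth_proj_eqI[OF l2_integrable_diff[OF f g]])
  show "(\<lambda>v. component f k v - component g k v) \<in> perp k"
    by (intro perp_diff component_perp f g)
  fix r assume r: "r \<in> perp k"
  have "l2_inner m (\<lambda>v. (f v - g v) - (component f k v - component g k v)) r =
     l2_inner m (\<lambda>v. f v - g v) r - l2_inner m (\<lambda>v. component f k v - component g k v) r"
    by (intro l2_inner_diff l2_integrable_diff f g component_L2 perp_L2[OF r])
  also have "\<dots> = 0"
    by (simp add: l2_inner_diff f g component_L2 perp_L2[OF r] component_inner r)
  finally show "l2_inner m (\<lambda>v. (f v - g v) - (component f k v - component g k v)) r = 0" .
qed

lemma component_cmult:
  assumes f: "l2_integrable m f"
  shows "component (\<lambda>v. c * f v) k = (\<lambda>v. c * component f k v)"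
proof (rule orth_proj_eqI[OF l2_integrable_cmult[OF f]])
  show "(\<lambda>v. c * component f k v) \<in> perp k" by (intro perp_cmult component_perp f)
  show "l2_inner m (\<lambda>v. c * f v - c * component f k v) r = 0" if "r \<in> perp k" for r
    using component_orth[OF f that] l2_inner_cmult[of m c "\<lambda>v. f v - component f k v"]
    by (simp add: right_diff_distrib)
qed

section \<open>The orthogonal decomposition\<close>

lemma qform_power_mult_forms_Q:
  assumes "h \<in> forms j"
  shows "(\<lambda>v. qform B v ^ Suc i * h v) \<in> forms_Q B (j + 2 * Suc i)"
proof -
  have *: "(\<lambda>v. qform B v ^ i * h v) \<in> forms (j + 2 * i)" for i
  proof (induction i)
    case (Suc i)
    then show ?case using forms_mult[OF forms_qform Suc, of B] by (simp add: mult.assoc)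
  qed (simp add: assms)
  show ?thesis
    by (rule forms_QI[OF *[of "Suc i"] forms_polyf[OF *[of i]]]) simp
qed

text \<open>
  On the surface, where \<open>Q = 1\<close>, a form of degree \<open>j\<close> agrees with its multiples by powers of \<open>Q\<close>, which
  lie in the spaces \<open>V\<^sub>Q(j + 2 i)\<close>; degrees of different parity are separated by the odd moments.
\<close>

lemma perp_orthogonal_less:
  assumes "j < k" "p \<in> perp j" "q \<in> perp k"
  shows "l2_inner m p q = 0"
proof (cases "odd (j + k)")
  case True
  then show ?thesis
    using odd_moment[OF True forms_mult[OF perp_forms[OF assms(2)] perp_forms[OF assms(3)]]]
    by (simp add: l2_inner_def)
next
  case False
  then have "even (k - j)" using assms(1) by auto
  then obtain n where "k - j = 2 * n" by blast
  moreover from this obtain i where "n = Suc i" using assms(1) by (cases n) auto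
  ultimately have k: "k = j + 2 * Suc i" using assms(1) by simp
  have "l2_inner m q (\<lambda>v. qform B v ^ Suc i * p v) = 0"
    using qform_power_mult_forms_Q[OF perp_forms[OF assms(2)], of i] k
    by (intro perp_forms_Q[OF assms(3)]) simp
  moreover have "l2_inner m q (\<lambda>v. qform B v ^ Suc i * p v) = l2_inner m q p"
    by (rule l2_inner_cong) (simp_all add: qsurface_def)
  ultimately show ?thesis by (simp add: l2_inner_commute)
qed

lemma perp_orthogonal:
  assumes "j \<noteq> k" "p \<in> perp j" "q \<in> perp k"
  shows "l2_inner m p q = 0"
  using perp_orthogonal_less[of j k p q] perp_orthogonal_less[of k j q p] assms
  by (auto simp: l2_inner_commute neq_iff)

text \<open>
  On the surface a form of degree \<open>k\<close> is a sum of elements of the spaces \<open>V\<^sub>Q\<^sup>\<bottom>(j)\<close>, \<open>j \<le> k\<close>: split off the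
  component in \<open>V\<^sub>Q\<^sup>\<bottom>(k)\<close>, divide the rest by \<open>Q\<close>, and continue with the quotient.
\<close>

lemma form_orthogonal_if_perp_orthogonal:
  assumes \<phi>: "l2_integrable m \<phi>"
    and orth: "\<And>j h. j \<le> k \<Longrightarrow> h \<in> perp j \<Longrightarrow> l2_inner m \<phi> h = 0"
    and p: "p \<in> forms k"
  shows "l2_inner m \<phi> p = 0"
  using orth p
proof (induction k arbitrary: p rule: less_induct)
  case (less k)
  obtain h where h: "h \<in> perp k" "(\<lambda>v. p v - h v) \<in> forms_Q B k"
    using perp_decomposition[OF less.prems(2)] .
  have "l2_inner m \<phi> (\<lambda>v. p v - h v) = 0"
    using h(2)
  proof (rule forms_Q_cofactor)
    assume "(\<lambda>v. p v - h v) = (\<lambda>v. 0)"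
    then show ?thesis by (simp add: l2_inner_def)
  next
    fix j g assume g: "k = j + 2" "g \<in> forms j" "(\<lambda>v. p v - h v) = (\<lambda>v. qform B v * g v)"
    have "l2_inner m \<phi> g = 0"
    proof (rule less.IH[OF _ _ g(2)])
      show "j < k" using g(1) by simp
      show "l2_inner m \<phi> h = 0" if "i \<le> j" "h \<in> perp i" for i h
        using that g(1) by (intro less.prems(1)[of i]) simp_all
    qed
    then show ?thesis by (simp add: g(3) l2_inner_qform_mult)
  qed
  moreover have "l2_inner m \<phi> h = 0" using less.prems(1) h(1) by blast
  ultimately show ?case
    using \<phi> perp_L2[OF h(1)] form_L2[OF less.prems(2)] by (simp add: l2_inner_diff_right)
qed

lemma partial_sum_L2:
  assumes "\<And>k. F k \<in> perp k"
  shows "l2_integrable m (\<lambda>v. \<Sum>k\<le>d. F k v)"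
  using assms perp_L2 by (intro l2_integrable_sum) blast

lemma partial_sum_inner:
  assumes F: "\<And>k. F k \<in> perp k" and h: "h \<in> perp j"
  shows "l2_inner m (\<lambda>v. \<Sum>k\<le>d. F k v) h = (if j \<le> d then l2_inner m (F j) h else 0)"
proof -
  have "l2_inner m (\<lambda>v. \<Sum>k\<le>d. F k v) h = (\<Sum>k\<le>d. l2_inner m (F k) h)"
    using F h perp_L2 by (intro l2_inner_sum) blast+
  also have "\<dots> = (\<Sum>k\<le>d. if k = j then l2_inner m (F j) h else 0)"
    using perp_orthogonal[OF _ F h] by (intro sum.cong) auto
  finally show ?thesis by simp
qed

lemma residual_orthogonal:
  assumes f: "l2_integrable m f" and p: "p \<in> forms k" and k: "k \<le> d"
  shows "l2_inner m (\<lambda>v. f v - (\<Sum>k\<le>d. component f k v)) p = 0"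
proof (rule form_orthogonal_if_perp_orthogonal[OF _ _ p])
  have S: "l2_integrable m (\<lambda>v. \<Sum>k\<le>d. component f k v)"
    by (intro partial_sum_L2 component_perp f)
  then show "l2_integrable m (\<lambda>v. f v - (\<Sum>k\<le>d. component f k v))"
    by (intro l2_integrable_diff f)
  fix j h assume "j \<le> k" "h \<in> perp j"
  then show "l2_inner m (\<lambda>v. f v - (\<Sum>k\<le>d. component f k v)) h = 0"
    using S f k perp_L2 partial_sum_inner[OF component_perp[OF f], of h j d] component_inner[OF f]
    by (simp add: l2_inner_diff)
qed

text \<open>
  The error of the partial sum is orthogonal to all polynomials of degree at most \<open>d\<close>.
\<close>

lemma partial_sum_best_approximation:
  assumes f: "l2_integrable m f" and p: "\<And>k. p k \<in> forms k"
  shows "l2_norm m (\<lambda>v. f v - (\<Sum>k\<le>d. component f k v)) \<le> l2_norm m (\<lambda>v. f v - (\<Sum>k\<le>d. p k v))"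
proof (rule power2_le_imp_le)
  let ?r = "\<lambda>v. f v - (\<Sum>k\<le>d. component f k v)"
  let ?q = "\<lambda>v. \<Sum>k\<le>d. (component f k v - p k v)"
  have F: "component f k \<in> forms k" for k using component_perp[OF f] perp_forms by blast
  have q: "l2_integrable m (\<lambda>v. component f k v - p k v)" for k
    using form_L2[OF forms_diff[OF F p]] .
  have r: "l2_integrable m ?r"
    by (intro l2_integrable_diff f partial_sum_L2 component_perp)
  have "l2_inner m ?r ?q = (\<Sum>k\<le>d. l2_inner m (\<lambda>v. component f k v - p k v) ?r)"
    using l2_inner_sum[of "{..d}" m "\<lambda>k v. component f k v - p k v" ?r] q r by (simp add: l2_inner_commute)
  also have "\<dots> = 0"
  proof (intro sum.neutral ballI)
    fix k assume "k \<in> {..d}"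
    then show "l2_inner m (\<lambda>v. component f k v - p k v) ?r = 0"
      using residual_orthogonal[OF f forms_diff[OF F p]] by (simp add: l2_inner_commute)
  qed
  finally have "(l2_norm m (\<lambda>v. ?r v + ?q v))\<^sup>2 = (l2_norm m ?r)\<^sup>2 + (l2_norm m ?q)\<^sup>2"
    using q r by (intro l2_Pythagoras l2_integrable_sum)
  moreover have "(\<lambda>v. ?r v + ?q v) = (\<lambda>v. f v - (\<Sum>k\<le>d. p k v))"
    by (simp add: sum_subtractf)
  ultimately show "(l2_norm m ?r)\<^sup>2 \<le> (l2_norm m (\<lambda>v. f v - (\<Sum>k\<le>d. p k v)))\<^sup>2" by simp
qed (rule l2_norm_nonneg)

definition poly_approximable :: "(real^3 \<Rightarrow> real) \<Rightarrow> bool" where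
  "poly_approximable f \<longleftrightarrow> (\<forall>e>0. \<exists>p. real_polynomial_function p \<and> l2_norm m (\<lambda>v. f v - p v) < e)"

lemma components_converge:
  assumes f: "l2_integrable m f" and approx: "poly_approximable f"
  shows "converges_in_l2 m (\<lambda>d v. \<Sum>k\<le>d. component f k v) f"
  unfolding converges_in_l2_def
proof (rule LIMSEQ_I)
  fix e :: real assume "e > 0"
  then obtain p where p: "real_polynomial_function p" "l2_norm m (\<lambda>v. f v - p v) < e"
    using approx by (auto simp: poly_approximable_def)
  obtain N where N: "\<And>v. p v = (\<Sum>k\<le>N. hom_part k p v)" using hom_part_sum[OF p(1)] by blast
  have "norm (l2_norm m (\<lambda>v. (\<Sum>k\<le>d. component f k v) - f v) - 0) < e" if "d \<ge> N" for d
  proof -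
    let ?p = "\<lambda>k v. if k \<le> N then hom_part k p v else 0"
    have "?p k \<in> forms k" for k using hom_part_in_forms[OF p(1), of k] by (cases "k \<le> N") simp_all
    from partial_sum_best_approximation[OF f this, of d]
    have le: "l2_norm m (\<lambda>v. f v - (\<Sum>k\<le>d. component f k v)) \<le> l2_norm m (\<lambda>v. f v - (\<Sum>k\<le>d. ?p k v))" .
    have "(\<Sum>k\<le>d. ?p k v) = p v" for v
    proof -
      have "(\<Sum>k\<le>d. ?p k v) = (\<Sum>k\<le>N. ?p k v)" using that by (intro sum.mono_neutral_right) auto
      then show ?thesis using N[of v] by simp
    qed
    with le have "l2_norm m (\<lambda>v. f v - (\<Sum>k\<le>d. component f k v)) \<le> l2_norm m (\<lambda>v. f v - p v)" by simp
    then show ?thesis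
      using p(2) l2_norm_minus_commute[of m f "\<lambda>v. \<Sum>k\<le>d. component f k v"] by (simp add: l2_norm_nonneg)
  qed
  then show "\<exists>N. \<forall>d\<ge>N. norm (l2_norm m (\<lambda>v. (\<Sum>k\<le>d. component f k v) - f v) - 0) < e" by blast
qed

lemma orth_decomposition_components:
  assumes f: "l2_integrable m f" and approx: "poly_approximable f"
  shows "orth_decomposition m B f (component f)"
  unfolding orth_decomposition_def
  using components_converge[OF assms] component_perp[OF f] perp_orthogonal by blast

text \<open>
  The inner product with an element of \<open>V\<^sub>Q\<^sup>\<bottom>(k)\<close> is continuous in \<open>L\<^sub>2\<close> and annihilates all summands but
  the one of index \<open>k\<close>.
\<close>

lemma orth_decomposition_unique:
  assumes f: "l2_integrable m f" and F: "orth_decomposition m B f F"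
  shows "F k = component f k"
proof (rule orth_proj_eqI[OF f, symmetric])
  have perp: "\<And>k. F k \<in> perp k" and conv: "converges_in_l2 m (\<lambda>d v. \<Sum>k\<le>d. F k v) f"
    using F by (auto simp: orth_decomposition_def)
  show "F k \<in> perp k" by (rule perp)
  fix r assume r: "r \<in> perp k"
  have S: "l2_integrable m (\<lambda>v. \<Sum>k\<le>d. F k v)" for d by (rule partial_sum_L2[OF perp])
  have "(\<lambda>d. l2_norm m (\<lambda>v. (\<Sum>k\<le>d. F k v) - f v) * l2_norm m r) \<longlonglongrightarrow> 0 * l2_norm m r"
    using conv unfolding converges_in_l2_def by (intro tendsto_mult tendsto_const)
  then have lim: "(\<lambda>d. l2_norm m (\<lambda>v. (\<Sum>k\<le>d. F k v) - f v) * l2_norm m r) \<longlonglongrightarrow> 0" by simp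
  have "\<bar>l2_inner m (F k) r - l2_inner m f r\<bar> \<le> l2_norm m (\<lambda>v. (\<Sum>k\<le>d. F k v) - f v) * l2_norm m r"
    if "d \<ge> k" for d
    using l2_Cauchy_Schwarz[OF l2_integrable_diff[OF S f] perp_L2[OF r], of d]
      partial_sum_inner[OF perp r, of d] that
    by (simp add: l2_inner_diff S f perp_L2[OF r])
  then have "\<bar>l2_inner m (F k) r - l2_inner m f r\<bar> \<le> 0"
    by (intro tendsto_lowerbound[OF lim]) (auto simp: eventually_at_top_linorder)
  then show "l2_inner m (\<lambda>v. f v - F k v) r = 0"
    by (simp add: l2_inner_diff f perp_L2[OF perp] perp_L2[OF r])
qed

lemma Bessel_summable:
  assumes f: "l2_integrable m f"
  shows "summable (\<lambda>k. (l2_norm m (component f k))\<^sup>2)"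
proof (rule summableI_nonneg_bounded)
  fix n
  have S: "l2_integrable m (\<lambda>v. \<Sum>k\<in>I. component f k v)" for I
    by (intro l2_integrable_sum component_L2 f)
  let ?S = "\<lambda>v. \<Sum>k<n. component f k v"
  have inner: "l2_inner m f (component f k) = (l2_norm m (component f k))\<^sup>2" for k
    using component_inner[OF f component_perp[OF f]] by (simp add: l2_norm_square)
  have fS: "l2_inner m f ?S = (\<Sum>k<n. (l2_norm m (component f k))\<^sup>2)"
    using l2_inner_sum[of "{..<n}" m "component f" f] component_L2[OF f] f
    by (simp add: l2_inner_commute[of m _ f] inner)
  have "l2_inner m ?S ?S = (\<Sum>k<n. l2_inner m (component f k) ?S)"
    by (intro l2_inner_sum component_L2 f S)
  also have "\<dots> = (\<Sum>k<n. (l2_norm m (component f k))\<^sup>2)"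
  proof (rule sum.cong)
    fix k assume k: "k \<in> {..<n}"
    have "l2_inner m (component f k) ?S = (\<Sum>j<n. l2_inner m (component f j) (component f k))"
      using l2_inner_sum[of "{..<n}" m "component f" "component f k"] component_L2[OF f]
      by (simp add: l2_inner_commute)
    also have "\<dots> = (\<Sum>j<n. if j = k then (l2_norm m (component f k))\<^sup>2 else 0)"
      using perp_orthogonal[OF _ component_perp[OF f] component_perp[OF f]]
      by (intro sum.cong) (auto simp: l2_norm_square)
    also have "\<dots> = (l2_norm m (component f k))\<^sup>2" using k by simp
    finally show "l2_inner m (component f k) ?S = (l2_norm m (component f k))\<^sup>2" .
  qed simp
  finally have SS: "l2_inner m ?S ?S = (\<Sum>k<n. (l2_norm m (component f k))\<^sup>2)" .
  have "0 \<le> l2_inner m f f - 2 * l2_inner m f ?S + l2_inner m ?S ?S"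
    using l2_inner_self_nonneg[of m "\<lambda>v. f v - ?S v"] by (simp add: l2_inner_diff_self f S)
  then show "(\<Sum>k<n. (l2_norm m (component f k))\<^sup>2) \<le> l2_inner m f f" by (simp add: fS SS)
qed simp

section \<open>Approximation by polynomials\<close>

lemma finite_measure_m: "finite_measure m"
proof
  have "l2_integrable m (\<lambda>v. 1)" by (rule poly_L2) auto
  then have "integrable m (\<lambda>v. 1::real)" by (simp add: l2_integrable_def)
  then have "integrable m (indicator (space m) :: _ \<Rightarrow> real)"
    by (rule Bochner_Integration.integrable_cong[THEN iffD1, rotated 2]) (auto simp: indicator_def)
  then show "emeasure m (space m) \<noteq> \<infinity>" by (simp add: integrable_indicator_iff)
qed

lemma continuous_borel_measurable:
  assumes "continuous_on (qsurface B) f"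
  shows "f \<in> borel_measurable m"
  using borel_measurable_continuous_on_restrict[OF assms] by (simp cong: measurable_cong_sets add: sets_m)

lemma continuous_L2:
  assumes f: "continuous_on (qsurface B) f" and cpt: "compact (qsurface B)"
  shows "l2_integrable m f"
proof -
  have c2: "continuous_on (qsurface B) (\<lambda>v. (f v)\<^sup>2)" by (intro continuous_intros f)
  then have "bounded ((\<lambda>v. (f v)\<^sup>2) ` qsurface B)" using cpt compact_continuous_image compact_imp_bounded by blast
  then obtain K where "\<And>v. v \<in> qsurface B \<Longrightarrow> norm ((f v)\<^sup>2) \<le> K" by (auto simp: bounded_iff)
  then have "integrable m (\<lambda>v. (f v)\<^sup>2)"
    by (intro finite_measure.integrable_const_bound[OF finite_measure_m, of _ K] continuous_borel_measurable c2)
       (auto simp: space_m intro!: AE_I2)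
  then show ?thesis using continuous_borel_measurable[OF f] by (simp add: l2_integrable_def)
qed

lemma l2_norm_uniform_bound:
  assumes f: "l2_integrable m f" and e: "\<And>v. v \<in> qsurface B \<Longrightarrow> \<bar>f v\<bar> \<le> e" and "e \<ge> 0"
  shows "l2_norm m f \<le> e * sqrt (measure m (space m))"
proof -
  interpret finite_measure m by (rule finite_measure_m)
  have "l2_inner m f f = (LINT v|m. (f v)\<^sup>2)" by (simp add: l2_inner_def power2_eq_square)
  also have "\<dots> \<le> (LINT v|m. e\<^sup>2)"
    using f by (intro integral_mono) (auto simp: l2_integrable_def space_m abs_le_square_iff[symmetric] intro: order_trans[OF e])
  also have "\<dots> = e\<^sup>2 * measure m (space m)" by simp
  finally have "l2_norm m f \<le> sqrt (e\<^sup>2 * measure m (space m))" by (simp add: l2_norm_def)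
  then show ?thesis using \<open>e \<ge> 0\<close> by (simp add: real_sqrt_mult)
qed

lemma continuous_poly_approximable:
  assumes f: "continuous_on (qsurface B) f" and cpt: "compact (qsurface B)"
  shows "poly_approximable f"
  unfolding poly_approximable_def
proof (intro allI impI)
  fix e :: real assume e: "e > 0"
  let ?s = "sqrt (measure m (space m))"
  define \<delta> where "\<delta> = e / (2 * (?s + 1))"
  have s: "?s \<ge> 0" by simp
  have \<delta>: "\<delta> > 0" using e s by (simp add: \<delta>_def add_nonneg_pos)
  obtain p where p: "real_polynomial_function p" "\<And>v. v \<in> qsurface B \<Longrightarrow> \<bar>f v - p v\<bar> < \<delta>"
    using Stone_Weierstrass_real_polynomial_function[OF cpt f \<delta>] by metis
  have "l2_norm m (\<lambda>v. f v - p v) \<le> \<delta> * ?s"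
    using p \<delta> by (intro l2_norm_uniform_bound l2_integrable_diff continuous_L2 f cpt poly_L2) (auto intro: less_imp_le)
  also have "\<dots> < e"
  proof -
    have "\<delta> * (?s + 1) = e / 2" using s by (simp add: \<delta>_def field_simps add_nonneg_eq_0_iff)
    then have "\<delta> * ?s = e / 2 - \<delta>" by (simp add: distrib_left)
    then show ?thesis using \<delta> e by simp
  qed
  finally show "\<exists>p. real_polynomial_function p \<and> l2_norm m (\<lambda>v. f v - p v) < e" using p(1) by blast
qed

section \<open>The angle estimate\<close>

text \<open>
  With \<open>p = h + q\<close>, \<open>h\<close> the orthogonal component and \<open>q\<close> the component in \<open>V\<^sub>Q(k)\<close>, the sine of the angle
  between \<open>p\<close> and \<open>q\<close> is the ratio of the norms of \<open>h\<close> and \<open>p\<close>.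
\<close>

lemma sin_theta_bound:
  assumes p: "p \<in> Fact k" and h: "h \<in> perp k" and d: "(\<lambda>v. p v - h v) \<in> forms_Q B k"
  shows "(sin (theta m B k))\<^sup>2 * (l2_norm m p)\<^sup>2 \<le> (l2_norm m h)\<^sup>2"
proof -
  let ?q = "\<lambda>v. p v - h v"
  have L2: "l2_integrable m h" "l2_integrable m ?q"
    using perp_L2[OF h] form_L2[OF forms_Q_forms[OF d]] .
  have hq: "l2_inner m h ?q = 0" using h d by (rule perp_forms_Q)
  have pyth: "(l2_norm m p)\<^sup>2 = (l2_norm m h)\<^sup>2 + (l2_norm m ?q)\<^sup>2"
    using l2_Pythagoras[OF L2 hq] by simp
  show ?thesis
  proof (cases "?q = (\<lambda>v. 0)")
    case True
    then have "p = h" by (intro ext) (simp add: fun_eq_iff)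
    then have "(l2_norm m p)\<^sup>2 = (l2_norm m h)\<^sup>2" by simp
    moreover have "(sin (theta m B k))\<^sup>2 \<le> 1" by (simp add: abs_square_le_1)
    ultimately show ?thesis by (simp add: mult_left_le_one_le)
  next
    case False
    have q_pos: "l2_norm m ?q > 0"
      using inner_definite[OF forms_Q_forms[OF d]] False l2_inner_self_nonneg[of m ?q]
      by (auto simp: l2_norm_def less_le)
    have p_ge: "l2_norm m ?q \<le> l2_norm m p"
    proof (rule power2_le_imp_le)
      show "(l2_norm m ?q)\<^sup>2 \<le> (l2_norm m p)\<^sup>2"
        using pyth zero_le_power2[of "l2_norm m h"] by linarith
    qed (rule l2_norm_nonneg)
    have p_pos: "l2_norm m p > 0" using q_pos p_ge by linarith
    define x where "x = l2_norm m ?q / l2_norm m p"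
    have x: "0 \<le> x" "x \<le> 1" using q_pos p_pos p_ge by (simp_all add: x_def)
    have "l2_inner m p ?q = l2_inner m (\<lambda>v. h v + ?q v) ?q" by simp
    also have "\<dots> = (l2_norm m ?q)\<^sup>2" using hq L2 by (subst l2_inner_add) (simp_all add: l2_norm_square)
    finally have ang: "l2_angle m p ?q = arccos x"
      using q_pos by (simp add: l2_angle_def x_def power2_eq_square)
    let ?A = "{l2_angle m p q |p q. p \<in> Fact k \<and> q \<in> forms_Q B k - {\<lambda>v. 0}}"
    have nonneg: "0 \<le> a" if "a \<in> ?A" for a
    proof -
      obtain p' q' where a: "a = l2_angle m p' q'" "p' \<in> Fact k" "q' \<in> forms_Q B k"
        using \<open>a \<in> ?A\<close> by blast
      have "p' \<in> forms k" using a form_prod_in_forms by (auto simp: Fact_def)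
      then have "\<bar>l2_inner m p' q'\<bar> \<le> l2_norm m p' * l2_norm m q'"
        by (rule l2_Cauchy_Schwarz[OF form_L2 forms_Q_L2[OF a(3)]])
      moreover have "\<bar>x / N\<bar> \<le> 1" if "\<bar>x\<bar> \<le> N" for x N :: real
      proof -
        have "0 \<le> N" using that by linarith
        then show ?thesis using that by (auto simp: abs_divide divide_le_eq_1 less_le)
      qed
      ultimately have "\<bar>l2_inner m p' q' / (l2_norm m p' * l2_norm m q')\<bar> \<le> 1" by blast
      then show ?thesis unfolding a(1) l2_angle_def by (intro arccos_lbound; linarith)
    qed
    have mem: "arccos x \<in> ?A" using p d False ang by force
    have \<theta>: "theta m B k = Inf ?A" using d False by (auto simp: theta_def)
    have "0 \<le> theta m B k" unfolding \<theta> using mem nonneg by (intro cInf_greatest) auto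
    moreover have "theta m B k \<le> arccos x"
      unfolding \<theta> using mem nonneg by (intro cInf_lower bdd_belowI[of _ 0]) auto
    moreover have "arccos x \<le> pi / 2" using x by (intro arccos_le_pi2) auto
    ultimately have "0 \<le> sin (theta m B k)" "sin (theta m B k) \<le> sin (arccos x)"
      by (auto intro: sin_ge_zero sin_monotone_2pi_le)
    then have "(sin (theta m B k))\<^sup>2 \<le> (sin (arccos x))\<^sup>2" by (intro power_mono)
    also have "\<dots> = 1 - x\<^sup>2" using x by (simp add: sin_arccos abs_square_le_1)
    finally have "(sin (theta m B k))\<^sup>2 * (l2_norm m p)\<^sup>2 \<le> (1 - x\<^sup>2) * (l2_norm m p)\<^sup>2"
      by (intro mult_right_mono) simp_all
    also have "\<dots> = (l2_norm m p)\<^sup>2 - (l2_norm m ?q)\<^sup>2"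
      using p_pos by (simp add: x_def left_diff_distrib power_divide)
    also have "\<dots> = (l2_norm m h)\<^sup>2" using pyth by linarith
    finally show ?thesis .
  qed
qed

lemma sin_theta_rho_bound:
  assumes w: "w \<in> multipoles k"
  shows "(sin (theta m B k))\<^sup>2 * (rho_zero m k w)\<^sup>2 \<le> (l2_norm m (Phi m B k w))\<^sup>2"
proof (cases "k = 0")
  case True
  have "(\<lambda>v. Theta k w v - Phi m B k w v) = (\<lambda>v. 0)"
    using Theta_Phi_diff[OF w] True by (simp add: forms_Q_0)
  then have "Phi m B k w = Theta k w" by (simp add: fun_eq_iff)
  then show ?thesis using True by (simp add: theta_def forms_Q_0 rho_zero_def)
next
  case False
  then obtain L where L: "L \<in> {..<k} \<rightarrow>\<^sub>E UNIV" "w = multipole_of k L"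
    using w by (auto simp: multipoles_pos)
  show ?thesis
  proof (cases "\<exists>\<nu><k. L \<nu> = 0")
    case True
    then show ?thesis
      using L by (simp add: multipole_of_def rho_zero_def l2_norm_def l2_inner_def)
  next
    case False
    then have "L \<in> {..<k} \<rightarrow>\<^sub>E (UNIV - {0})" using L by (auto simp: PiE_iff)
    then have "Theta k w \<in> Fact k" using L by (simp add: Theta_multipole_of Fact_def)
    from sin_theta_bound[OF this Phi_perp[OF w] Theta_Phi_diff[OF w]]
    show ?thesis by (simp add: rho_zero_def)
  qed
qed

end

section \<open>Directional derivatives of polynomials\<close>

definition dir_deriv :: "real^3 \<Rightarrow> (real^3 \<Rightarrow> real) \<Rightarrow> real^3 \<Rightarrow> real" where
  "dir_deriv u p v = frechet_derivative p (at v) u"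

lemma dir_deriv_eqI: "(p has_derivative D) (at v) \<Longrightarrow> dir_deriv u p v = D u"
  using frechet_derivative_at by (metis dir_deriv_def)

lemma has_derivative_dir_deriv:
  assumes "real_polynomial_function p"
  shows "(p has_derivative (\<lambda>u. dir_deriv u p v)) (at v)"
  using differentiable_at_real_polynomial_function[OF assms, of v UNIV]
  unfolding dir_deriv_def frechet_derivative_works .

lemma linear_dir_deriv:
  assumes "real_polynomial_function p"
  shows "linear (\<lambda>u. dir_deriv u p v)"
  using has_derivative_linear[OF has_derivative_dir_deriv[OF assms]] .

lemma dir_deriv_add:
  assumes "real_polynomial_function p" "real_polynomial_function q"
  shows "dir_deriv u (\<lambda>v. p v + q v) v = dir_deriv u p v + dir_deriv u q v"
  by (rule dir_deriv_eqI[OF has_derivative_add]) (intro has_derivative_dir_deriv assms)+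

lemma dir_deriv_mult:
  assumes "real_polynomial_function p" "real_polynomial_function q"
  shows "dir_deriv u (\<lambda>v. p v * q v) v = p v * dir_deriv u q v + dir_deriv u p v * q v"
  by (rule dir_deriv_eqI[OF has_derivative_mult]) (intro has_derivative_dir_deriv assms)+

lemma dir_deriv_const: "dir_deriv u (\<lambda>v. c) v = 0"
  by (rule dir_deriv_eqI) simp

lemma dir_deriv_cmult:
  assumes "real_polynomial_function p"
  shows "dir_deriv u (\<lambda>v. c * p v) v = c * dir_deriv u p v"
  using dir_deriv_mult[OF real_polynomial_function.intros(2) assms] by (simp add: dir_deriv_const)

lemma dir_deriv_diff:
  assumes "real_polynomial_function p" "real_polynomial_function q"
  shows "dir_deriv u (\<lambda>v. p v - q v) v = dir_deriv u p v - dir_deriv u q v"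
  by (rule dir_deriv_eqI[OF has_derivative_diff]) (intro has_derivative_dir_deriv assms)+

lemma dir_deriv_linear: "bounded_linear f \<Longrightarrow> dir_deriv u f v = f u"
  by (rule dir_deriv_eqI[OF bounded_linear_imp_has_derivative])

lemma dir_deriv_polyf:
  assumes "real_polynomial_function p"
  shows "real_polynomial_function (dir_deriv u p)"
  using assms
proof (induction p rule: real_polynomial_function.induct)
  case (linear f)
  have "dir_deriv u f = (\<lambda>v. f u)" by (intro ext dir_deriv_linear linear)
  then show ?case by auto
next
  case (const c)
  have "dir_deriv u (\<lambda>v. c) = (\<lambda>v. 0)" by (intro ext dir_deriv_const)
  then show ?case by auto
next
  case (add f g)
  have "dir_deriv u (\<lambda>v. f v + g v) = (\<lambda>v. dir_deriv u f v + dir_deriv u g v)"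
    by (intro ext dir_deriv_add add.hyps)
  then show ?case using add.IH by auto
next
  case (mult f g)
  have "dir_deriv u (\<lambda>v. f v * g v) = (\<lambda>v. f v * dir_deriv u g v + dir_deriv u f v * g v)"
    by (intro ext dir_deriv_mult mult.hyps)
  then show ?case using mult by auto
qed

lemma dir_deriv_commute:
  assumes "real_polynomial_function p"
  shows "dir_deriv u (dir_deriv w p) v = dir_deriv w (dir_deriv u p) v"
  using assms
proof (induction p arbitrary: v rule: real_polynomial_function.induct)
  case (linear f)
  have "dir_deriv u f = (\<lambda>v. f u)" for u by (intro ext dir_deriv_linear linear)
  then show ?case by (simp add: dir_deriv_const)
next
  case (const c)
  have "dir_deriv u (\<lambda>v. c) = (\<lambda>v. 0)" for u by (intro ext dir_deriv_const)
  then show ?case by (simp add: dir_deriv_const)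
next
  case (add f g)
  have "dir_deriv u (\<lambda>v. f v + g v) = (\<lambda>v. dir_deriv u f v + dir_deriv u g v)" for u
    by (intro ext dir_deriv_add add.hyps)
  then show ?case using add by (simp add: dir_deriv_add dir_deriv_polyf)
next
  case (mult f g)
  have eq: "dir_deriv u (\<lambda>v. f v * g v) = (\<lambda>v. f v * dir_deriv u g v + dir_deriv u f v * g v)" for u
    by (intro ext dir_deriv_mult mult.hyps)
  have "dir_deriv u (\<lambda>v. f v * dir_deriv w g v + dir_deriv w f v * g v) v =
     (f v * dir_deriv u (dir_deriv w g) v + dir_deriv u f v * dir_deriv w g v) +
     (dir_deriv w f v * dir_deriv u g v + dir_deriv u (dir_deriv w f) v * g v)" for u w
    using mult.hyps dir_deriv_polyf
    by (subst dir_deriv_add; (subst dir_deriv_mult)?; (subst dir_deriv_mult)?)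
       (auto intro!: real_polynomial_function.intros(4))
  then show ?case unfolding eq by (simp add: mult.IH)
qed

lemma dir_deriv_scale_arg:
  assumes p: "p \<in> forms k"
  shows "c * dir_deriv u p (c *\<^sub>R v) = c ^ k * dir_deriv u p v"
proof -
  have rp: "real_polynomial_function p" using p by (rule forms_polyf)
  have "((\<lambda>v. p (c *\<^sub>R v)) has_derivative (\<lambda>u. dir_deriv (c *\<^sub>R u) p (c *\<^sub>R v))) (at v)"
    by (rule has_derivative_compose[OF _ has_derivative_dir_deriv[OF rp]]) (auto intro!: derivative_eq_intros)
  moreover have "(\<lambda>v. p (c *\<^sub>R v)) = (\<lambda>v. c ^ k * p v)" using forms_scale[OF p] by blast
  ultimately have "((\<lambda>v. c ^ k * p v) has_derivative (\<lambda>u. dir_deriv (c *\<^sub>R u) p (c *\<^sub>R v))) (at v)" by simp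
  from dir_deriv_eqI[OF this, of u] show ?thesis
    by (simp add: dir_deriv_cmult[OF rp] linear_cmul[OF linear_dir_deriv[OF rp]])
qed

text \<open>Euler's identity, from the derivative of \<open>p (t v) = t\<^sup>k p v\<close> at \<open>t = 1\<close>.\<close>

lemma dir_deriv_self:
  assumes p: "p \<in> forms k"
  shows "dir_deriv v p v = of_nat k * p v"
proof -
  have rp: "real_polynomial_function p" using p by (rule forms_polyf)
  have "((\<lambda>t. p (t *\<^sub>R v)) has_derivative (\<lambda>t. dir_deriv (t *\<^sub>R v) p (1 *\<^sub>R v))) (at 1)"
    by (rule has_derivative_compose[OF _ has_derivative_dir_deriv[OF rp]]) (auto intro!: derivative_eq_intros)
  then have "((\<lambda>t. p (t *\<^sub>R v)) has_real_derivative dir_deriv v p v) (at 1)"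
    using linear_cmul[OF linear_dir_deriv[OF rp]] by (simp add: has_field_derivative_def mult_commute_abs)
  moreover have "(\<lambda>t. p (t *\<^sub>R v)) = (\<lambda>t. t ^ k * p v)" using forms_scale[OF p] by blast
  ultimately have "((\<lambda>t. t ^ k * p v) has_real_derivative dir_deriv v p v) (at 1)" by simp
  moreover have "((\<lambda>t. t ^ k * p v) has_real_derivative of_nat k * p v) (at 1)"
    by (auto intro!: derivative_eq_intros)
  ultimately show ?thesis by (rule DERIV_unique)
qed

lemma dir_deriv_qform:
  assumes "transpose B = B"
  shows "dir_deriv u (qform B) v = 2 * (u \<bullet> (B *v v))"
proof -
  have "(qform B has_derivative (\<lambda>u. v \<bullet> (B *v u) + u \<bullet> (B *v v))) (at v)"
    unfolding qform_def[abs_def]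
    by (intro has_derivative_inner has_derivative_ident bounded_linear_imp_has_derivative
        matrix_vector_mul_bounded_linear)
  from dir_deriv_eqI[OF this, of u] show ?thesis
    using symmetric_inner_swap[OF assms, of v u] by simp
qed

section \<open>Definite forms: compactness and orthonormal bases\<close>

lemma continuous_on_qform: "continuous_on S (qform B)"
  by (simp add: continuous_on_polymonial_function flip: real_polynomial_function_eq)

lemma pos_def_compact:
  assumes "pos_def_form B"
  shows "compact (qsurface B)"
proof -
  obtain e :: "real^3" where e: "norm e = 1" using vector_choose_size[of 1] by auto
  then have "e \<in> sphere 0 1" by simp
  then obtain x where x: "x \<in> sphere 0 1" "\<And>y. y \<in> sphere 0 1 \<Longrightarrow> qform B x \<le> qform B y"
    using continuous_attains_inf[OF compact_sphere _ continuous_on_qform, of 0 1 B] by blast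
  have "x \<noteq> 0" using x(1) by auto
  then have c: "qform B x > 0" using assms by (simp add: pos_def_form_def)
  have "norm v \<le> sqrt (1 / qform B x)" if v: "v \<in> qsurface B" for v
  proof (cases "v = 0")
    case False
    have "(1 / norm v) *\<^sub>R v \<in> sphere 0 1" using False by simp
    then have "qform B x \<le> (1 / norm v)\<^sup>2 * qform B v" using x(2) by (metis qform_scale)
    then have "qform B x \<le> 1 / (norm v)\<^sup>2" using v by (simp add: qsurface_def power_divide)
    then have "(norm v)\<^sup>2 \<le> 1 / qform B x" using c False by (simp add: field_simps)
    then show ?thesis by (rule real_le_rsqrt)
  qed (use c in simp)
  then have "bounded (qsurface B)" by (auto simp: bounded_iff)
  moreover have "closed (qsurface B)"
    unfolding qsurface_def by (intro closed_Collect_eq continuous_on_qform continuous_on_const)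
  ultimately show ?thesis by (simp add: compact_eq_bounded_closed)
qed

lemma gram_matrix_entry:
  fixes U B :: "real^'n^'n"
  shows "(U ** B ** transpose U) $ i $ j = U $ i \<bullet> (B *v U $ j)"
  unfolding matrix_mul_assoc[symmetric]
  by (simp add: matrix_matrix_mult_def transpose_def inner_vec_def matrix_vector_mult_def)

text \<open>The rows of \<open>U\<close> form a basis that is orthonormal for the form.\<close>

lemma orthonormal_basis_exists:
  assumes sym: "transpose B = B" and pd: "pos_def_form B"
  obtains U :: "real^3^3" where "U ** B ** transpose U = mat 1"
proof -
  have normalise: "\<exists>b. qform B b = 1 \<and> (\<forall>c. a \<bullet> c = 0 \<longrightarrow> b \<bullet> c = 0)" if "a \<noteq> 0" for a
  proof (intro exI conjI allI impI)
    have "qform B a > 0" using that pd by (simp add: pos_def_form_def)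
    then show "qform B ((1 / sqrt (qform B a)) *\<^sub>R a) = 1" by (simp add: qform_scale power_divide)
  qed simp
  obtain a1 :: "real^3" where "a1 \<noteq> 0" using orthogonal_to_two_exists by metis
  then obtain u1 where u1: "qform B u1 = 1" using normalise by blast
  obtain a2 where "a2 \<noteq> 0" "a2 \<bullet> (B *v u1) = 0" using orthogonal_to_two_exists by metis
  then obtain u2 where u2: "qform B u2 = 1" "u2 \<bullet> (B *v u1) = 0" using normalise by blast
  obtain a3 where "a3 \<noteq> 0" "a3 \<bullet> (B *v u1) = 0" "a3 \<bullet> (B *v u2) = 0" using orthogonal_to_two_exists by metis
  then obtain u3 where u3: "qform B u3 = 1" "u3 \<bullet> (B *v u1) = 0" "u3 \<bullet> (B *v u2) = 0" using normalise by blast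
  let ?U = "vector [u1, u2, u3] :: real^3^3"
  have "(?U ** B ** transpose ?U) $ i $ j = mat 1 $ i $ j" for i j
    unfolding gram_matrix_entry using exhaust_3[of i] exhaust_3[of j] u1 u2 u3 symmetric_inner_swap[OF sym, of u1 u2]
      symmetric_inner_swap[OF sym, of u1 u3] symmetric_inner_swap[OF sym, of u2 u3]
    by (auto simp: mat_def vector_3 qform_def)
  then show ?thesis by (intro that[of ?U]) (simp add: vec_eq_iff)
qed

lemma matrix_inv_from_orthonormal_basis:
  fixes U B :: "real^'n^'n"
  assumes "U ** B ** transpose U = mat 1"
  shows "matrix_inv B = transpose U ** U" "transpose U ** (U ** B) = mat 1"
proof -
  show left: "transpose U ** (U ** B) = mat 1"
    using assms matrix_left_right_inverse by blast
  then have l: "(transpose U ** U) ** B = mat 1" by (simp add: matrix_mul_assoc)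
  then have r: "B ** (transpose U ** U) = mat 1" using matrix_left_right_inverse by blast
  have inv: "B ** matrix_inv B = mat 1 \<and> matrix_inv B ** B = mat 1"
    unfolding matrix_inv_def by (rule someI[of _ "transpose U ** U"]) (use l r in simp)
  have "matrix_inv B = (transpose U ** U) ** (B ** matrix_inv B)"
    by (simp add: matrix_mul_assoc l)
  then show "matrix_inv B = transpose U ** U" using inv by simp
qed

section \<open>Infinitesimal rotations and harmonic polynomials\<close>

locale rotation_invariant_measure = quadric_measure +
  fixes U :: "real^3^3"
  assumes pos_def: "pos_def_form B"
    and invariant: "form_invariant_measure m B"
    and orthonormal: "U ** B ** transpose U = mat 1"
begin

definition coord :: "3 \<Rightarrow> real^3 \<Rightarrow> real" where
  "coord i v = U $ i \<bullet> (B *v v)"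

definition deriv_along :: "3 \<Rightarrow> (real^3 \<Rightarrow> real) \<Rightarrow> real^3 \<Rightarrow> real" where
  "deriv_along i = dir_deriv (U $ i)"

text \<open>The vector field generating the rotations in the plane of the basis vectors \<open>i\<close> and \<open>j\<close>.\<close>

definition rot_field :: "3 \<Rightarrow> 3 \<Rightarrow> (real^3 \<Rightarrow> real) \<Rightarrow> real^3 \<Rightarrow> real" where
  "rot_field i j p v = coord i v * deriv_along j p v - coord j v * deriv_along i p v"

lemma coord_linear: "bounded_linear (coord i)"
  unfolding coord_def[abs_def]
  by (rule bounded_linear_compose[OF bounded_linear_inner_right matrix_vector_mul_bounded_linear])

lemma coord_add: "coord i (v + w) = coord i v + coord i w"
  by (simp add: coord_def matrix_vector_right_distrib inner_add_right)

lemma coord_polyf: "real_polynomial_function (coord i)"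
  by (intro real_polynomial_function.intros(1) coord_linear)

lemma coord_scale: "coord i (c *\<^sub>R v) = c * coord i v"
  by (simp add: coord_def matrix_vector_mult_scaleR)

lemma coord_basis: "coord i (U $ j) = (if i = j then 1 else 0)"
  using gram_matrix_entry[of U B i j] orthonormal by (simp add: coord_def mat_def)

lemma coord_expansion: "v = (\<Sum>i\<in>UNIV. coord i v *\<^sub>R U $ i)"
proof -
  have "v = transpose U *v ((U ** B) *v v)"
    by (simp add: matrix_vector_mul_assoc matrix_inv_from_orthonormal_basis(2)[OF orthonormal])
  also have "(U ** B) *v v = (\<chi> i. coord i v)"
    by (simp add: coord_def matrix_vector_mul_assoc[symmetric] vec_eq_iff matrix_vector_mul_component)
  also have "transpose U *v (\<chi> i. coord i v) = (\<Sum>i\<in>UNIV. coord i v *\<^sub>R U $ i)"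
    by (simp add: matrix_vector_mult_def transpose_def vec_eq_iff mult.commute)
  finally show ?thesis .
qed

lemma qform_coords: "qform B v = (\<Sum>i\<in>UNIV. (coord i v)\<^sup>2)"
proof -
  have "qform B v = (\<Sum>i\<in>UNIV. coord i v *\<^sub>R U $ i) \<bullet> (B *v v)"
    using coord_expansion[of v] by (simp add: qform_def)
  also have "\<dots> = (\<Sum>i\<in>UNIV. (coord i v)\<^sup>2)"
    by (simp add: inner_sum_left coord_def power2_eq_square)
  finally show ?thesis .
qed

lemma deriv_along_polyf: "real_polynomial_function p \<Longrightarrow> real_polynomial_function (deriv_along i p)"
  by (simp add: deriv_along_def dir_deriv_polyf)

lemma deriv_along_coord: "deriv_along i (coord j) v = (if i = j then 1 else 0)"
  by (simp add: deriv_along_def dir_deriv_linear[OF coord_linear] coord_basis)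

lemma deriv_along_coord_mult:
  assumes "real_polynomial_function q"
  shows "deriv_along l (\<lambda>v. coord i v * q v) v = coord i v * deriv_along l q v + (if l = i then 1 else 0) * q v"
  using deriv_along_coord[of l i v] by (simp add: deriv_along_def dir_deriv_mult[OF coord_polyf assms])

lemma rot_field_polyf: "real_polynomial_function p \<Longrightarrow> real_polynomial_function (rot_field i j p)"
  unfolding rot_field_def[abs_def]
  by (intro real_polynomial_function_diff real_polynomial_function.intros(4) coord_polyf deriv_along_polyf)

lemma rot_field_forms:
  assumes p: "p \<in> forms k"
  shows "rot_field i j p \<in> forms k"
proof -
  have "rot_field i j p (c *\<^sub>R v) = c ^ k * rot_field i j p v" for c v
  proof -
    have "rot_field i j p (c *\<^sub>R v) = coord i v * (c * deriv_along j p (c *\<^sub>R v)) - coord j v * (c * deriv_along i p (c *\<^sub>R v))"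
      by (simp add: rot_field_def coord_scale)
    also have "\<dots> = c ^ k * rot_field i j p v"
      unfolding deriv_along_def dir_deriv_scale_arg[OF p]
      by (simp add: rot_field_def deriv_along_def algebra_simps)
    finally show ?thesis .
  qed
  then show ?thesis using rot_field_polyf[OF forms_polyf[OF p]] by (simp add: forms_def)
qed

lemma rot_field_mult:
  assumes "real_polynomial_function p" "real_polynomial_function q"
  shows "rot_field i j (\<lambda>v. p v * q v) v = p v * rot_field i j q v + rot_field i j p v * q v"
  by (simp add: rot_field_def deriv_along_def dir_deriv_mult assms algebra_simps)

lemma rot_field_qform: "rot_field i j (qform B) v = 0"
  by (simp add: rot_field_def deriv_along_def dir_deriv_qform[OF symB] coord_def)

lemma rot_field_forms_Q:
  assumes "p \<in> forms_Q B k"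
  shows "rot_field i j p \<in> forms_Q B k"
proof -
  obtain g where g: "real_polynomial_function g" "p = (\<lambda>v. qform B v * g v)"
    using assms by (auto simp: forms_Q_def)
  show ?thesis
    by (rule forms_QI[OF rot_field_forms[OF forms_Q_forms[OF assms]] rot_field_polyf[OF g(1), of i j]])
       (simp add: g(2) rot_field_mult g(1) rot_field_qform)
qed

text \<open>
  The rotation by the angle \<open>t\<close> in the plane of the basis vectors \<open>i\<close> and \<open>j\<close>, written as a displacement.
\<close>

definition rotation :: "3 \<Rightarrow> 3 \<Rightarrow> real \<Rightarrow> real^3 \<Rightarrow> real^3" where
  "rotation i j t v = v + ((cos t - 1) * coord i v - sin t * coord j v) *\<^sub>R U $ i
     + (sin t * coord i v + (cos t - 1) * coord j v) *\<^sub>R U $ j"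

lemma coord_rotation:
  assumes "i \<noteq> j"
  shows "coord i (rotation i j t v) = cos t * coord i v - sin t * coord j v"
    "coord j (rotation i j t v) = sin t * coord i v + cos t * coord j v"
    "l \<noteq> i \<Longrightarrow> l \<noteq> j \<Longrightarrow> coord l (rotation i j t v) = coord l v"
  unfolding rotation_def coord_add coord_scale coord_basis using assms
  by (simp_all add: algebra_simps)

lemma qform_rotation:
  assumes "i \<noteq> j"
  shows "qform B (rotation i j t v) = qform B v"
proof -
  have rest: "(\<Sum>l\<in>UNIV. (coord l w)\<^sup>2) = (coord i w)\<^sup>2 + ((coord j w)\<^sup>2 + (\<Sum>l\<in>UNIV - {i} - {j}. (coord l w)\<^sup>2))" for w
    using assms by (simp add: sum.remove[of UNIV i] sum.remove[of "UNIV - {i}" j])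
  have "(coord i (rotation i j t v))\<^sup>2 + (coord j (rotation i j t v))\<^sup>2 =
     (coord i v)\<^sup>2 + (coord j v)\<^sup>2"
  proof -
    have "(c * x - s * y)\<^sup>2 + (s * x + c * y)\<^sup>2 = (s\<^sup>2 + c\<^sup>2) * (x\<^sup>2 + y\<^sup>2)" for c s x y :: real
      by (simp add: power2_eq_square algebra_simps)
    then show ?thesis unfolding coord_rotation(1,2)[OF assms] by simp
  qed
  moreover have "(\<Sum>l\<in>UNIV - {i} - {j}. (coord l (rotation i j t v))\<^sup>2) = (\<Sum>l\<in>UNIV - {i} - {j}. (coord l v)\<^sup>2)"
    using assms by (intro sum.cong) (auto simp: coord_rotation(3))
  ultimately show ?thesis unfolding qform_coords rest by simp
qed

lemma rotation_linear: "linear (rotation i j t)"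
  unfolding rotation_def[abs_def]
  by (rule linearI) (simp_all add: coord_add coord_scale algebra_simps)

lemma rotation_surface: "i \<noteq> j \<Longrightarrow> v \<in> qsurface B \<Longrightarrow> rotation i j t v \<in> qsurface B"
  by (simp add: qsurface_def qform_rotation)

lemma integral_rotation:
  assumes ij: "i \<noteq> j" and p: "real_polynomial_function p"
  shows "(LINT v|m. p (rotation i j t v)) = (LINT v|m. p v)"
proof -
  let ?A = "matrix (rotation i j t)"
  have A: "?A *v v = rotation i j t v" for v
    using matrix_vector_mul(2)[OF rotation_linear] by metis
  have "(\<lambda>v. ?A *v v) \<in> measurable (restrict_space borel (qsurface B)) (restrict_space borel (qsurface B))"
  proof (intro measurable_restrict_space3 borel_measurable_continuous_onI)
    show "continuous_on UNIV (\<lambda>v. ?A *v v)"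
      by (intro linear_continuous_on matrix_vector_mul_bounded_linear)
  qed (use rotation_surface[OF ij] in \<open>auto simp: A\<close>)
  then have meas: "(\<lambda>v. ?A *v v) \<in> measurable m m"
    using sets_m by (simp cong: measurable_cong_sets)
  have "\<forall>v. qform B (?A *v v) = qform B v" by (simp add: A qform_rotation[OF ij])
  then have "distr m m (\<lambda>v. ?A *v v) = m"
    using invariant unfolding form_invariant_measure_def by blast
  moreover have "p \<in> borel_measurable m" using poly_L2[OF p] by (simp add: l2_integrable_def)
  ultimately show ?thesis
    using integral_distr[OF meas, of p] by (simp add: A)
qed

lemma rotation_derivative:
  assumes ij: "i \<noteq> j" and p: "real_polynomial_function p"
  shows "((\<lambda>t. p (rotation i j t v)) has_real_derivative rot_field i j p (rotation i j t v)) (at t)"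
proof -
  let ?R = "rotation i j t v"
  have "((\<lambda>t. rotation i j t v) has_derivative
      (\<lambda>h. h *\<^sub>R (- coord j ?R *\<^sub>R U $ i + coord i ?R *\<^sub>R U $ j))) (at t)"
    unfolding coord_rotation[OF ij] unfolding rotation_def
    by (auto intro!: derivative_eq_intros simp: algebra_simps)
  from has_derivative_compose[OF this has_derivative_dir_deriv[OF p]]
  have "((\<lambda>t. p (rotation i j t v)) has_derivative
      (\<lambda>h. dir_deriv (h *\<^sub>R (- coord j ?R *\<^sub>R U $ i + coord i ?R *\<^sub>R U $ j)) p ?R)) (at t)" .
  moreover have "dir_deriv (h *\<^sub>R (- coord j ?R *\<^sub>R U $ i + coord i ?R *\<^sub>R U $ j)) p ?R = h * rot_field i j p ?R" for h
    by (simp only: linear_cmul[OF linear_dir_deriv[OF p]] linear_add[OF linear_dir_deriv[OF p]]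
        real_scaleR_def rot_field_def deriv_along_def) (simp add: algebra_simps)
  ultimately show ?thesis by (simp add: has_field_derivative_def mult_commute_abs)
qed

text \<open>The integral over the rotated surface does not depend on the angle, so its derivative vanishes.\<close>

lemma integral_rot_field:
  assumes ij: "i \<noteq> j" and p: "real_polynomial_function p"
  shows "(LINT v|m. rot_field i j p v) = 0"
proof -
  let ?X = "rot_field i j p"
  have X: "real_polynomial_function ?X" using p by (rule rot_field_polyf)
  have "continuous_on (qsurface B) ?X"
    using X by (simp add: continuous_on_polymonial_function flip: real_polynomial_function_eq)
  then have "bounded (?X ` qsurface B)"
    using pos_def_compact[OF pos_def] compact_continuous_image compact_imp_bounded by blast
  then obtain K where K: "\<And>v. v \<in> qsurface B \<Longrightarrow> \<bar>?X v\<bar> \<le> K" by (auto simp: bounded_iff)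
  have R0: "rotation i j 0 v = v" for v by (simp add: rotation_def)
  let ?t = "\<lambda>n. 1 / of_nat (Suc n) :: real"
  let ?s = "\<lambda>n v. (p (rotation i j (?t n) v) - p v) / ?t n"
  have rp: "real_polynomial_function (\<lambda>v. p (rotation i j t v))" for t
    using polyf_compose_linear[OF rotation_linear p] .
  have sm: "real_polynomial_function (?s n)" for n
    by (intro real_polynomial_function_divide real_polynomial_function_diff rp p)
  have meas: "q \<in> borel_measurable m" if "real_polynomial_function q" for q
    using poly_L2[OF that] by (simp add: l2_integrable_def)
  have int: "integrable m q" if "real_polynomial_function q" for q
    using l2_mult_integrable[OF poly_L2[OF that] poly_L2[OF real_polynomial_function.intros(2)[of 1]]] by simp
  have "(\<lambda>n. LINT v|m. ?s n v) \<longlonglongrightarrow> (LINT v|m. ?X v)"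
  proof (rule integral_dominated_convergence[where w = "\<lambda>_. K"])
    show "?X \<in> borel_measurable m" "\<And>n. ?s n \<in> borel_measurable m" by (intro meas X sm)+
    show "integrable m (\<lambda>_. K)" by (intro int real_polynomial_function.intros(2))
    show "AE v in m. (\<lambda>n. ?s n v) \<longlonglongrightarrow> ?X v"
    proof (intro AE_I2)
      fix v
      have "((\<lambda>t. (p (rotation i j (0 + t) v) - p (rotation i j 0 v)) / t) \<longlongrightarrow> ?X (rotation i j 0 v)) (at 0)"
        using rotation_derivative[OF ij p, of v 0] by (simp add: DERIV_def)
      then have "((\<lambda>t. (p (rotation i j t v) - p v) / t) \<longlongrightarrow> ?X v) (at 0)" by (simp add: R0)
      moreover have "filterlim ?t (at 0) sequentially"
        using LIMSEQ_Suc[OF lim_1_over_n] by (intro filterlim_atI) auto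
      ultimately show "(\<lambda>n. ?s n v) \<longlonglongrightarrow> ?X v" by (rule filterlim_compose)
    qed
    show "AE v in m. norm (?s n v) \<le> K" for n
    proof (intro AE_I2)
      fix v assume "v \<in> space m"
      then have v: "v \<in> qsurface B" by (simp add: space_m)
      obtain z where "p (rotation i j (?t n) v) - p (rotation i j 0 v) = (?t n - 0) * ?X (rotation i j z v)"
        using MVT2[of 0 "?t n" "\<lambda>t. p (rotation i j t v)" "\<lambda>t. ?X (rotation i j t v)"]
          rotation_derivative[OF ij p] by auto
      then have "?s n v = ?X (rotation i j z v)" by (simp add: R0)
      then show "norm (?s n v) \<le> K" using K[OF rotation_surface[OF ij v]] by simp
    qed
  qed
  moreover have "(LINT v|m. ?s n v) = 0" for n
  proof -
    have "(LINT v|m. p (rotation i j (?t n) v) - p v) = 0"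
      by (simp add: Bochner_Integration.integral_diff int[OF rp] int[OF p] integral_rotation[OF ij p])
    then show ?thesis by simp
  qed
  ultimately have "(\<lambda>n. 0) \<longlonglongrightarrow> (LINT v|m. ?X v)" by simp
  then show ?thesis by (simp add: LIMSEQ_const_iff)
qed

lemma rot_field_antisymmetric:
  assumes ij: "i \<noteq> j" and p: "real_polynomial_function p" and q: "real_polynomial_function q"
  shows "l2_inner m (rot_field i j p) q = - l2_inner m p (rot_field i j q)"
proof -
  have int: "integrable m (\<lambda>v. f v * g v)" if "real_polynomial_function f" "real_polynomial_function g" for f g
    using l2_mult_integrable[OF poly_L2[OF that(1)] poly_L2[OF that(2)]] .
  have "0 = (LINT v|m. rot_field i j (\<lambda>v. p v * q v) v)"
    using integral_rot_field[OF ij real_polynomial_function.intros(4)[OF p q]] by simp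
  also have "\<dots> = (LINT v|m. p v * rot_field i j q v + rot_field i j p v * q v)"
    by (simp add: rot_field_mult p q)
  also have "\<dots> = l2_inner m p (rot_field i j q) + l2_inner m (rot_field i j p) q"
    unfolding l2_inner_def by (intro Bochner_Integration.integral_add int rot_field_polyf p q)
  finally show ?thesis by simp
qed

lemma rot_field_perp:
  assumes ij: "i \<noteq> j" and p: "p \<in> perp k"
  shows "rot_field i j p \<in> perp k"
  unfolding forms_Q_perp_def
proof (intro CollectI conjI ballI)
  show "rot_field i j p \<in> forms k" by (intro rot_field_forms perp_forms p)
  fix q assume q: "q \<in> forms_Q B k"
  have "l2_inner m (rot_field i j p) q = - l2_inner m p (rot_field i j q)"
    by (rule rot_field_antisymmetric[OF ij forms_polyf[OF perp_forms[OF p]] forms_polyf[OF forms_Q_forms[OF q]]])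
  then show "l2_inner m (rot_field i j p) q = 0"
    using perp_forms_Q[OF p rot_field_forms_Q[OF q]] by simp
qed

lemma perp_add: "p \<in> perp k \<Longrightarrow> q \<in> perp k \<Longrightarrow> (\<lambda>v. p v + q v) \<in> perp k"
  using perp_diff[of p k "\<lambda>v. - 1 * q v"] perp_cmult[of q k "- 1"] by simp

lemma rot_field_square:
  assumes ij: "i \<noteq> j" and p: "real_polynomial_function p"
  shows "rot_field i j (rot_field i j p) v =
    (coord i v)\<^sup>2 * deriv_along j (deriv_along j p) v + (coord j v)\<^sup>2 * deriv_along i (deriv_along i p) v
    - 2 * (coord i v * coord j v * deriv_along i (deriv_along j p) v)
    - coord i v * deriv_along i p v - coord j v * deriv_along j p v"
proof -
  have d: "deriv_along l (rot_field i j p) v =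
      (coord i v * deriv_along l (deriv_along j p) v + (if l = i then 1 else 0) * deriv_along j p v)
      - (coord j v * deriv_along l (deriv_along i p) v + (if l = j then 1 else 0) * deriv_along i p v)" for l
  proof -
    have pj: "real_polynomial_function (deriv_along j p)" and pi: "real_polynomial_function (deriv_along i p)"
      by (intro deriv_along_polyf p)+
    have "deriv_along l (rot_field i j p) v =
      deriv_along l (\<lambda>v. coord i v * deriv_along j p v) v - deriv_along l (\<lambda>v. coord j v * deriv_along i p v) v"
      unfolding rot_field_def[abs_def] deriv_along_def[of l]
      by (intro dir_deriv_diff real_polynomial_function.intros(4) coord_polyf pi pj)
    then show ?thesis
      by (simp only: deriv_along_coord_mult[OF pi] deriv_along_coord_mult[OF pj])
  qed
  have comm: "deriv_along j (deriv_along i p) v = deriv_along i (deriv_along j p) v"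
    unfolding deriv_along_def by (rule dir_deriv_commute[OF p])
  show ?thesis
    unfolding rot_field_def[of i j "rot_field i j p"] d using ij
    by (simp add: comm power2_eq_square algebra_simps)
qed

lemma Euler_identity:
  assumes p: "p \<in> forms k"
  shows "(\<Sum>i\<in>UNIV. coord i v * deriv_along i p v) = of_nat k * p v"
proof -
  have lin: "linear (\<lambda>u. dir_deriv u p v)" by (rule linear_dir_deriv[OF forms_polyf[OF p]])
  have "of_nat k * p v = dir_deriv (\<Sum>i\<in>UNIV. coord i v *\<^sub>R U $ i) p v"
    using dir_deriv_self[OF p, of v] coord_expansion[of v] by simp
  also have "\<dots> = (\<Sum>i\<in>UNIV. coord i v * deriv_along i p v)"
    by (simp add: linear_sum[OF lin] linear_cmul[OF lin] deriv_along_def)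
  finally show ?thesis by simp
qed

text \<open>
  Differentiate Euler's identity along the basis vector \<open>j\<close>.
\<close>

lemma Euler_identity_derivative:
  assumes p: "p \<in> forms k"
  shows "(\<Sum>i\<in>UNIV. coord i v * deriv_along j (deriv_along i p) v) = (of_nat k - 1) * deriv_along j p v"
proof -
  have rp: "real_polynomial_function p" by (rule forms_polyf[OF p])
  have part: "deriv_along j (\<lambda>v. coord i v * deriv_along i p v) v =
     coord i v * deriv_along j (deriv_along i p) v + (if j = i then deriv_along i p v else 0)" for i
    by (simp add: deriv_along_coord_mult deriv_along_polyf[OF rp])
  have q: "real_polynomial_function (\<lambda>v. coord i v * deriv_along i p v)" for i
    by (intro real_polynomial_function.intros(4) coord_polyf deriv_along_polyf rp)
  have "of_nat k * deriv_along j p v = deriv_along j (\<lambda>v. of_nat k * p v) v"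
    by (simp add: deriv_along_def dir_deriv_cmult rp)
  also have "\<dots> = deriv_along j (\<lambda>v. \<Sum>i\<in>UNIV. coord i v * deriv_along i p v) v"
    by (simp only: Euler_identity[OF p])
  also have "\<dots> = (\<Sum>i\<in>UNIV. deriv_along j (\<lambda>v. coord i v * deriv_along i p v) v)"
    by (simp add: sum_3 deriv_along_def[of j] dir_deriv_add q real_polynomial_function.intros(3))
  also have "\<dots> = (\<Sum>i\<in>UNIV. coord i v * deriv_along j (deriv_along i p) v) + deriv_along j p v"
    by (simp add: part sum.distrib)
  finally show ?thesis by (simp add: algebra_simps)
qed

definition lap :: "(real^3 \<Rightarrow> real) \<Rightarrow> real^3 \<Rightarrow> real" where
  "lap p v = (\<Sum>i\<in>UNIV. deriv_along i (deriv_along i p) v)"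

lemma lap_polyf: "real_polynomial_function p \<Longrightarrow> real_polynomial_function (lap p)"
  unfolding lap_def[abs_def] by (intro real_polynomial_function_sum deriv_along_polyf finite)

lemma laplacian_Q_eq_lap:
  assumes p: "real_polynomial_function p"
  shows "laplacian_Q B p v = lap p v"
proof -
  have pd: "partial_deriv a q = dir_deriv (axis a 1) q" for a q
    by (simp add: partial_deriv_def[abs_def] dir_deriv_def[abs_def])
  have exp: "dir_deriv u q v = (\<Sum>a\<in>UNIV. u $ a * partial_deriv a q v)" if q: "real_polynomial_function q" for u q v
  proof -
    have "dir_deriv u q v = dir_deriv (\<Sum>a\<in>UNIV. (u $ a) *\<^sub>R axis a 1) q v"
      by (simp add: basis_expansion scalar_mult_eq_scaleR[symmetric])
    also have "\<dots> = (\<Sum>a\<in>UNIV. u $ a * dir_deriv (axis a 1) q v)"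
      by (simp add: linear_sum[OF linear_dir_deriv[OF q]] linear_cmul[OF linear_dir_deriv[OF q]])
    finally show ?thesis by (simp add: pd)
  qed
  have rp: "real_polynomial_function (partial_deriv a p)" for a
    unfolding pd by (intro dir_deriv_polyf p)
  have two: "deriv_along i (deriv_along i p) v =
     (\<Sum>a\<in>UNIV. \<Sum>b\<in>UNIV. U $ i $ a * U $ i $ b * partial_deriv a (partial_deriv b p) v)" for i
  proof -
    have first: "deriv_along i p = (\<lambda>v. \<Sum>b\<in>UNIV. U $ i $ b * partial_deriv b p v)"
      by (intro ext) (simp add: deriv_along_def exp[OF p])
    have "deriv_along i (deriv_along i p) v = (\<Sum>a\<in>UNIV. U $ i $ a * partial_deriv a (deriv_along i p) v)"
      using exp[OF deriv_along_polyf[OF p]] by (simp add: deriv_along_def)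
    also have "\<dots> = (\<Sum>a\<in>UNIV. U $ i $ a * (\<Sum>b\<in>UNIV. U $ i $ b * partial_deriv a (partial_deriv b p) v))"
      unfolding first pd[of _ "\<lambda>v. \<Sum>b\<in>UNIV. U $ i $ b * partial_deriv b p v"] pd[of _ "partial_deriv _ p"]
      by (simp add: sum_3 dir_deriv_add dir_deriv_cmult rp polyf_cmult real_polynomial_function.intros(3))
    finally show ?thesis by (simp add: sum_distrib_left mult.assoc)
  qed
  have "matrix_inv B $ a $ b = (\<Sum>i\<in>UNIV. U $ i $ a * U $ i $ b)" for a b
    by (simp add: matrix_inv_from_orthonormal_basis(1)[OF orthonormal] matrix_matrix_mult_def transpose_def)
  then have "laplacian_Q B p v = (\<Sum>a\<in>UNIV. \<Sum>b\<in>UNIV. \<Sum>i\<in>UNIV. U $ i $ a * U $ i $ b * partial_deriv a (partial_deriv b p) v)"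
    by (simp add: laplacian_Q_def sum_distrib_right)
  also have "\<dots> = (\<Sum>a\<in>UNIV. \<Sum>i\<in>UNIV. \<Sum>b\<in>UNIV. U $ i $ a * U $ i $ b * partial_deriv a (partial_deriv b p) v)"
    by (intro sum.cong refl sum.swap)
  also have "\<dots> = (\<Sum>i\<in>UNIV. \<Sum>a\<in>UNIV. \<Sum>b\<in>UNIV. U $ i $ a * U $ i $ b * partial_deriv a (partial_deriv b p) v)"
    by (rule sum.swap)
  finally show ?thesis by (simp add: lap_def two)
qed

definition casimir :: "(real^3 \<Rightarrow> real) \<Rightarrow> real^3 \<Rightarrow> real" where
  "casimir p v = rot_field 1 2 (rot_field 1 2 p) v + rot_field 2 3 (rot_field 2 3 p) v
     + rot_field 1 3 (rot_field 1 3 p) v"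

text \<open>
  With the Euler operator \<open>E\<close> the Casimir operator is \<open>Q \<Delta>\<^sub>Q - E\<^sup>2 - E\<close>, and \<open>E\<close> is multiplication by \<open>k\<close> on forms
  of degree \<open>k\<close>.
\<close>

lemma casimir_form:
  assumes p: "p \<in> forms k"
  shows "casimir p v = qform B v * lap p v - of_nat k * (of_nat k + 1) * p v"
proof -
  have rp: "real_polynomial_function p" by (rule forms_polyf[OF p])
  let ?x = "\<lambda>i. coord i v" and ?D = "\<lambda>i. deriv_along i p v" and ?DD = "\<lambda>i j. deriv_along i (deriv_along j p) v"
  have comm: "?DD i j = ?DD j i" for i j
    unfolding deriv_along_def by (rule dir_deriv_commute[OF rp])
  have E1: "?x 1 * ?D 1 + ?x 2 * ?D 2 + ?x 3 * ?D 3 = of_nat k * p v"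
    using Euler_identity[OF p, of v] by (simp add: sum_3)
  have E2: "?x 1 * ?DD j 1 + ?x 2 * ?DD j 2 + ?x 3 * ?DD j 3 = (of_nat k - 1) * ?D j" for j
    using Euler_identity_derivative[OF p, of v j] by (simp add: sum_3)
  have "(of_nat k - 1) * (of_nat k * p v) = ?x 1 * ((of_nat k - 1) * ?D 1) + ?x 2 * ((of_nat k - 1) * ?D 2) + ?x 3 * ((of_nat k - 1) * ?D 3)"
    unfolding E1[symmetric] by (simp add: algebra_simps)
  also have "\<dots> = (?x 1)\<^sup>2 * ?DD 1 1 + (?x 2)\<^sup>2 * ?DD 2 2 + (?x 3)\<^sup>2 * ?DD 3 3
      + 2 * (?x 1 * ?x 2 * ?DD 1 2) + 2 * (?x 2 * ?x 3 * ?DD 2 3) + 2 * (?x 1 * ?x 3 * ?DD 1 3)"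
    unfolding E2[symmetric] by (simp add: comm[of 2 1] comm[of 3 1] comm[of 3 2] power2_eq_square algebra_simps)
  finally have second: "(?x 1)\<^sup>2 * ?DD 1 1 + (?x 2)\<^sup>2 * ?DD 2 2 + (?x 3)\<^sup>2 * ?DD 3 3
      + 2 * (?x 1 * ?x 2 * ?DD 1 2) + 2 * (?x 2 * ?x 3 * ?DD 2 3) + 2 * (?x 1 * ?x 3 * ?DD 1 3)
      = (of_nat k - 1) * (of_nat k * p v)" by simp
  have "casimir p v = ((?x 1)\<^sup>2 + (?x 2)\<^sup>2 + (?x 3)\<^sup>2) * (?DD 1 1 + ?DD 2 2 + ?DD 3 3)
     - ((?x 1)\<^sup>2 * ?DD 1 1 + (?x 2)\<^sup>2 * ?DD 2 2 + (?x 3)\<^sup>2 * ?DD 3 3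
      + 2 * (?x 1 * ?x 2 * ?DD 1 2) + 2 * (?x 2 * ?x 3 * ?DD 2 3) + 2 * (?x 1 * ?x 3 * ?DD 1 3))
     - 2 * (?x 1 * ?D 1 + ?x 2 * ?D 2 + ?x 3 * ?D 3)"
    by (simp add: casimir_def rot_field_square rp algebra_simps)
  also have "\<dots> = qform B v * lap p v - (of_nat k - 1) * (of_nat k * p v) - 2 * (of_nat k * p v)"
    unfolding second E1 by (simp add: qform_coords lap_def sum_3)
  finally show ?thesis by (simp add: algebra_simps)
qed

text \<open>
  The space \<open>V\<^sub>Q\<^sup>\<bottom>(k)\<close> is stable under the Casimir operator, which on forms of degree \<open>k\<close> differs from
  \<open>Q \<Delta>\<^sub>Q\<close> by a scalar; hence \<open>Q \<Delta>\<^sub>Q p\<close> lies both in this space and in \<open>V\<^sub>Q(k)\<close>.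
\<close>

lemma perp_harmonic:
  assumes p: "p \<in> perp k"
  shows "p \<in> Har_Q B k"
proof -
  have pf: "p \<in> forms k" by (rule perp_forms[OF p])
  have rp: "real_polynomial_function p" by (rule forms_polyf[OF pf])
  have cas: "casimir p \<in> perp k"
    unfolding casimir_def[abs_def] by (intro perp_add rot_field_perp p) simp_all
  have "(\<lambda>v. qform B v * lap p v) = (\<lambda>v. casimir p v + (of_nat k * (of_nat k + 1)) * p v)"
    by (simp add: casimir_form[OF pf])
  also have "\<dots> \<in> perp k" by (intro perp_add perp_cmult cas p)
  finally have mem: "(\<lambda>v. qform B v * lap p v) \<in> perp k" .
  have "(\<lambda>v. qform B v * lap p v) \<in> forms_Q B k"
    by (rule forms_QI[OF perp_forms[OF mem] lap_polyf[OF rp]]) simp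
  then have zero: "qform B v * lap p v = 0" for v
    using perp_inter_forms_Q[OF mem] by (simp add: fun_eq_iff)
  have "lap p v = 0" for v
  proof (rule polyf_zero_product[OF polyf_qform lap_polyf[OF rp] subspace_UNIV zero, of "U $ 1" v])
    show "qform B (U $ 1) \<noteq> 0" using coord_basis[of 1 1] by (simp add: qform_def coord_def)
  qed simp_all
  then show ?thesis using pf by (simp add: Har_Q_def laplacian_Q_eq_lap[OF rp])
qed

end

section \<open>Continuity of the multipoles\<close>

lemma simultaneous_convergent_subsequence:
  fixes L :: "nat \<Rightarrow> nat \<Rightarrow> 'a::heine_borel"
  assumes "\<And>\<nu>. \<nu> < k \<Longrightarrow> bounded (range (\<lambda>n. L n \<nu>))"
  shows "\<exists>r l. strict_mono (r :: nat \<Rightarrow> nat) \<and> (\<forall>\<nu><k. (\<lambda>n. L (r n) \<nu>) \<longlonglongrightarrow> l \<nu>)"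
  using assms
proof (induction k)
  case 0
  show ?case by (intro exI[of _ id]) (simp add: strict_mono_def)
next
  case (Suc k)
  then obtain r l where r: "strict_mono (r :: nat \<Rightarrow> nat)" "\<And>\<nu>. \<nu> < k \<Longrightarrow> (\<lambda>n. L (r n) \<nu>) \<longlonglongrightarrow> l \<nu>"
    by fastforce
  have "bounded (range (\<lambda>n. L (r n) k))"
    using Suc.prems[of k] by (rule bounded_subset) auto
  then obtain l' s where s: "strict_mono (s :: nat \<Rightarrow> nat)" "((\<lambda>n. L (r n) k) \<circ> s) \<longlonglongrightarrow> l'"
    using bounded_imp_convergent_subsequence by blast
  have "(\<lambda>n. L ((r \<circ> s) n) \<nu>) \<longlonglongrightarrow> (l(k := l')) \<nu>" if "\<nu> < Suc k" for \<nu>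
  proof (cases "\<nu> = k")
    case True
    then show ?thesis using s(2) by (simp add: o_def)
  next
    case False
    then have "\<nu> < k" using that by simp
    from LIMSEQ_subseq_LIMSEQ[OF r(2)[OF this] s(1)] show ?thesis using False by (simp add: o_def)
  qed
  then show ?case using strict_mono_o[OF r(1) s(1)] by blast
qed

text \<open>
  Together with vectors \<open>L\<close> of norm 1 this is a normal form of the representatives of a multipole, in
  which \<open>c = 0\<close> gives the zero multipole.
\<close>

definition scale_first :: "nat \<Rightarrow> real \<Rightarrow> (nat \<Rightarrow> real^3) \<Rightarrow> nat \<Rightarrow> real^3" where
  "scale_first k c L = (\<lambda>\<nu>\<in>{..<k}. if \<nu> = 0 then c *\<^sub>R L 0 else L \<nu>)"

lemma form_prod_scale_first:
  assumes "k \<noteq> 0"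
  shows "form_prod k (scale_first k c L) v = c * form_prod k L v"
proof -
  obtain j where j: "k = Suc j" using assms by (cases k) auto
  show ?thesis by (simp only: form_prod_def j prod.lessThan_Suc_shift) (simp add: scale_first_def)
qed

lemma scale_first_PiE: "scale_first k c L \<in> {..<k} \<rightarrow>\<^sub>E UNIV"
  by (simp add: scale_first_def)

lemma multipole_normal_form:
  assumes pd: "pos_def_form B" and k: "k \<noteq> 0" and w: "w \<in> multipoles k"
  shows "\<exists>c L. (\<forall>\<nu>. norm (L \<nu>) = 1) \<and> w = multipole_of k (scale_first k c L)"
proof -
  obtain L where L: "L \<in> {..<k} \<rightarrow>\<^sub>E UNIV" "w = multipole_of k L" using w k by (auto simp: multipoles_pos)
  obtain e :: "real^3" where e: "norm e = 1" using vector_choose_size[of 1] by auto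
  define M where "M \<nu> = (if L \<nu> = 0 then e else (1 / norm (L \<nu>)) *\<^sub>R L \<nu>)" for \<nu>
  define c where "c = (\<Prod>\<nu><k. norm (L \<nu>))"
  have M: "norm (M \<nu>) = 1" for \<nu> using e by (simp add: M_def)
  have LM: "L \<nu> = norm (L \<nu>) *\<^sub>R M \<nu>" for \<nu> by (simp add: M_def)
  have "L \<nu> \<bullet> v = norm (L \<nu>) * (M \<nu> \<bullet> v)" for \<nu> v
    using arg_cong[OF LM[of \<nu>], of "\<lambda>x. x \<bullet> v"] by simp
  then have "form_prod k L v = (\<Prod>\<nu><k. norm (L \<nu>) * (M \<nu> \<bullet> v))" for v
    unfolding form_prod_def by (intro prod.cong) simp_all
  then have "form_prod k L v = c * form_prod k M v" for v
    by (simp add: c_def form_prod_def prod.distrib)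
  then have "(\<lambda>v. Theta k w v - Theta k (multipole_of k (scale_first k c M)) v) = (\<lambda>v. 0)"
    by (simp add: L Theta_multipole_of scale_first_PiE form_prod_scale_first[OF k])
  then have "w = multipole_of k (scale_first k c M)"
    using k forms_Q_zero by (intro Theta_injective_modulo_qform[OF pd w]) (auto simp: multipoles_pos scale_first_PiE)
  then show ?thesis using M by blast
qed

context quadric_measure
begin

lemma component_cong:
  assumes "\<And>v. v \<in> qsurface B \<Longrightarrow> f v = g v"
  shows "component f k = component g k"
proof -
  have "l2_inner m (\<lambda>v. f v - q v) r = l2_inner m (\<lambda>v. g v - q v) r" for q r
    by (rule l2_inner_cong) (simp_all add: assms)
  then show ?thesis by (simp add: orth_proj_def)
qed

lemma l2_inner_tendsto:
  assumes "\<And>n. l2_integrable m (p n)" "l2_integrable m q" "l2_integrable m h"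
    and "(\<lambda>n. l2_norm m (\<lambda>v. p n v - q v)) \<longlonglongrightarrow> 0"
  shows "(\<lambda>n. l2_inner m (p n) h) \<longlonglongrightarrow> l2_inner m q h"
proof (rule LIM_zero_cancel, rule Lim_null_comparison)
  have "\<bar>l2_inner m (p n) h - l2_inner m q h\<bar> \<le> l2_norm m (\<lambda>v. p n v - q v) * l2_norm m h" for n
    using l2_Cauchy_Schwarz[OF l2_integrable_diff[OF assms(1,2)] assms(3), of n]
    by (simp add: l2_inner_diff assms)
  then show "\<forall>\<^sub>F n in sequentially. norm (l2_inner m (p n) h - l2_inner m q h) \<le> l2_norm m (\<lambda>v. p n v - q v) * l2_norm m h"
    by simp
  show "(\<lambda>n. l2_norm m (\<lambda>v. p n v - q v) * l2_norm m h) \<longlonglongrightarrow> 0"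
    using tendsto_mult[OF assms(4) tendsto_const[of "l2_norm m h"]] by simp
qed

lemma form_prod_tendsto:
  assumes cpt: "compact (qsurface B)"
    and L: "\<And>n \<nu>. norm (L n \<nu>) = 1" "\<And>\<nu>. \<nu> < k \<Longrightarrow> (\<lambda>n. L n \<nu>) \<longlonglongrightarrow> l \<nu>"
    and l: "\<And>\<nu>. \<nu> < k \<Longrightarrow> norm (l \<nu>) = 1"
  shows "(\<lambda>n. l2_norm m (\<lambda>v. form_prod k (L n) v - form_prod k l v)) \<longlonglongrightarrow> 0"
proof -
  obtain R where R: "\<And>v. v \<in> qsurface B \<Longrightarrow> norm v \<le> R"
    using compact_imp_bounded[OF cpt] by (auto simp: bounded_iff)
  have bound: "\<bar>form_prod k M v\<bar> \<le> R ^ k" if M: "\<And>\<nu>. \<nu> < k \<Longrightarrow> norm (M \<nu>) = 1" and v: "v \<in> qsurface B" for M v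
  proof -
    have "\<bar>form_prod k M v\<bar> = (\<Prod>\<nu><k. \<bar>M \<nu> \<bullet> v\<bar>)" by (simp add: form_prod_def abs_prod)
    also have "\<dots> \<le> (\<Prod>\<nu><k. R)"
    proof (intro prod_mono conjI)
      fix \<nu> assume "\<nu> \<in> {..<k}"
      then show "\<bar>M \<nu> \<bullet> v\<bar> \<le> R" using Cauchy_Schwarz_ineq2[of "M \<nu>" v] M[of \<nu>] R[OF v] by simp
    qed simp
    finally show ?thesis by simp
  qed
  let ?d = "\<lambda>n v. form_prod k (L n) v - form_prod k l v"
  have rp: "real_polynomial_function (?d n)" for n
    by (intro real_polynomial_function_diff forms_polyf[OF form_prod_in_forms])
  have "(\<lambda>n. LINT v|m. (?d n v)\<^sup>2) \<longlonglongrightarrow> (LINT v|m. 0)"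
  proof (rule integral_dominated_convergence[where w = "\<lambda>_. (2 * R ^ k)\<^sup>2"])
    show "(\<lambda>v. (?d n v)\<^sup>2) \<in> borel_measurable m" for n
      using poly_L2[OF rp] by (auto simp: l2_integrable_def intro: borel_measurable_integrable)
    show "integrable m (\<lambda>_. (2 * R ^ k)\<^sup>2)"
      using finite_measure.integrable_const[OF finite_measure_m] .
    show "AE v in m. (\<lambda>n. (?d n v)\<^sup>2) \<longlonglongrightarrow> 0"
    proof (intro AE_I2)
      fix v
      have "(\<lambda>n. form_prod k (L n) v) \<longlonglongrightarrow> form_prod k l v"
        unfolding form_prod_def using L(2) by (intro tendsto_prod tendsto_inner tendsto_const) auto
      from tendsto_power[OF LIM_zero[OF this], of 2] show "(\<lambda>n. (?d n v)\<^sup>2) \<longlonglongrightarrow> 0" by simp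
    qed
    show "AE v in m. norm ((?d n v)\<^sup>2) \<le> (2 * R ^ k)\<^sup>2" for n
    proof (intro AE_I2)
      fix v assume "v \<in> space m"
      then have v: "v \<in> qsurface B" by (simp add: space_m)
      have "\<bar>?d n v\<bar> \<le> 2 * R ^ k" using bound[of "L n" v] bound[of l v] L(1) l v by fastforce
      then have "\<bar>?d n v\<bar>\<^sup>2 \<le> (2 * R ^ k)\<^sup>2" by (intro power_mono) simp_all
      then show "norm ((?d n v)\<^sup>2) \<le> (2 * R ^ k)\<^sup>2" by simp
    qed
  qed simp
  then have "(\<lambda>n. sqrt (LINT v|m. (?d n v)\<^sup>2)) \<longlonglongrightarrow> sqrt 0" by (intro tendsto_real_sqrt) simp
  then show ?thesis by (simp add: l2_norm_def l2_inner_def power2_eq_square)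
qed

lemma component_norm_tendsto:
  assumes "\<And>n. l2_integrable m (p n)" "l2_integrable m q"
    and lim: "(\<lambda>n. l2_norm m (\<lambda>v. p n v - q v)) \<longlonglongrightarrow> 0"
  shows "(\<lambda>n. l2_norm m (\<lambda>v. component (p n) k v - component q k v)) \<longlonglongrightarrow> 0"
proof (rule Lim_null_comparison[OF _ lim], intro always_eventually allI)
  fix n
  show "norm (l2_norm m (\<lambda>v. component (p n) k v - component q k v)) \<le> l2_norm m (\<lambda>v. p n v - q v)"
    using component_norm_le[OF l2_integrable_diff[OF assms(1,2)], of k n]
    by (simp add: component_diff assms l2_norm_nonneg)
qed

lemma Phi_injective:
  assumes pd: "pos_def_form B" and w: "w \<in> multipoles k" "w' \<in> multipoles k"
    and eq: "Phi m B k w = Phi m B k w'"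
  shows "w = w'"
proof (rule Theta_injective_modulo_qform[OF pd w])
  have "(\<lambda>v. (Theta k w v - Phi m B k w v) - (Theta k w' v - Phi m B k w' v)) \<in> forms_Q B k"
    by (intro forms_Q_diff Theta_Phi_diff w)
  then show "(\<lambda>v. Theta k w v - Theta k w' v) \<in> forms_Q B k" by (simp add: eq)
qed

lemma representing_Phi:
  assumes "l2_integrable m f" "representing m B f w"
  shows "w k \<in> multipoles k" "Phi m B k (w k) = component f k"
  using assms orth_decomposition_unique[OF assms(1)] by (auto simp: representing_def)

lemma representing_unique:
  assumes "pos_def_form B" "l2_integrable m f" "representing m B f w" "representing m B f w'"
  shows "w k = w' k"
  using representing_Phi[OF assms(2,3)] representing_Phi[OF assms(2,4)]
  by (intro Phi_injective[OF assms(1)]) auto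

lemma representingI:
  assumes "l2_integrable m f" "poly_approximable f"
    and "\<And>k. w k \<in> multipoles k" "\<And>k. Phi m B k (w k) = component f k"
  shows "representing m B f w"
  unfolding representing_def using assms orth_decomposition_components by blast

lemma multipole_with_component:
  assumes irred: "irreducible_poly_fun (qform B)" and f: "l2_integrable m f"
  shows "\<exists>w\<in>multipoles k. Phi m B k w = component f k"
proof -
  have c: "component f k \<in> perp k" by (rule component_perp[OF f])
  obtain w where w: "w \<in> multipoles k" "(\<lambda>v. component f k v - Theta k w v) \<in> forms_Q B k"
    using Theta_surjective_modulo_qform[OF symB irred perp_forms[OF c]] .
  have "(\<lambda>v. Theta k w v - component f k v) \<in> forms_Q B k"
    using forms_Q_cmult[OF w(2), of "- 1"] by simp
  then show ?thesis using Phi_eqI[OF w(1) c] w(1) by blast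
qed

text \<open>
  A limit of multipoles is found among normalised representatives: by compactness the unit vectors
  converge along a subsequence, and since the projection of a product of unit linear forms never
  vanishes, the scalar factors converge too.
\<close>

lemma multipole_limit:
  assumes pd: "pos_def_form B" and k: "k \<noteq> 0"
    and w: "\<And>n. w n \<in> multipoles k" and w0: "w0 \<in> multipoles k"
    and lim: "\<And>q. q \<in> perp k \<Longrightarrow> (\<lambda>n. l2_inner m (Phi m B k (w n)) q) \<longlonglongrightarrow> l2_inner m (Phi m B k w0) q"
  shows "\<exists>M l r. strict_mono (r :: nat \<Rightarrow> nat) \<and> (\<forall>n. w (r n) = multipole_of k (M n)) \<and>
    w0 = multipole_of k l \<and> limitin (product_topology (\<lambda>_. euclidean) {..<k}) M l sequentially"
proof -
  have "\<forall>n. \<exists>c L. (\<forall>\<nu>. norm (L \<nu>) = 1) \<and> w n = multipole_of k (scale_first k c L)"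
    using multipole_normal_form[OF pd k w] by blast
  then obtain c L where L: "\<And>n \<nu>. norm (L n \<nu>) = 1" and wn: "\<And>n. w n = multipole_of k (scale_first k (c n) (L n))"
    by metis
  have "bounded (range (\<lambda>n. L n \<nu>))" for \<nu> by (auto simp: bounded_iff L intro!: exI[of _ 1])
  then obtain r l where r: "strict_mono (r :: nat \<Rightarrow> nat)" and l: "\<And>\<nu>. \<nu> < k \<Longrightarrow> (\<lambda>n. L (r n) \<nu>) \<longlonglongrightarrow> l \<nu>"
    using simultaneous_convergent_subsequence[of k L] by blast
  have l1: "norm (l \<nu>) = 1" if "\<nu> < k" for \<nu>
    using tendsto_norm[OF l[OF that]] by (simp add: L LIMSEQ_const_iff)
  let ?p = "\<lambda>n. form_prod k (L n)" and ?q = "form_prod k l"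
  let ?P = "\<lambda>n. component (?p n) k" and ?Q = "component ?q k"
  have fp: "form_prod k M \<in> forms k" for M by (rule form_prod_in_forms)
  have Pp: "?P n \<in> perp k" "?Q \<in> perp k" for n by (intro component_perp form_L2[OF fp])+
  have "(\<lambda>n. l2_norm m (\<lambda>v. ?p (r n) v - ?q v)) \<longlonglongrightarrow> 0"
    by (rule form_prod_tendsto[OF pos_def_compact[OF pd] L l l1])
  then have "(\<lambda>n. l2_norm m (\<lambda>v. ?P (r n) v - ?Q v)) \<longlonglongrightarrow> 0"
    by (intro component_norm_tendsto form_L2[OF fp])
  then have limP: "(\<lambda>n. l2_inner m (?P (r n)) h) \<longlonglongrightarrow> l2_inner m ?Q h" if "h \<in> perp k" for h
    by (rule l2_inner_tendsto[OF perp_L2[OF Pp(1)] perp_L2[OF Pp(2)] perp_L2[OF that]])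
  have QQ: "l2_inner m ?Q ?Q \<noteq> 0"
  proof
    assume "l2_inner m ?Q ?Q = 0"
    then have "?Q = (\<lambda>v. 0)" by (rule inner_definite[OF perp_forms[OF Pp(2)]])
    then have "(\<lambda>v. 1 * ?q v) \<in> forms_Q B k" using component_form_diff[OF fp, of l] by simp
    moreover have "l \<nu> \<noteq> 0" if "\<nu> < k" for \<nu> using l1[OF that] by auto
    ultimately show False using linear_product_not_in_forms_Q[OF pd, of k l 1] by simp
  qed
  have Phi_scale: "Phi m B k (multipole_of k (scale_first k a M)) = (\<lambda>v. a * component (form_prod k M) k v)" for a M
  proof -
    have "Theta k (multipole_of k (scale_first k a M)) = (\<lambda>v. a * form_prod k M v)"
      by (simp add: Theta_multipole_of scale_first_PiE form_prod_scale_first[OF k] fun_eq_iff)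
    then show ?thesis unfolding Phi_def by (simp add: component_cmult[OF form_L2[OF fp]])
  qed
  have inner_w: "l2_inner m (Phi m B k (w n)) h = c n * l2_inner m (?P n) h" for n h
    by (simp add: wn Phi_scale l2_inner_cmult)
  \<comment> \<open>the scalar factors are quotients of inner products, whose limit is known\<close>
  define c0 where "c0 = l2_inner m (Phi m B k w0) ?Q / l2_inner m ?Q ?Q"
  have c_lim: "(\<lambda>n. c (r n)) \<longlonglongrightarrow> c0"
  proof (rule Lim_transform_eventually)
    show "(\<lambda>n. l2_inner m (Phi m B k (w (r n))) ?Q / l2_inner m (?P (r n)) ?Q) \<longlonglongrightarrow> c0"
      unfolding c0_def
      using LIMSEQ_subseq_LIMSEQ[OF lim[OF Pp(2)] r] by (intro tendsto_divide limP Pp(2) QQ) (simp add: o_def)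
    have "\<forall>\<^sub>F n in sequentially. l2_inner m (?P (r n)) ?Q \<noteq> 0"
      by (rule tendsto_imp_eventually_ne[OF limP[OF Pp(2)] QQ])
    then show "\<forall>\<^sub>F n in sequentially. l2_inner m (Phi m B k (w (r n))) ?Q / l2_inner m (?P (r n)) ?Q = c (r n)"
      by eventually_elim (simp add: inner_w)
  qed
  have "Phi m B k w0 = (\<lambda>v. c0 * ?Q v)"
  proof -
    let ?d = "\<lambda>v. Phi m B k w0 v - c0 * ?Q v"
    have d: "?d \<in> perp k" by (intro perp_diff perp_cmult Phi_perp w0 Pp)
    have "(\<lambda>n. c (r n) * l2_inner m (?P (r n)) ?d) \<longlonglongrightarrow> c0 * l2_inner m ?Q ?d"
      by (intro tendsto_mult c_lim limP d)
    moreover have "(\<lambda>n. c (r n) * l2_inner m (?P (r n)) ?d) \<longlonglongrightarrow> l2_inner m (Phi m B k w0) ?d"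
      using LIMSEQ_subseq_LIMSEQ[OF lim[OF d] r] by (simp add: o_def inner_w)
    ultimately have "c0 * l2_inner m ?Q ?d = l2_inner m (Phi m B k w0) ?d" by (rule LIMSEQ_unique)
    then have "l2_inner m ?d ?d = 0"
      by (simp add: l2_inner_diff l2_inner_cmult perp_L2[OF d] perp_L2[OF Phi_perp[OF w0]]
          l2_integrable_cmult perp_L2[OF Pp(2)])
    then have "?d = (\<lambda>v. 0)" by (rule inner_definite[OF perp_forms[OF d]])
    then show ?thesis by (simp add: fun_eq_iff)
  qed
  then have w0_eq: "w0 = multipole_of k (scale_first k c0 l)"
    using k by (intro Phi_injective[OF pd w0]) (simp_all add: Phi_scale multipoles_pos scale_first_PiE)
  have "limitin (product_topology (\<lambda>_. euclidean) {..<k})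
    (\<lambda>n. scale_first k (c (r n)) (L (r n))) (scale_first k c0 l) sequentially"
    unfolding limitin_componentwise
  proof (intro conjI ballI)
    show "scale_first k c0 l \<in> extensional {..<k}" by (simp add: scale_first_def)
    fix \<nu> assume \<nu>: "\<nu> \<in> {..<k}"
    show "limitin euclidean (\<lambda>n. scale_first k (c (r n)) (L (r n)) \<nu>) (scale_first k c0 l \<nu>) sequentially"
      using \<nu> k l[of \<nu>] l[of 0] c_lim by (auto simp: scale_first_def intro!: tendsto_scaleR)
  qed (simp add: scale_first_def)
  then show ?thesis using r wn w0_eq
    by (intro exI[of _ "\<lambda>n. scale_first k (c (r n)) (L (r n))"] exI[of _ "scale_first k c0 l"] exI[of _ r] conjI allI)
qed

text \<open>
  In the quotient topology it suffices to lift, along subsequences, convergent sequences of multipoles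
  to convergent sequences of tuples.
\<close>

lemma multipole_path_continuous:
  fixes u :: "real \<Rightarrow> multipole"
  assumes pd: "pos_def_form B" and u: "\<And>t. t \<in> T \<Longrightarrow> u t \<in> multipoles k"
    and cont: "\<And>q. q \<in> perp k \<Longrightarrow> continuous_on T (\<lambda>t. l2_inner m (Phi m B k (u t)) q)"
  shows "continuous_map (top_of_set T) (multipole_topology k) u"
  unfolding continuous_map_def
proof (intro conjI allI impI)
  show "u \<in> topspace (top_of_set T) \<rightarrow> topspace (multipole_topology k)"
    using u by (simp add: topspace_multipole_topology)
  fix V assume V: "openin (multipole_topology k) V"
  show "openin (top_of_set T) {t \<in> topspace (top_of_set T). u t \<in> V}"
  proof (cases "k = 0")
    case True
    have "\<forall>t\<in>T. \<exists>c. u t = Scalar_Multipole c" using u True by (auto simp: multipoles_def)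
    then obtain c where c: "\<And>t. t \<in> T \<Longrightarrow> u t = Scalar_Multipole (c t)" by metis
    let ?one = "\<lambda>v::real^3. 1::real"
    have one: "?one \<in> perp 0" by (auto simp: forms_Q_perp_def forms_def forms_Q_0 l2_inner_def)
    have "l2_inner m ?one ?one \<noteq> 0" using inner_definite[OF perp_forms[OF one]] by (metis zero_neq_one)
    moreover have "Phi m B k (u t) = (\<lambda>v. c t * ?one v)" if "t \<in> T" for t
    proof (rule Phi_eqI[OF u[OF that]])
      show "(\<lambda>v. c t * ?one v) \<in> perp k" using perp_cmult[OF one] True by simp
      show "(\<lambda>v. Theta k (u t) v - c t * ?one v) \<in> forms_Q B k" by (simp add: c[OF that] forms_Q_zero)
    qed
    ultimately have "c t = l2_inner m (Phi m B k (u t)) ?one / l2_inner m ?one ?one" if "t \<in> T" for t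
      using that l2_inner_cmult[of m "c t" ?one ?one] by simp
    moreover have "continuous_on T (\<lambda>t. l2_inner m (Phi m B k (u t)) ?one / l2_inner m ?one ?one)"
      using one True \<open>l2_inner m ?one ?one \<noteq> 0\<close> by (intro continuous_on_divide cont continuous_on_const) auto
    ultimately have c_cont: "continuous_on T c" using continuous_on_eq by fastforce
    have "open {x. Scalar_Multipole x \<in> V}"
      using V True by (simp add: multipole_topology_def openin_quotient_topology)
    then have "openin (top_of_set T) (T \<inter> c -` {x. Scalar_Multipole x \<in> V})"
      using c_cont continuous_openin_preimage_gen by blast
    moreover have "T \<inter> c -` {x. Scalar_Multipole x \<in> V} = {t \<in> topspace (top_of_set T). u t \<in> V}"
      using c by auto
    ultimately show ?thesis by simp
  next
    case False
    let ?X = "product_topology (\<lambda>_. euclidean) {..<k} :: (nat \<Rightarrow> real^3) topology"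
    have pre: "openin ?X {L \<in> topspace ?X. multipole_of k L \<in> V}"
      using V False by (simp add: multipole_topology_def openin_quotient_topology)
    have "\<exists>e>0. \<forall>s\<in>T. dist s t < e \<longrightarrow> u s \<in> V" if t: "t \<in> T" "u t \<in> V" for t
    proof (rule ccontr)
      assume "\<not> ?thesis"
      then have "\<forall>n. \<exists>s. s \<in> T \<and> dist s t < 1 / of_nat (Suc n) \<and> u s \<notin> V"
        by (metis of_nat_0_less_iff zero_less_Suc zero_less_divide_1_iff)
      then obtain s where s: "\<And>n. s n \<in> T" "\<And>n. dist (s n) t < 1 / of_nat (Suc n)" "\<And>n. u (s n) \<notin> V" by metis
      have "(\<lambda>n. dist (s n) t) \<longlonglongrightarrow> 0"
      proof (rule Lim_null_comparison)
        show "\<forall>\<^sub>F n in sequentially. norm (dist (s n) t) \<le> 1 / of_nat (Suc n)"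
          using s(2) by (intro always_eventually allI) (simp add: less_imp_le)
        show "(\<lambda>n. 1 / of_nat (Suc n) :: real) \<longlonglongrightarrow> 0"
          by (rule LIMSEQ_Suc[OF lim_1_over_n])
      qed
      then have st: "s \<longlonglongrightarrow> t" by (rule tendsto_dist_iff[THEN iffD2])
      have "(\<lambda>n. l2_inner m (Phi m B k (u (s n))) q) \<longlonglongrightarrow> l2_inner m (Phi m B k (u t)) q" if "q \<in> perp k" for q
        using continuous_on_tendsto_compose[OF cont[OF that] st t(1)] s(1) by simp
      from multipole_limit[OF pd False u[OF s(1)] u[OF t(1)] this]
      obtain M l r where M: "\<And>n. u (s (r n)) = multipole_of k (M n)" "u t = multipole_of k l"
        "limitin ?X M l sequentially" by blast
      have "l \<in> {L \<in> topspace ?X. multipole_of k L \<in> V}"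
        using limitin_topspace[OF M(3)] M(2) t(2) by simp
      then have "\<forall>\<^sub>F n in sequentially. M n \<in> {L \<in> topspace ?X. multipole_of k L \<in> V}"
        using M(3) pre unfolding limitin_def by blast
      then obtain n where "multipole_of k (M n) \<in> V" by (auto simp: eventually_sequentially)
      then show False using M(1) s(3) by metis
    qed
    then show ?thesis by (auto simp: openin_euclidean_subtopology_iff)
  qed
qed

lemma l2_inner_deformation_continuous:
  assumes cpt: "compact (qsurface B)" and g: "continuous_deformation (qsurface B) g"
    and q: "l2_integrable m q"
  shows "continuous_on {0..1} (\<lambda>t. l2_inner m (g t) q)"
  unfolding continuous_on_def
proof
  fix t :: real assume t: "t \<in> {0..1}"
  have L2: "l2_integrable m (g s)" if "s \<in> {0..1}" for s
    using g that by (intro continuous_L2 cpt) (simp add: continuous_deformation_def)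
  have unif: "uniform_limit (qsurface B) g (g t) (at t within {0..1})"
    using g t by (simp add: continuous_deformation_def)
  define K where "K = sqrt (measure m (space m)) * l2_norm m q + 1"
  have K: "K > 0" by (simp add: K_def add_nonneg_pos l2_norm_nonneg)
  show "((\<lambda>t. l2_inner m (g t) q) \<longlongrightarrow> l2_inner m (g t) q) (at t within {0..1})"
  proof (rule tendstoI)
    fix e :: real assume e: "e > 0"
    have "\<forall>\<^sub>F s in at t within {0..1}. \<forall>v\<in>qsurface B. dist (g s v) (g t v) < e / K"
      using unif e K by (simp add: uniform_limit_iff)
    moreover have "\<forall>\<^sub>F s in at t within {0..1}. s \<in> {0..1}"
      by (simp add: eventually_at_filter)
    ultimately show "\<forall>\<^sub>F s in at t within {0..1}. dist (l2_inner m (g s) q) (l2_inner m (g t) q) < e"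
    proof eventually_elim
      case (elim s)
      have d: "l2_integrable m (\<lambda>v. g s v - g t v)" by (intro l2_integrable_diff L2 elim t)
      have "l2_norm m (\<lambda>v. g s v - g t v) \<le> (e / K) * sqrt (measure m (space m))"
        using elim e K by (intro l2_norm_uniform_bound d) (auto simp: dist_real_def intro: less_imp_le)
      then have "l2_norm m (\<lambda>v. g s v - g t v) * l2_norm m q \<le> (e / K) * sqrt (measure m (space m)) * l2_norm m q"
        by (intro mult_right_mono l2_norm_nonneg)
      also have "\<dots> = (e / K) * (K - 1)" by (simp add: K_def)
      also have "\<dots> < e" using e K by (simp add: field_simps)
      finally show ?case
        using l2_Cauchy_Schwarz[OF d q] l2_inner_diff[OF L2[OF elim(2)] L2[OF t] q] by (simp add: dist_real_def)
    qed
  qed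
qed

lemma deformation_multipoles:
  assumes pd: "pos_def_form B" and irred: "irreducible_poly_fun (qform B)"
    and g: "continuous_deformation (qsurface B) g"
  obtains u where "representing_deformation m B g u"
proof -
  have cpt: "compact (qsurface B)" by (rule pos_def_compact[OF pd])
  have gc: "continuous_on (qsurface B) (g t)" if "t \<in> {0..1}" for t
    using g that by (simp add: continuous_deformation_def)
  have L2: "l2_integrable m (g t)" if "t \<in> {0..1}" for t
    by (rule continuous_L2[OF gc[OF that] cpt])
  have "\<forall>t k. \<exists>w. t \<in> {0..1} \<longrightarrow> w \<in> multipoles k \<and> Phi m B k w = component (g t) k"
    using multipole_with_component[OF irred L2] by blast
  then obtain u where u: "\<And>t k. t \<in> {0..1} \<Longrightarrow> u t k \<in> multipoles k"
    "\<And>t k. t \<in> {0..1} \<Longrightarrow> Phi m B k (u t k) = component (g t) k" by metis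
  have "representing m B (g t) (u t)" if "t \<in> {0..1}" for t
    using that by (intro representingI L2 continuous_poly_approximable gc cpt u)
  moreover have "continuous_map (top_of_set {0..1}) (multipole_topology k) (\<lambda>t. u t k)" for k
  proof (rule multipole_path_continuous[OF pd u(1)])
    fix q assume q: "q \<in> perp k"
    have "l2_inner m (Phi m B k (u t k)) q = l2_inner m (g t) q" if "t \<in> {0..1}" for t
      using component_inner[OF L2[OF that] q] u(2)[OF that] by simp
    then show "continuous_on {0..1} (\<lambda>t. l2_inner m (Phi m B k (u t k)) q)"
      by (intro continuous_on_eq[OF l2_inner_deformation_continuous[OF cpt g perp_L2[OF q]]]) simp
  qed
  ultimately have "representing_deformation m B g u" unfolding representing_deformation_def by blast
  then show ?thesis by (rule that)
qed

end

theorem theorem22: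
  fixes B :: "real^3^3" and m :: "(real^3) measure" and f :: "real^3 \<Rightarrow> real"
  assumes sym: "transpose B = B"
    and irred: "irreducible_poly_fun (qform B)"
    and borel: "sets m = sets (restrict_space borel (qsurface B))"
    and poly_L2: "\<And>p. real_polynomial_function p \<Longrightarrow> l2_integrable m p"
    and inner_product: "\<And>k p. p \<in> forms k \<Longrightarrow> l2_inner m p p = 0 \<Longrightarrow> p = (\<lambda>v. 0)"
    and odd_moments: "\<And>k p. odd k \<Longrightarrow> p \<in> forms k \<Longrightarrow> (LINT v|m. p v) = 0"
    and dense: "\<not> compact (qsurface B) \<Longrightarrow> polys_dense_in_l2 m"
    and f_cont: "continuous_on (qsurface B) f"
    and f_L2: "l2_integrable m f"
  shows "\<exists>w. (\<forall>k. w k \<in> multipoles k) \<and>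
     \<comment> \<open>(1)\<close>
     (\<forall>k. Phi m B k (w k) \<in> forms_Q_perp m B k) \<and>
     (\<forall>j k. j \<noteq> k \<longrightarrow> l2_inner m (Phi m B j (w j)) (Phi m B k (w k)) = 0) \<and>
     (\<forall>F. orth_decomposition m B f F \<longrightarrow> (\<forall>k. F k = Phi m B k (w k))) \<and>
     \<comment> \<open>(2)\<close>
     converges_in_l2 m (\<lambda>d v. \<Sum>k\<le>d. Phi m B k (w k) v) f \<and>
     \<comment> \<open>(3)\<close>
     summable (\<lambda>k. (sin (theta m B k))\<^sup>2 * (rho_zero m k (w k))\<^sup>2) \<and>
     (pos_def_form B \<longrightarrow>
        \<comment> \<open>(4)\<close>
        (form_invariant_measure m B \<longrightarrow> (\<forall>k. Phi m B k (w k) \<in> Har_Q B k)) \<and>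
        \<comment> \<open>(5)\<close>
        (\<forall>w'. representing m B f w' \<longrightarrow> (\<forall>k. w' k = w k)) \<and>
        \<comment> \<open>(6)\<close>
        (\<forall>g. continuous_deformation (qsurface B) g \<and> (\<forall>v\<in>qsurface B. g 0 v = f v) \<longrightarrow>
           (\<exists>u. representing_deformation m B g u \<and> (\<forall>k. u 0 k = w k) \<and>
              (\<forall>u'. representing_deformation m B g u' \<and> (\<forall>k. u' 0 k = w k) \<longrightarrow>
                 (\<forall>t\<in>{0..1}. \<forall>k. u' t k = u t k)))))"
proof -
  interpret quadric_measure B m
    by unfold_locales (fact sym borel poly_L2 inner_product odd_moments)+
  have approx: "poly_approximable f"
  proof (cases "compact (qsurface B)")
    case True
    then show ?thesis by (rule continuous_poly_approximable[OF f_cont])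
  next
    case False
    then show ?thesis using dense f_L2 by (simp add: polys_dense_in_l2_def poly_approximable_def)
  qed
  have "\<forall>k. \<exists>w. w \<in> multipoles k \<and> Phi m B k w = component f k"
    using multipole_with_component[OF irred f_L2] by blast
  then obtain w where w: "\<And>k. w k \<in> multipoles k" "\<And>k. Phi m B k (w k) = component f k" by metis
  have rep: "representing m B f w" by (rule representingI[OF f_L2 approx w])
  show ?thesis
  proof (intro exI[of _ w] conjI impI allI)
    show "w k \<in> multipoles k" for k by (rule w)
    show perp: "Phi m B k (w k) \<in> perp k" for k by (rule Phi_perp[OF w(1)])
    show "l2_inner m (Phi m B j (w j)) (Phi m B k (w k)) = 0" if "j \<noteq> k" for j k
      by (rule perp_orthogonal[OF that perp perp])
    show "F k = Phi m B k (w k)" if "orth_decomposition m B f F" for F k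
      using orth_decomposition_unique[OF f_L2 that] by (simp add: w)
    show "converges_in_l2 m (\<lambda>d v. \<Sum>k\<le>d. Phi m B k (w k) v) f"
      unfolding w by (rule components_converge[OF f_L2 approx])
    show "summable (\<lambda>k. (sin (theta m B k))\<^sup>2 * (rho_zero m k (w k))\<^sup>2)"
      using sin_theta_rho_bound[OF w(1)]
      by (intro summable_comparison_test'[OF Bessel_summable[OF f_L2], of 0]) (simp add: w)
  next
    fix k assume "pos_def_form B" "form_invariant_measure m B"
    moreover obtain U :: "real^3^3" where "U ** B ** transpose U = mat 1"
      using orthonormal_basis_exists[OF sym \<open>pos_def_form B\<close>] .
    ultimately interpret rotation_invariant_measure B m U by unfold_locales
    show "Phi m B k (w k) \<in> Har_Q B k" by (intro perp_harmonic Phi_perp w)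
  next
    fix w' k assume "pos_def_form B" "representing m B f w'"
    then show "w' k = w k" using representing_unique[OF _ f_L2 _ rep] by blast
  next
    fix g assume pd: "pos_def_form B"
      and g: "continuous_deformation (qsurface B) g \<and> (\<forall>v\<in>qsurface B. g 0 v = f v)"
    obtain u where u: "representing_deformation m B g u" using deformation_multipoles[OF pd irred] g by blast
    have L2: "l2_integrable m (g t)" if "t \<in> {0..1}" for t
      using g that by (intro continuous_L2 pos_def_compact[OF pd]) (simp add: continuous_deformation_def)
    have rep_u: "representing m B (g t) (u t)" if "t \<in> {0..1}" for t
      using u that by (simp add: representing_deformation_def)
    have "u 0 k = w k" for k
    proof (rule Phi_injective[OF pd _ w(1)])
      have 0: "(0::real) \<in> {0..1}" by simp
      show "u 0 k \<in> multipoles k" by (rule representing_Phi[OF L2[OF 0] rep_u[OF 0]])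
      have "component (g 0) k = component f k" using g by (intro component_cong) simp
      then show "Phi m B k (u 0 k) = Phi m B k (w k)"
        using representing_Phi(2)[OF L2[OF 0] rep_u[OF 0]] w(2) by simp
    qed
    moreover have "u' t k = u t k" if "representing_deformation m B g u'" "t \<in> {0..1}" for u' t k
      using that by (intro representing_unique[OF pd L2 _ rep_u]) (simp_all add: representing_deformation_def)
    ultimately show "\<exists>u. representing_deformation m B g u \<and> (\<forall>k. u 0 k = w k) \<and>
      (\<forall>u'. representing_deformation m B g u' \<and> (\<forall>k. u' 0 k = w k) \<longrightarrow> (\<forall>t\<in>{0..1}. \<forall>k. u' t k = u t k))"
      using u by blast
  qed
qed

end
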